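(* Let $d\in\{2,3\}$ and $\alpha\in(0,2)$. Let $u\in C^6(\mathbb{R}^d)$ be a compactly supported real-valued function. Let $w\in C^3(\mathbb{R})$ be a compactly supported real-valued function that is symmetric about $0$ (i.e. $w(z)=w(-z)$ for all $z$), satisfies $0\le w(z)\le 1$ for all $z\in\mathbb{R}$, and satisfies $1-w(z)=O(|z|^3)$ as $z\to 0$. For $h>0$ and $\mathbf{j}\in\mathbb{Z}^d$ put $\mathbf{y}_{\mathbf{j}}=h\,\mathbf{j}$, and define $$A_{1,d}=\sum_{\mathbf{j}\in\mathbb{Z}^d\setminus\{\mathbf{0}\}}\frac{1}{|\mathbf{y}_{\mathbf{j}}|^{d+\alpha}},\qquad A_{2,d}=\frac12\sum_{\mathbf{j}\in\mathbb{Z}^d\setminus\{\mathbf{0}\}}\frac{w(|\mathbf{y}_{\mathbf{j}}|)\,(\mathbf{e}_1^T\mathbf{y}_{\mathbf{j}})^2}{|\mathbf{y}_{\mathbf{j}}|^{d+\alpha}}.$$ Then, as $h\to 0$, $$C_{\alpha,d}\int_{\mathbb{R}^d}\frac{u(\mathbf{0})-u(\mathbf{y})+w(|\mathbf{y}|)\sum_{1\le|\beta|\le 3}\frac{D^\beta u(\mathbf{0})}{\beta!}\mathbf{y}^\beta}{|\mathbf{y}|^{d+\alpha}}\,d\mathbf{y} = C_{\alpha,d}h^d\left[A_{1,d}\,u(\mathbf{0})-\sum_{\mathbf{j}\in\mathbb{Z}^d\setminus\{\mathbf{0}\}}\frac{u(\mathbf{y}_{\mathbf{j}})}{|\mathbf{y}_{\mathbf{j}}|^{d+\alpha}}+A_{2,d}\,\Delta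 u(\mathbf{0})\right]+O(h^2).$$
   Context: Here $\beta$ ranges over multi-indices in $\mathbb{Z}_{\ge0}^d$, with $|\beta|=\beta_1+\dots+\beta_d$, $\beta!=\beta_1!\cdots\beta_d!$, $\mathbf{y}^\beta=y_1^{\beta_1}\cdots y_d^{\beta_d}$ and $D^\beta$ the corresponding partial derivative. $|\mathbf{y}|$ is the Euclidean norm, $\mathbf{e}_1^T\mathbf{y}$ is the first coordinate of $\mathbf{y}$, and $\Delta$ is the Laplacian. $C_{\alpha,d}$ is the normalizing constant in the definition $(-\Delta)^{\alpha/2}u(\mathbf{x})=\mathrm{p.v.}\int_{\mathbb{R}^d}C_{\alpha,d}\frac{u(\mathbf{x})-u(\mathbf{y})}{|\mathbf{x}-\mathbf{y}|^{d+\alpha}}\,d\mathbf{y}$ of the fractional Laplacian; it is a positive constant depending only on $\alpha$ and $d$ (namely $C_{\alpha,d}=\frac{2^{\alpha}\Gamma((d+\alpha)/2)}{\pi^{d/2}|\Gamma(-\alpha/2)|}$). The quantities $A_{1,d}$ and $A_{2,d}$ depend on $h$. The constant implied in $O(h^2)$ may depend on $u$, $w$, $\alpha$ and $d$ but not on $h$. *)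

theory Defs
  imports "HOL-Analysis.Analysis" "HOL-Library.Landau_Symbols"
begin

definition partial_deriv :: "'a::euclidean_space \<Rightarrow> ('a \<Rightarrow> real) \<Rightarrow> 'a \<Rightarrow> real" where
  "partial_deriv b f x = deriv (\<lambda>t. f (x + t *\<^sub>R b)) 0"

text \<open>All partial derivatives up to order \<open>k\<close>, in any order of differentiation, exist
  everywhere and are continuous. On the type of reals the only basis vector is \<open>1\<close>, so there
  this is the usual \<open>k\<close>-fold continuous differentiability in one variable.\<close>

primrec C_k :: "nat \<Rightarrow> ('a::euclidean_space \<Rightarrow> real) \<Rightarrow> bool" where
  "C_k 0 f \<longleftrightarrow> continuous_on UNIV f"
| "C_k (Suc k) f \<longleftrightarrow> continuous_on UNIV f \<and>
     (\<forall>b\<in>Basis. (\<forall>x. (\<lambda>t. f (x + t *\<^sub>R b)) field_differentiable (at 0)) \<and>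
                 C_k k (partial_deriv b f))"

definition compactly_supported :: "('a::topological_space \<Rightarrow> real) \<Rightarrow> bool" where
  "compactly_supported f \<longleftrightarrow> compact (closure {x. f x \<noteq> 0})"

text \<open>The coordinates of \<open>real ^ 'n\<close> are numbered by the linear order on \<open>'n\<close>; in particular
  the first coordinate is \<open>Min UNIV\<close>.\<close>

definition multi_deriv ::
    "('n::{finite,linorder} \<Rightarrow> nat) \<Rightarrow> ((real, 'n) vec \<Rightarrow> real) \<Rightarrow> (real, 'n) vec \<Rightarrow> real" where
  "multi_deriv \<beta> f =
     foldr (\<lambda>i. partial_deriv (axis i 1) ^^ \<beta> i) (sorted_list_of_set UNIV) f"

definition multi_size :: "('n::finite \<Rightarrow> nat) \<Rightarrow> nat" where
  "multi_size \<beta> = (\<Sum>i\<in>UNIV. \<beta> i)"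

definition multi_fact :: "('n::finite \<Rightarrow> nat) \<Rightarrow> real" where
  "multi_fact \<beta> = (\<Prod>i\<in>UNIV. fact (\<beta> i))"

definition multi_power :: "real ^ 'n::finite \<Rightarrow> ('n \<Rightarrow> nat) \<Rightarrow> real" where
  "multi_power y \<beta> = (\<Prod>i\<in>UNIV. (y $ i) ^ \<beta> i)"

definition laplacian :: "(real ^ 'n::finite \<Rightarrow> real) \<Rightarrow> real ^ 'n \<Rightarrow> real" where
  "laplacian f x = (\<Sum>i\<in>UNIV. partial_deriv (axis i 1) (partial_deriv (axis i 1) f) x)"

text \<open>The normalizing constant of the fractional Laplacian of order \<open>\<alpha>\<close> in dimension \<open>d\<close>.\<close>

definition frac_laplacian_const :: "real \<Rightarrow> nat \<Rightarrow> real" where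
  "frac_laplacian_const \<alpha> d =
     2 powr \<alpha> * Gamma ((real d + \<alpha>) / 2) / (pi powr (real d / 2) * \<bar>Gamma (- \<alpha> / 2)\<bar>)"

definition grid_point :: "real \<Rightarrow> int ^ 'n \<Rightarrow> real ^ 'n::finite" where
  "grid_point h j = h *\<^sub>R (\<chi> i. real_of_int (j $ i))"

text \<open>The first argument of \<open>A1\<close> and \<open>A2\<close> only fixes the dimension \<open>CARD('n)\<close>.\<close>

definition A1 :: "'n::finite itself \<Rightarrow> real \<Rightarrow> real \<Rightarrow> real" where
  "A1 _ \<alpha> h =
     (\<Sum>\<^sub>\<infinity>j\<in>UNIV - {0 :: int ^ 'n}. 1 / norm (grid_point h j) powr (real CARD('n) + \<alpha>))"

definition A2 :: "'n::{finite,linorder} itself \<Rightarrow> (real \<Rightarrow> real) \<Rightarrow> real \<Rightarrow> real \<Rightarrow> real" where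
  "A2 _ w \<alpha> h = 1 / 2 *
     (\<Sum>\<^sub>\<infinity>j\<in>UNIV - {0 :: (int, 'n) vec}.
        w (norm (grid_point h j)) * (grid_point h j $ Min UNIV)\<^sup>2
        / norm (grid_point h j) powr (real CARD('n) + \<alpha>))"

end

theory Submission
  imports Defs
begin

text \<open>
  Write \<open>F\<close> for the numerator of the integrand \<open>f y = F y / |y|\<^sup>d\<^sup>+\<^sup>\<alpha>\<close>. On the lattice
  \<open>h \<int>\<^sup>d\<close> the terms of \<open>F\<close> with \<open>|\<beta>|\<close> odd or \<open>\<beta>\<close> mixed sum to zero by reflection,
  and those with \<open>\<beta> = 2 e\<^sub>i\<close> give \<open>A\<^sub>2\<close> times the Laplacian by permuting coordinates, so the
  claim is that the punctured lattice sum of \<open>f\<close> approximates its integral to order \<open>h\<^sup>2\<close>.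
  Since \<open>F\<close> is a Taylor remainder of order \<open>4\<close> up to the factor \<open>1 - w = O(|y|\<^sup>3)\<close> times a
  polynomial without constant term, and is constant near infinity, \<open>f\<close> and its second
  derivatives are bounded by \<open>min(|y|\<^sup>4, 1) |y|\<^sup>-\<^sup>d\<^sup>-\<^sup>\<alpha>\<close> and by
  \<open>g(y) = min(|y|\<^sup>4, 1) |y|\<^sup>-\<^sup>d\<^sup>-\<^sup>\<alpha>\<^sup>-\<^sup>2\<close>. The weight \<open>g\<close> is integrable because \<open>0 < \<alpha> < 2\<close>
  and is comparable to a constant on each cube around a nonzero lattice point, so there the
  midpoint error is at most a multiple of \<open>h\<^sup>2\<close> times the integral of \<open>g\<close> over the cube. On the
  cube around the origin \<open>|f| \<le> C |y|\<^sup>2 g\<close> gives the same bound.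
\<close>

subsection \<open>Partial derivatives and the vanishing form of Taylor's theorem\<close>

text \<open>The second derivatives of \<open>f\<close> may blow up at the origin like
  \<open>|y|\<close> to the power \<open>2 - d - \<alpha>\<close>, so no uniform bound on them can
  feed the midpoint rule; a pointwise weight is carried along instead. Scaling each derivative of
  order \<open>k\<close> by \<open>|y|\<close> to the \<open>k\<close> makes such bounds stable
  under sums and products, so the Taylor remainder, the cutoff and the power of the norm are
  estimated separately and the second derivative of the quotient is never computed. Derivatives are
  taken along lines \<open>t -> y + t v\<close>: a midpoint error only sees symmetric second
  differences, and \<open>C_k\<close> only speaks of partial derivatives. Directional
  differentiability, symmetry of mixed partials and Taylor's bound are therefore derived from
  continuous partials first.\<close>

lemma has_real_derivative_shift:
  fixes f :: "'a::real_normed_vector \<Rightarrow> real"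
  assumes "((\<lambda>t. f (x + s *\<^sub>R b + t *\<^sub>R b)) has_real_derivative D) (at 0)"
  shows "((\<lambda>t. f (x + t *\<^sub>R b)) has_real_derivative D) (at s)"
proof -
  have "((\<lambda>t. f (x + (t + s) *\<^sub>R b)) has_real_derivative D) (at 0)"
    using assms by (simp add: scaleR_add_left add_ac)
  then show ?thesis
    using DERIV_shift[of "\<lambda>t. f (x + t *\<^sub>R b)" D 0 s] by (simp add: add_ac)
qed

lemma C_k_continuous: "C_k k f \<Longrightarrow> continuous_on UNIV f"
  by (cases k) auto

lemma C_k_isCont: "C_k k f \<Longrightarrow> isCont f x"
  using C_k_continuous continuous_on_eq_continuous_at open_UNIV by blast

lemma C_k_partial: "C_k (Suc k) f \<Longrightarrow> b \<in> Basis \<Longrightarrow> C_k k (partial_deriv b f)"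
  by simp

lemma C_k_Suc_field_differentiable:
  "C_k (Suc k) f \<Longrightarrow> b \<in> Basis \<Longrightarrow> (\<lambda>t. f (x + t *\<^sub>R b)) field_differentiable (at 0)"
  by simp

lemma C_k_SucI:
  assumes "continuous_on UNIV f"
    and "\<And>b x. b \<in> Basis \<Longrightarrow> (\<lambda>t. f (x + t *\<^sub>R b)) field_differentiable (at 0)"
    and "\<And>b. b \<in> Basis \<Longrightarrow> C_k k (partial_deriv b f)"
  shows "C_k (Suc k) f"
  using assms by simp

lemma C_k_Suc_imp: "C_k (Suc k) f \<Longrightarrow> C_k k f"
proof (induction k arbitrary: f)
  case (Suc k)
  then show ?case unfolding C_k.simps(2)[of "Suc k"] C_k.simps(2)[of k] by blast
qed simp

declare C_k.simps(2) [simp del]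

lemma C_k_le: "C_k k f \<Longrightarrow> l \<le> k \<Longrightarrow> C_k l f"
proof (induction k)
  case (Suc k)
  then show ?case using C_k_Suc_imp[of k f] le_Suc_eq by blast
qed simp

lemma C_k_DERIV:
  assumes "C_k (Suc k) f" "b \<in> Basis"
  shows "((\<lambda>t. f (x + t *\<^sub>R b)) has_real_derivative partial_deriv b f (x + s *\<^sub>R b)) (at s)"
proof -
  have "(\<lambda>t. f (x + s *\<^sub>R b + t *\<^sub>R b)) field_differentiable (at 0)"
    using assms by (rule C_k_Suc_field_differentiable)
  then have "((\<lambda>t. f (x + s *\<^sub>R b + t *\<^sub>R b)) has_real_derivative
      partial_deriv b f (x + s *\<^sub>R b)) (at 0)"
    unfolding partial_deriv_def by (simp add: DERIV_deriv_iff_field_differentiable)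
  then show ?thesis by (rule has_real_derivative_shift)
qed

lemma partial_derivI:
  assumes "((\<lambda>t. f (x + t *\<^sub>R b)) has_real_derivative D) (at 0)"
  shows "partial_deriv b f x = D"
  unfolding partial_deriv_def by (rule DERIV_imp_deriv) (fact assms)

text \<open>The closed bound on \<open>\<xi>\<close> covers every sign of \<open>s\<close>,
  including zero, and forces \<open>\<xi>\<close> to tend to 0 with \<open>s\<close>, so that
  continuity of the partial derivative can be applied afterwards.\<close>

lemma C_k_partial_MVT:
  assumes "C_k (Suc k) f" "b \<in> Basis"
  obtains \<xi> where "\<bar>\<xi>\<bar> \<le> \<bar>s\<bar>"
    "f (x + s *\<^sub>R b) - f x = s * partial_deriv b f (x + \<xi> *\<^sub>R b)"
proof (cases "s = 0")
  case True
  then show ?thesis using that[of 0] by simp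
next
  case False
  define \<phi> where "\<phi> = (\<lambda>t. f (x + t *\<^sub>R b))"
  define \<phi>' where "\<phi>' = (\<lambda>t. partial_deriv b f (x + t *\<^sub>R b))"
  have D: "(\<phi> has_real_derivative \<phi>' t) (at t)" for t
    unfolding \<phi>_def \<phi>'_def by (rule C_k_DERIV[OF assms])
  show ?thesis
  proof (cases "s > 0")
    case True
    then obtain z where "0 < z" "z < s" "\<phi> s - \<phi> 0 = (s - 0) * \<phi>' z"
      using MVT2[of 0 s \<phi> \<phi>'] D by blast
    then show ?thesis using that[of z] by (simp add: \<phi>_def \<phi>'_def)
  next
    case neg: False
    with False have "s < 0" by simp
    then obtain z where "s < z" "z < 0" "\<phi> 0 - \<phi> s = (0 - s) * \<phi>' z"
      using MVT2[of s 0 \<phi> \<phi>'] D by blast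
    then show ?thesis using that[of z] by (simp add: \<phi>_def \<phi>'_def algebra_simps)
  qed
qed

text \<open>Mere existence of partial derivatives gives no directional ones; their continuity does.
  One coordinate is added at a time: the increment in direction \<open>b\<close> starts at the
  moving point \<open>x + t v\<close>, where the mean value theorem evaluates the partial derivative
  at a point tending to \<open>x\<close>.\<close>

lemma C_k_line_DERIV_aux:
  assumes f: "C_k (Suc k) f" and B: "finite B" "B \<subseteq> Basis"
  shows "((\<lambda>t. f (x + t *\<^sub>R (\<Sum>b\<in>B. c b *\<^sub>R b))) has_real_derivative
    (\<Sum>b\<in>B. c b * partial_deriv b f x)) (at 0)"
  using B
proof (induction B rule: finite_induct)
  case empty
  then show ?case by simp
next
  case (insert b B)
  define v where "v = (\<Sum>b\<in>B. c b *\<^sub>R b)"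
  have b: "b \<in> Basis" using insert by auto
  have IH: "((\<lambda>t. f (x + t *\<^sub>R v)) has_real_derivative (\<Sum>b\<in>B. c b * partial_deriv b f x)) (at 0)"
    unfolding v_def using insert by auto
  have "\<exists>\<xi>. \<bar>\<xi>\<bar> \<le> \<bar>t * c b\<bar> \<and> f (x + t *\<^sub>R v + (t * c b) *\<^sub>R b) - f (x + t *\<^sub>R v)
      = (t * c b) * partial_deriv b f (x + t *\<^sub>R v + \<xi> *\<^sub>R b)" for t
    by (rule C_k_partial_MVT[OF f b, where x = "x + t *\<^sub>R v" and s = "t * c b"]) blast
  then obtain \<xi> where \<xi>: "\<And>t. \<bar>\<xi> t\<bar> \<le> \<bar>t * c b\<bar>"
    "\<And>t. f (x + t *\<^sub>R v + (t * c b) *\<^sub>R b) - f (x + t *\<^sub>R v)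
      = (t * c b) * partial_deriv b f (x + t *\<^sub>R v + \<xi> t *\<^sub>R b)"
    by metis
  have "\<xi> \<midarrow>0\<rightarrow> 0"
  proof (rule Lim_null_comparison[where g = "\<lambda>t. \<bar>t * c b\<bar>"])
    show "\<forall>\<^sub>F t in at 0. norm (\<xi> t) \<le> \<bar>t * c b\<bar>" using \<xi>(1) by simp
    show "(\<lambda>t. \<bar>t * c b\<bar>) \<midarrow>0\<rightarrow> 0" by (auto intro!: tendsto_eq_intros)
  qed
  then have "(\<lambda>t. x + t *\<^sub>R v + \<xi> t *\<^sub>R b) \<midarrow>0\<rightarrow> x"
    by (auto intro!: tendsto_eq_intros)
  then have "(\<lambda>t. partial_deriv b f (x + t *\<^sub>R v + \<xi> t *\<^sub>R b)) \<midarrow>0\<rightarrow> partial_deriv b f x"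
    using C_k_isCont[OF C_k_partial[OF f b]] isCont_tendsto_compose by blast
  then have "(\<lambda>t. c b * partial_deriv b f (x + t *\<^sub>R v + \<xi> t *\<^sub>R b) + (f (x + t *\<^sub>R v) - f x) / t)
     \<midarrow>0\<rightarrow> c b * partial_deriv b f x + (\<Sum>b\<in>B. c b * partial_deriv b f x)"
    using IH unfolding has_field_derivative_iff by (auto intro!: tendsto_intros)
  moreover have "\<forall>\<^sub>F t in at 0. c b * partial_deriv b f (x + t *\<^sub>R v + \<xi> t *\<^sub>R b) + (f (x + t *\<^sub>R v) - f x) / t
      = (f (x + t *\<^sub>R (c b *\<^sub>R b + v)) - f x) / t"
  proof -
    have "c b * partial_deriv b f (x + t *\<^sub>R v + \<xi> t *\<^sub>R b) + (f (x + t *\<^sub>R v) - f x) / t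
      = (f (x + t *\<^sub>R (c b *\<^sub>R b + v)) - f x) / t" if "t \<noteq> 0" for t
    proof -
      have "f (x + t *\<^sub>R (c b *\<^sub>R b + v)) = f (x + t *\<^sub>R v) + (t * c b) * partial_deriv b f (x + t *\<^sub>R v + \<xi> t *\<^sub>R b)"
        using \<xi>(2)[of t] by (simp add: algebra_simps)
      then show ?thesis using that by (simp add: field_simps)
    qed
    then show ?thesis by (simp add: eventually_at_filter)
  qed
  ultimately have "(\<lambda>t. (f (x + t *\<^sub>R (c b *\<^sub>R b + v)) - f x) / t)
     \<midarrow>0\<rightarrow> c b * partial_deriv b f x + (\<Sum>b\<in>B. c b * partial_deriv b f x)"
    by (rule Lim_transform_eventually)
  then show ?case
    using insert by (simp add: has_field_derivative_iff v_def)
qed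

lemma C_k_line_DERIV:
  assumes "C_k (Suc k) f"
  shows "((\<lambda>t. f (x + t *\<^sub>R v)) has_real_derivative
    (\<Sum>b\<in>Basis. (v \<bullet> b) * partial_deriv b f (x + s *\<^sub>R v))) (at s)"
proof (rule has_real_derivative_shift)
  show "((\<lambda>t. f (x + s *\<^sub>R v + t *\<^sub>R v)) has_real_derivative
      (\<Sum>b\<in>Basis. (v \<bullet> b) * partial_deriv b f (x + s *\<^sub>R v))) (at 0)"
    using C_k_line_DERIV_aux[OF assms, of Basis "x + s *\<^sub>R v" "\<lambda>b. v \<bullet> b"]
    by (simp add: euclidean_representation)
qed

text \<open>Two applications of the mean value theorem: in direction \<open>b\<close> to the
  difference of \<open>f\<close> along \<open>c\<close>, then in direction \<open>c\<close> to the
  partial derivative of \<open>f\<close> along \<open>b\<close>.\<close>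

lemma C_k_second_difference_MVT:
  assumes f: "C_k (Suc (Suc k)) f" and b: "b \<in> Basis" and c: "c \<in> Basis"
  obtains \<xi> \<eta> where "\<bar>\<xi>\<bar> \<le> \<bar>e\<bar>" "\<bar>\<eta>\<bar> \<le> \<bar>e\<bar>"
    "f (x + e *\<^sub>R b + e *\<^sub>R c) - f (x + e *\<^sub>R b) - f (x + e *\<^sub>R c) + f x
      = e * e * partial_deriv c (partial_deriv b f) (x + \<xi> *\<^sub>R b + \<eta> *\<^sub>R c)"
proof -
  define \<phi> where "\<phi> = (\<lambda>s. f (x + e *\<^sub>R c + s *\<^sub>R b) - f (x + s *\<^sub>R b))"
  define \<phi>' where "\<phi>' = (\<lambda>s. partial_deriv b f (x + e *\<^sub>R c + s *\<^sub>R b) - partial_deriv b f (x + s *\<^sub>R b))"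
  have D: "(\<phi> has_real_derivative \<phi>' s) (at s)" for s
    unfolding \<phi>_def \<phi>'_def
    by (intro derivative_intros C_k_DERIV[OF f b])
  have "\<exists>\<xi>. \<bar>\<xi>\<bar> \<le> \<bar>e\<bar> \<and> \<phi> e - \<phi> 0 = e * \<phi>' \<xi>"
  proof -
    consider "e = 0" | "e > 0" | "e < 0" by linarith
    then show ?thesis
    proof cases
      case 2
      then obtain z where "0 < z" "z < e" "\<phi> e - \<phi> 0 = (e - 0) * \<phi>' z"
        using MVT2[of 0 e \<phi> \<phi>'] D by blast
      then show ?thesis by (intro exI[of _ z]) auto
    next
      case 3
      then obtain z where "e < z" "z < 0" "\<phi> 0 - \<phi> e = (0 - e) * \<phi>' z"
        using MVT2[of e 0 \<phi> \<phi>'] D by blast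
      then show ?thesis by (intro exI[of _ z]) auto
    qed auto
  qed
  then obtain \<xi> where \<xi>: "\<bar>\<xi>\<bar> \<le> \<bar>e\<bar>" "\<phi> e - \<phi> 0 = e * \<phi>' \<xi>" by blast
  obtain \<eta> where \<eta>: "\<bar>\<eta>\<bar> \<le> \<bar>e\<bar>"
    "partial_deriv b f (x + \<xi> *\<^sub>R b + e *\<^sub>R c) - partial_deriv b f (x + \<xi> *\<^sub>R b)
     = e * partial_deriv c (partial_deriv b f) (x + \<xi> *\<^sub>R b + \<eta> *\<^sub>R c)"
    by (rule C_k_partial_MVT[OF C_k_partial[OF f b] c])
  have "x + e *\<^sub>R c + s *\<^sub>R b = x + s *\<^sub>R b + e *\<^sub>R c" for s by (simp add: add_ac)
  then have "\<phi> e - \<phi> 0 = e * (e * partial_deriv c (partial_deriv b f) (x + \<xi> *\<^sub>R b + \<eta> *\<^sub>R c))"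
    by (simp only: \<xi>(2) \<phi>'_def \<eta>(2))
  moreover have "\<phi> e - \<phi> 0 = f (x + e *\<^sub>R b + e *\<^sub>R c) - f (x + e *\<^sub>R b) - f (x + e *\<^sub>R c) + f x"
    by (simp add: \<phi>_def algebra_simps)
  ultimately show ?thesis using that[OF \<xi>(1) \<eta>(1)] by (simp add: mult.assoc)
qed

text \<open>Schwarz's theorem: the second difference is symmetric in \<open>b\<close> and
  \<open>c\<close>, while its quotient by \<open>e * e\<close> tends to either mixed derivative,
  depending on which direction is treated first.\<close>

lemma partial_deriv_commute:
  assumes f: "C_k (Suc (Suc k)) f" and b: "b \<in> Basis" and c: "c \<in> Basis"
  shows "partial_deriv b (partial_deriv c f) = partial_deriv c (partial_deriv b f)"
proof
  fix x
  define \<Delta> where "\<Delta> e = f (x + e *\<^sub>R b + e *\<^sub>R c) - f (x + e *\<^sub>R b) - f (x + e *\<^sub>R c) + f x" for e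
  \<comment> \<open>The formula for \<open>\<Delta>\<close> is a premise here, so that one limit
    statement applies to both orders of the two directions.\<close>
  have lim: "((\<lambda>e. \<Delta> e / (e * e)) \<longlongrightarrow> partial_deriv c (partial_deriv b f) x) (at 0)"
    if b: "b \<in> Basis" and c: "c \<in> Basis"
      and \<Delta>: "\<And>e. \<Delta> e = f (x + e *\<^sub>R b + e *\<^sub>R c) - f (x + e *\<^sub>R b) - f (x + e *\<^sub>R c) + f x"
    for b c
  proof -
    let ?g = "partial_deriv c (partial_deriv b f)"
    have "\<exists>\<xi> \<eta>. \<bar>\<xi>\<bar> \<le> \<bar>e\<bar> \<and> \<bar>\<eta>\<bar> \<le> \<bar>e\<bar> \<and> \<Delta> e = e * e * ?g (x + \<xi> *\<^sub>R b + \<eta> *\<^sub>R c)" for e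
      unfolding \<Delta> by (rule C_k_second_difference_MVT[OF f b c, of e x]) blast
    then obtain \<xi> \<eta> where \<xi>\<eta>: "\<And>e. \<bar>\<xi> e\<bar> \<le> \<bar>e\<bar>" "\<And>e. \<bar>\<eta> e\<bar> \<le> \<bar>e\<bar>"
      "\<And>e. \<Delta> e = e * e * ?g (x + \<xi> e *\<^sub>R b + \<eta> e *\<^sub>R c)" by metis
    have null: "g \<midarrow>0\<rightarrow> 0" if "\<And>e. \<bar>g e\<bar> \<le> \<bar>e\<bar>" for g :: "real \<Rightarrow> real"
    proof (rule Lim_null_comparison[where g = "\<lambda>t. \<bar>t\<bar>"])
      show "\<forall>\<^sub>F t in at 0. norm (g t) \<le> \<bar>t\<bar>" using that by simp
      show "(\<lambda>t::real. \<bar>t\<bar>) \<midarrow>0\<rightarrow> 0" by (auto intro!: tendsto_eq_intros)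
    qed
    have "(\<lambda>e. x + \<xi> e *\<^sub>R b + \<eta> e *\<^sub>R c) \<midarrow>0\<rightarrow> x"
      using null[of \<xi>] null[of \<eta>] \<xi>\<eta>(1,2) by (auto intro!: tendsto_eq_intros)
    then have "(\<lambda>e. ?g (x + \<xi> e *\<^sub>R b + \<eta> e *\<^sub>R c)) \<midarrow>0\<rightarrow> ?g x"
      using C_k_isCont[OF C_k_partial[OF C_k_partial[OF f b] c]] isCont_tendsto_compose by blast
    then show ?thesis
      by (rule Lim_transform_eventually) (use \<xi>\<eta>(3) in \<open>auto simp: eventually_at_filter\<close>)
  qed
  have "((\<lambda>e. \<Delta> e / (e * e)) \<longlongrightarrow> partial_deriv c (partial_deriv b f) x) (at 0)"
    using lim[OF b c] \<Delta>_def by blast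
  moreover have "\<Delta> e = f (x + e *\<^sub>R c + e *\<^sub>R b) - f (x + e *\<^sub>R c) - f (x + e *\<^sub>R b) + f x" for e
    unfolding \<Delta>_def by (simp add: algebra_simps)
  then have "((\<lambda>e. \<Delta> e / (e * e)) \<longlongrightarrow> partial_deriv b (partial_deriv c f) x) (at 0)"
    using lim[OF c b] by blast
  ultimately show "partial_deriv b (partial_deriv c f) x = partial_deriv c (partial_deriv b f) x"
    using tendsto_unique at_neq_bot by blast
qed

section \<open>Iterated partial derivatives indexed by lists of directions\<close>

lemma C_k_foldr_partial:
  assumes "C_k (k + length l) f" "set l \<subseteq> Basis"
  shows "C_k k (foldr partial_deriv l f)"
  using assms
proof (induction l arbitrary: k)
  case (Cons b l)
  then have "C_k (Suc k) (foldr partial_deriv l f)" by simp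
  then show ?case using Cons.prems C_k_partial by auto
qed simp

lemma foldr_partial_deriv_to_front:
  assumes "C_k (length (p @ b # q)) f" "set (p @ b # q) \<subseteq> Basis"
  shows "foldr partial_deriv (p @ b # q) f = foldr partial_deriv (b # p @ q) f"
  using assms
proof (induction p)
  case (Cons a p)
  have "foldr partial_deriv (p @ b # q) f = foldr partial_deriv (b # p @ q) f"
    using Cons C_k_Suc_imp by auto
  moreover have "C_k (Suc (Suc 0)) (foldr partial_deriv (p @ q) f)"
    using Cons.prems by (intro C_k_foldr_partial) auto
  ultimately show ?case
    using Cons.prems partial_deriv_commute[of 0 "foldr partial_deriv (p @ q) f" a b] by simp
qed simp

text \<open>The head of \<open>l\<close> is located in \<open>l'\<close> and commuted to the front.
  Needed because \<open>multi_deriv\<close> differentiates in a fixed sorted order, whereas repeated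
  differentiation produces directions in any order.\<close>

lemma foldr_partial_deriv_perm:
  assumes "C_k (length l) f" "set l \<subseteq> Basis" "mset l = mset l'"
  shows "foldr partial_deriv l f = foldr partial_deriv l' f"
  using assms
proof (induction l arbitrary: l')
  case (Cons b l)
  then obtain p q where l': "l' = p @ b # q"
    by (metis list.set_intros(1) mset_eq_setD split_list)
  then have m: "mset l = mset (p @ q)" using Cons.prems by simp
  have len: "length l' = length (b # l)" using Cons.prems(3) by (metis size_mset)
  have set: "set l' = set (b # l)" using Cons.prems(3) by (metis mset_eq_setD)
  have "foldr partial_deriv l' f = foldr partial_deriv (b # p @ q) f"
    unfolding l' using l' len set Cons.prems
    by (intro foldr_partial_deriv_to_front) (auto simp del: length_append)
  moreover have "foldr partial_deriv l f = foldr partial_deriv (p @ q) f"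
    using Cons.prems m C_k_Suc_imp[of "length l" f] by (intro Cons.IH) auto
  ultimately show ?case by simp
qed simp

lemma partial_deriv_lin:
  assumes "C_k (Suc k) f" "C_k (Suc k) g" "b \<in> Basis"
  shows "partial_deriv b (\<lambda>x. r * f x + s * g x) = (\<lambda>x. r * partial_deriv b f x + s * partial_deriv b g x)"
proof
  fix x
  show "partial_deriv b (\<lambda>x. r * f x + s * g x) x = r * partial_deriv b f x + s * partial_deriv b g x"
    using C_k_DERIV[OF assms(1,3), of x 0] C_k_DERIV[OF assms(2,3), of x 0]
    by (intro partial_derivI) (auto intro!: derivative_eq_intros)
qed

lemma C_k_lin:
  assumes "C_k k f" "C_k k g"
  shows "C_k k (\<lambda>x. r * f x + s * g x)"
  using assms
proof (induction k arbitrary: f g)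
  case 0
  then show ?case by (auto intro!: continuous_intros)
next
  case (Suc k)
  have "(\<lambda>t. r * f (x + t *\<^sub>R b) + s * g (x + t *\<^sub>R b)) field_differentiable (at 0)" if "b \<in> Basis" for x b
    using Suc.prems that
    by (intro derivative_intros C_k_Suc_field_differentiable)
  moreover have "C_k k (partial_deriv b (\<lambda>x. r * f x + s * g x))" if "b \<in> Basis" for b
    unfolding partial_deriv_lin[OF Suc.prems that]
    using Suc that C_k_partial by blast
  ultimately show ?case using Suc.prems C_k_continuous
    by (intro C_k_SucI continuous_intros) auto
qed

lemma foldr_partial_deriv_lin:
  assumes "C_k (length l) f" "C_k (length l) g" "set l \<subseteq> Basis"
  shows "foldr partial_deriv l (\<lambda>x. r * f x + s * g x)
    = (\<lambda>x. r * foldr partial_deriv l f x + s * foldr partial_deriv l g x)"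
  using assms
proof (induction l)
  case (Cons b l)
  have "C_k (Suc 0) (foldr partial_deriv l f)" "C_k (Suc 0) (foldr partial_deriv l g)"
    using Cons.prems by (auto intro!: C_k_foldr_partial)
  then show ?case
    using Cons C_k_Suc_imp[of "length l" f] C_k_Suc_imp[of "length l" g] partial_deriv_lin[of 0 "foldr partial_deriv l f" "foldr partial_deriv l g" b]
    by auto
qed simp

lemma C_k_const [simp]: "C_k k (\<lambda>x. c)"
proof (induction k arbitrary: c)
  case (Suc k)
  have "partial_deriv b (\<lambda>x. c) = (\<lambda>x. 0)" for b :: 'a
    by (auto simp: partial_deriv_def)
  then show ?case using Suc by (intro C_k_SucI) auto
qed auto

lemma C_k_sum:
  assumes "\<And>i. i \<in> I \<Longrightarrow> C_k k (f i)"
  shows "C_k k (\<lambda>x. \<Sum>i\<in>I. c i * f i x)"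
  using assms
proof (induction I rule: infinite_finite_induct)
  case (insert i I)
  then show ?case using C_k_lin[of k "f i" "\<lambda>x. \<Sum>i\<in>I. c i * f i x" "c i" 1] by simp
qed auto

lemma foldr_partial_deriv_const:
  assumes "set l \<subseteq> Basis"
  shows "foldr partial_deriv l (\<lambda>x. 0) = (\<lambda>x. 0)"
  using assms by (induction l) (auto simp: partial_deriv_def)

lemma foldr_partial_deriv_sum:
  assumes "\<And>i. i \<in> I \<Longrightarrow> C_k (length l) (f i)" "set l \<subseteq> Basis"
  shows "foldr partial_deriv l (\<lambda>x. \<Sum>i\<in>I. c i * f i x) = (\<lambda>x. \<Sum>i\<in>I. c i * foldr partial_deriv l (f i) x)"
  using assms
proof (induction I rule: infinite_finite_induct)
  case (insert i I)
  have "C_k (length l) (\<lambda>x. \<Sum>i\<in>I. c i * f i x)" using insert by (intro C_k_sum) auto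
  then have "foldr partial_deriv l (\<lambda>x. c i * f i x + 1 * (\<Sum>i\<in>I. c i * f i x))
    = (\<lambda>x. c i * foldr partial_deriv l (f i) x + 1 * foldr partial_deriv l (\<lambda>x. \<Sum>i\<in>I. c i * f i x) x)"
    using insert by (intro foldr_partial_deriv_lin) auto
  then show ?case using insert by simp
qed (auto simp: foldr_partial_deriv_const)

text \<open>Taylor's theorem for a function whose low-order derivatives vanish at 0, so that no
  polynomial appears. Each first partial satisfies the bound with one power less, and the mean value
  theorem on the segment from 0 to \<open>y\<close> contributes the missing factor
  \<open>norm y\<close>. The base case is boundedness on a compact ball.\<close>

lemma Taylor_vanishing_bound:
  fixes R :: "'a::euclidean_space \<Rightarrow> real"
  assumes "C_k m R"
    and "\<And>l. set l \<subseteq> Basis \<Longrightarrow> length l < m \<Longrightarrow> foldr partial_deriv l R 0 = 0"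
  shows "\<exists>C. \<forall>y\<in>cball 0 \<rho>. \<bar>R y\<bar> \<le> C * norm y ^ m"
  using assms
proof (induction m arbitrary: R)
  case 0
  have "compact (R ` cball 0 \<rho>)"
    using 0 by (intro compact_continuous_image) (auto intro: continuous_on_subset)
  then obtain C where "\<And>y. y \<in> cball 0 \<rho> \<Longrightarrow> norm (R y) \<le> C"
    using compact_imp_bounded bounded_iff by (metis imageI)
  then show ?case by (intro exI[of _ C]) auto
next
  case (Suc m)
  have "\<exists>C. \<forall>y\<in>cball 0 \<rho>. \<bar>partial_deriv b R y\<bar> \<le> C * norm y ^ m" if b: "b \<in> Basis" for b
  proof (rule Suc.IH)
    show "C_k m (partial_deriv b R)" using Suc.prems(1) b by (rule C_k_partial)
    fix l :: "'a list" assume "set l \<subseteq> Basis" "length l < m"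
    \<comment> \<open>\<open>foldr\<close> applies the last list entry first, so an inner derivative
      is appended on the right.\<close>
    then show "foldr partial_deriv l (partial_deriv b R) 0 = 0"
      using Suc.prems(2)[of "l @ [b]"] b by auto
  qed
  then obtain C where C: "\<And>b y. b \<in> Basis \<Longrightarrow> y \<in> cball 0 \<rho> \<Longrightarrow> \<bar>partial_deriv b R y\<bar> \<le> C b * norm y ^ m"
    by metis
  have "\<bar>R y\<bar> \<le> (\<Sum>b\<in>Basis. \<bar>C b\<bar>) * norm y ^ Suc m" if y: "y \<in> cball 0 \<rho>" for y
  proof -
    let ?d = "\<lambda>t. \<Sum>b\<in>Basis. (y \<bullet> b) * partial_deriv b R (0 + t *\<^sub>R y)"
    have "\<exists>z>0. z < 1 \<and> R (0 + 1 *\<^sub>R y) - R (0 + 0 *\<^sub>R y) = (1 - 0) * ?d z"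
      by (rule MVT2) (auto simp del: add_0 intro!: C_k_line_DERIV[OF Suc.prems(1)])
    then obtain z where z: "0 < z" "z < 1" "R y - R 0 = ?d z" by auto
    have zy: "norm (z *\<^sub>R y) \<le> norm y" using z by (simp add: mult_left_le_one_le)
    have "\<bar>R y\<bar> = \<bar>?d z\<bar>" using z Suc.prems(2)[of "[]"] by simp
    also have "\<dots> \<le> (\<Sum>b\<in>Basis. \<bar>(y \<bullet> b) * partial_deriv b R (0 + z *\<^sub>R y)\<bar>)" by (rule sum_abs)
    also have "\<dots> \<le> (\<Sum>b\<in>Basis. \<bar>C b\<bar> * norm y ^ Suc m)"
    proof (rule sum_mono)
      fix b :: 'a assume b: "b \<in> Basis"
      have "\<bar>partial_deriv b R (0 + z *\<^sub>R y)\<bar> \<le> C b * norm (z *\<^sub>R y) ^ m"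
        using C[OF b, of "z *\<^sub>R y"] zy y by simp
      also have "\<dots> \<le> \<bar>C b\<bar> * norm y ^ m"
        using zy by (intro mult_mono power_mono) auto
      finally have "\<bar>y \<bullet> b\<bar> * \<bar>partial_deriv b R (0 + z *\<^sub>R y)\<bar> \<le> norm y * (\<bar>C b\<bar> * norm y ^ m)"
        using b by (intro mult_mono Basis_le_norm) auto
      then show "\<bar>(y \<bullet> b) * partial_deriv b R (0 + z *\<^sub>R y)\<bar> \<le> \<bar>C b\<bar> * norm y ^ Suc m"
        by (simp add: abs_mult mult_ac)
    qed
    finally show ?thesis by (simp add: sum_distrib_right)
  qed
  then show ?case by blast
qed

subsection \<open>Multi-index Taylor polynomials\<close>

lemma multi_power_split: "multi_power y \<beta> = (y $ i) ^ \<beta> i * (\<Prod>j\<in>UNIV - {i}. (y $ j) ^ \<beta> j)"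
  unfolding multi_power_def by (rule prod.remove) auto

lemma multi_fact_split: "multi_fact \<beta> = fact (\<beta> i) * (\<Prod>j\<in>UNIV - {i}. fact (\<beta> j))"
  unfolding multi_fact_def by (rule prod.remove) auto

text \<open>For \<open>\<beta> i = 0\<close> the truncated exponent is harmless, since the factor
  \<open>real (\<beta> i)\<close> vanishes.\<close>

lemma multi_power_line_DERIV:
  "((\<lambda>t. multi_power (x + t *\<^sub>R axis i 1) \<beta>) has_real_derivative
     real (\<beta> i) * multi_power x (\<beta>(i := \<beta> i - 1))) (at 0)"
proof -
  define c where "c = (\<Prod>j\<in>UNIV - {i}. (x $ j) ^ \<beta> j)"
  have "multi_power (x + t *\<^sub>R axis i 1) \<beta> = (x $ i + t) ^ \<beta> i * c" for t
    unfolding multi_power_split[of _ _ i] c_def by (simp add: axis_def)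
  moreover have "multi_power x (\<beta>(i := \<beta> i - 1)) = (x $ i) ^ (\<beta> i - 1) * c"
    unfolding multi_power_split[of _ _ i] c_def by simp
  ultimately show ?thesis
    by (auto intro!: derivative_eq_intros)
qed

lemma partial_deriv_multi_power:
  "partial_deriv (axis i 1) (\<lambda>y. multi_power y \<beta>) = (\<lambda>y. real (\<beta> i) * multi_power y (\<beta>(i := \<beta> i - 1)))"
  by (rule ext) (rule partial_derivI, rule multi_power_line_DERIV)

lemma continuous_on_multi_power [continuous_intros]:
  "continuous_on S f \<Longrightarrow> continuous_on S (\<lambda>x. multi_power (f x) \<beta>)"
  unfolding multi_power_def by (intro continuous_intros)

lemma real_vec_Basis: "(Basis :: (real ^ 'n::finite) set) = range (\<lambda>i. axis i 1)"
  by (auto simp: Basis_vec_def)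

lemma C_k_multi_power [simp]: "C_k k (\<lambda>y. multi_power y \<beta>)"
proof (induction k arbitrary: \<beta>)
  case 0
  then show ?case by (auto intro!: continuous_intros)
next
  case (Suc k)
  have "C_k k (partial_deriv (axis i 1) (\<lambda>y. multi_power y \<beta>))" for i
    unfolding partial_deriv_multi_power
    using C_k_lin[OF Suc C_k_const, of "real (\<beta> i)" "\<beta>(i := \<beta> i - 1)" 0 0]
    by (simp add: fun_upd_def)
  moreover have "(\<lambda>t. multi_power (x + t *\<^sub>R axis i 1) \<beta>) field_differentiable at 0" for x i
    using multi_power_line_DERIV field_differentiable_def by blast
  ultimately show ?case
    by (intro C_k_SucI) (auto simp: real_vec_Basis intro!: continuous_intros)
qed

lemma multi_power_zero: "multi_power 0 \<beta> = (if \<beta> = (\<lambda>_. 0) then 1 else 0)"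
  by (auto simp: multi_power_def fun_eq_iff zero_power power_0_left)

lemma multi_fact_nonzero [simp]: "multi_fact \<beta> \<noteq> 0"
  by (simp add: multi_fact_def)

text \<open>Duality of monomials and derivatives at 0. The induction removes the right end of the
  list because that entry differentiates first; each step contributes a factor
  \<open>\<beta> i\<close>, and these build up the factorial.\<close>

lemma foldr_partial_deriv_multi_power:
  "foldr partial_deriv (map (\<lambda>i. axis i 1) l) (\<lambda>y. multi_power y \<beta>) 0
    = (if \<beta> = count_list l then multi_fact \<beta> else 0)"
proof (induction l arbitrary: \<beta> rule: rev_induct)
  case Nil
  then show ?case by (auto simp: multi_power_zero multi_fact_def fun_eq_iff)
next
  case (snoc i l)
  let ?l = "map (\<lambda>i. axis i 1) l :: (real ^ 'a) list"
  let ?\<gamma> = "\<beta>(i := \<beta> i - 1)"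
  have "foldr partial_deriv (map (\<lambda>i. axis i 1) (l @ [i])) (\<lambda>y. multi_power y \<beta>) 0
    = foldr partial_deriv ?l (\<lambda>y. real (\<beta> i) * multi_power y ?\<gamma> + 0 * multi_power y ?\<gamma>) 0"
    by (simp add: partial_deriv_multi_power)
  also have "\<dots> = real (\<beta> i) * foldr partial_deriv ?l (\<lambda>y. multi_power y ?\<gamma>) 0"
    by (subst foldr_partial_deriv_lin) (auto simp: real_vec_Basis)
  also have "\<dots> = real (\<beta> i) * (if ?\<gamma> = count_list l then multi_fact ?\<gamma> else 0)"
    by (simp only: snoc)
  also have "\<dots> = (if \<beta> = count_list (l @ [i]) then multi_fact \<beta> else 0)"
  proof (cases "\<beta> i")
    case 0
    then have "\<beta> \<noteq> count_list (l @ [i])" by (auto simp: fun_eq_iff dest!: spec[of _ i])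
    then show ?thesis using 0 by simp
  next
    case (Suc k)
    then have "(?\<gamma> = count_list (l)) = (\<beta> = count_list (l @ [i]))"
      by (auto simp: fun_eq_iff split: if_splits)
    moreover have "real (\<beta> i) * multi_fact ?\<gamma> = multi_fact \<beta>"
      unfolding multi_fact_split[of _ i] using Suc by simp
    ultimately show ?thesis
      by (cases "\<beta> = count_list (l @ [i])") (simp_all only: if_True if_False mult_zero_right simp_thms)
  qed
  finally show ?case .
qed

text \<open>Turns the operator powers inside \<open>multi_deriv\<close> into one list of directions,
  the form in which order independence is available; \<open>count_list\<close> is its inverse up to
  permutation.\<close>

definition multi_list :: "('n::{finite,linorder} \<Rightarrow> nat) \<Rightarrow> 'n list" where
  "multi_list \<beta> = concat (map (\<lambda>i. replicate (\<beta> i) i) (sorted_list_of_set UNIV))"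

lemma multi_deriv_foldr:
  fixes f :: "(real, 'n::{finite,linorder}) vec \<Rightarrow> real"
  shows "multi_deriv \<beta> f = foldr partial_deriv (map (\<lambda>i. axis i 1) (multi_list \<beta>)) f"
proof -
  have "foldr (\<lambda>i. partial_deriv (axis i 1) ^^ \<beta> i) L f
    = foldr partial_deriv (map (\<lambda>i. axis i 1) (concat (map (\<lambda>i. replicate (\<beta> i) i) L))) f" for L
    by (induction L) (simp_all add: map_concat)
  then show ?thesis unfolding multi_deriv_def multi_list_def .
qed

lemma count_multi_list: "count_list (multi_list \<beta>) x = \<beta> x"
proof -
  have "count_list (concat (map (\<lambda>i. replicate (\<beta> i) i) L)) x = (if x \<in> set L then \<beta> x else 0)"
    if "distinct L" for L
    using that by (induction L) (auto simp: count_list_eq_length_filter filter_replicate)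
  then show ?thesis unfolding multi_list_def by simp
qed

lemma mset_multi_list_count_list: "mset (multi_list (count_list l)) = mset l"
  by (rule multiset_eqI) (simp add: count_mset count_multi_list)

lemma multi_size_count_list: "multi_size (count_list l) = length l"
  unfolding multi_size_def using sum_count_set[of l UNIV] by simp

lemma finite_multi_size: "finite {\<beta> :: 'n::finite \<Rightarrow> nat. multi_size \<beta> < m}"
proof (rule finite_subset)
  show "{\<beta> :: 'n \<Rightarrow> nat. multi_size \<beta> < m} \<subseteq> PiE UNIV (\<lambda>_. {..<m})"
    unfolding multi_size_def
    by (auto simp: PiE_def) (meson UNIV_I finite le_less_trans member_le_sum zero_le)
qed (auto intro: finite_PiE)

text \<open>Of all monomials only the one with exponent \<open>count_list k\<close> survives
  differentiation along \<open>l\<close> at 0. Its derivative cancels the factorial in the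
  coefficient, and permutation identifies \<open>multi_deriv \<gamma> u 0\<close> with the
  derivative of \<open>u\<close> along \<open>l\<close>.\<close>

lemma foldr_partial_deriv_Taylor_remainder:
  fixes u :: "real ^ 'n::{finite,linorder} \<Rightarrow> real"
  assumes u: "C_k m u" and l: "set l \<subseteq> Basis" "length l < m"
  shows "foldr partial_deriv l (\<lambda>y. u y -
    (\<Sum>\<beta> | multi_size \<beta> < m. multi_deriv \<beta> u 0 / multi_fact \<beta> * multi_power y \<beta>)) 0 = 0"
proof -
  let ?ax = "\<lambda>i. axis i 1 :: (real, 'n) vec"
  let ?I = "{\<beta> :: 'n \<Rightarrow> nat. multi_size \<beta> < m}"
  define c where "c \<beta> = multi_deriv \<beta> u 0 / multi_fact \<beta>" for \<beta>
  define P where "P y = (\<Sum>\<beta>\<in>?I. c \<beta> * multi_power y \<beta>)" for y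
  obtain k where k: "l = map ?ax k"
    using l(1) unfolding real_vec_Basis by (metis ex_map_conv subset_iff rangeE)
  define \<gamma> where "\<gamma> = count_list k"
  have \<gamma>: "\<gamma> \<in> ?I" using l k by (simp add: \<gamma>_def multi_size_count_list)
  have um: "C_k (length l) u" using C_k_le[OF u] l by simp
  have "foldr partial_deriv l P 0 = (\<Sum>\<beta>\<in>?I. c \<beta> * foldr partial_deriv l (\<lambda>y. multi_power y \<beta>) 0)"
    unfolding P_def
    using foldr_partial_deriv_sum[of ?I l "\<lambda>\<beta> y. multi_power y \<beta>" c] l by simp
  also have "\<dots> = (\<Sum>\<beta>\<in>?I. if \<beta> = \<gamma> then c \<beta> * multi_fact \<beta> else 0)"
    unfolding k foldr_partial_deriv_multi_power \<gamma>_def by (intro sum.cong) auto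
  also have "\<dots> = multi_deriv \<gamma> u 0"
    using \<gamma> by (simp add: finite_multi_size c_def)
  also have "\<dots> = foldr partial_deriv l u 0"
    unfolding multi_deriv_foldr
    by (subst foldr_partial_deriv_perm[OF um l(1), of "map ?ax (multi_list \<gamma>)"])
      (simp_all add: k \<gamma>_def mset_multi_list_count_list)
  finally have "foldr partial_deriv l P 0 = foldr partial_deriv l u 0" .
  moreover have "foldr partial_deriv l (\<lambda>y. 1 * u y + (-1) * P y) =
    (\<lambda>x. 1 * foldr partial_deriv l u x + (-1) * foldr partial_deriv l P x)"
    using um l by (intro foldr_partial_deriv_lin) (auto simp: P_def intro!: C_k_sum)
  ultimately show ?thesis unfolding P_def c_def by simp
qed

subsection \<open>Symbol estimates\<close>

text \<open>\<open>a\<close> and \<open>b\<close> are the first two derivatives of \<open>t \<mapsto> f (y + t v)\<close> at \<open>0\<close>; below,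
  \<open>symbol_on S W f\<close> says that \<open>|y|\<^sup>k |D\<^sup>k f(y)| \<le> W y\<close> on \<open>S\<close> for \<open>k \<le> 2\<close>.\<close>

definition line_jet :: "('a::real_normed_vector \<Rightarrow> real) \<Rightarrow> 'a \<Rightarrow> 'a \<Rightarrow> real \<Rightarrow> real \<Rightarrow> bool" where
  "line_jet f y v a b \<longleftrightarrow>
    (\<exists>g. (\<forall>\<^sub>F t in nhds 0. ((\<lambda>t. f (y + t *\<^sub>R v)) has_real_derivative g t) (at t)) \<and>
         g 0 = a \<and> (g has_real_derivative b) (at 0))"

lemma line_jetI:
  assumes "\<forall>\<^sub>F t in nhds 0. ((\<lambda>t. f (y + t *\<^sub>R v)) has_real_derivative g t) (at t)"
    "g 0 = a" "(g has_real_derivative b) (at 0)"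
  shows "line_jet f y v a b"
  using assms unfolding line_jet_def by blast

lemma line_jet_first: "line_jet f y v a b \<Longrightarrow> ((\<lambda>t. f (y + t *\<^sub>R v)) has_real_derivative a) (at 0)"
  unfolding line_jet_def by (auto dest: eventually_nhds_x_imp_x)

lemma line_jet_const: "line_jet (\<lambda>_. c) y v 0 0"
  by (rule line_jetI[where g = "\<lambda>_. 0"]) auto

lemma line_jet_add:
  assumes "line_jet f y v a b" "line_jet g y v a' b'"
  shows "line_jet (\<lambda>y. f y + g y) y v (a + a') (b + b')"
proof -
  obtain F where F: "\<forall>\<^sub>F t in nhds 0. ((\<lambda>t. f (y + t *\<^sub>R v)) has_real_derivative F t) (at t)"
    "F 0 = a" "(F has_real_derivative b) (at 0)" using assms unfolding line_jet_def by blast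
  obtain G where G: "\<forall>\<^sub>F t in nhds 0. ((\<lambda>t. g (y + t *\<^sub>R v)) has_real_derivative G t) (at t)"
    "G 0 = a'" "(G has_real_derivative b') (at 0)" using assms unfolding line_jet_def by blast
  show ?thesis
  proof (rule line_jetI[where g = "\<lambda>t. F t + G t"])
    show "\<forall>\<^sub>F t in nhds 0. ((\<lambda>t. f (y + t *\<^sub>R v) + g (y + t *\<^sub>R v)) has_real_derivative F t + G t) (at t)"
      using F(1) G(1) by eventually_elim (auto intro!: derivative_eq_intros)
  qed (use F G in \<open>auto intro!: derivative_eq_intros\<close>)
qed

lemma line_jet_mult:
  assumes "line_jet f y v a b" "line_jet g y v a' b'"
  shows "line_jet (\<lambda>y. f y * g y) y v (a * g y + a' * f y) (b * g y + 2 * a * a' + b' * f y)"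
proof -
  obtain F where F: "\<forall>\<^sub>F t in nhds 0. ((\<lambda>t. f (y + t *\<^sub>R v)) has_real_derivative F t) (at t)"
    "F 0 = a" "(F has_real_derivative b) (at 0)" using assms unfolding line_jet_def by blast
  obtain G where G: "\<forall>\<^sub>F t in nhds 0. ((\<lambda>t. g (y + t *\<^sub>R v)) has_real_derivative G t) (at t)"
    "G 0 = a'" "(G has_real_derivative b') (at 0)" using assms unfolding line_jet_def by blast
  note D = assms[THEN line_jet_first]
  show ?thesis
  proof (rule line_jetI[where g = "\<lambda>t. F t * g (y + t *\<^sub>R v) + G t * f (y + t *\<^sub>R v)"])
    show "\<forall>\<^sub>F t in nhds 0. ((\<lambda>t. f (y + t *\<^sub>R v) * g (y + t *\<^sub>R v)) has_real_derivative
        F t * g (y + t *\<^sub>R v) + G t * f (y + t *\<^sub>R v)) (at t)"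
      using F(1) G(1) by eventually_elim (auto intro!: derivative_eq_intros)
    show "((\<lambda>t. F t * g (y + t *\<^sub>R v) + G t * f (y + t *\<^sub>R v)) has_real_derivative
        b * g y + 2 * a * a' + b' * f y) (at 0)"
      using F(2,3) G(2,3) D by (auto intro!: derivative_eq_intros)
  qed (use F G in auto)
qed

text \<open>Derivatives of \<open>g\<close> are asked for on the positive reals only, which admits
  square roots and real powers; continuity of \<open>f\<close> along the line keeps its values
  positive near \<open>y\<close>.\<close>

lemma line_jet_compose:
  fixes g :: "real \<Rightarrow> real"
  assumes f: "line_jet f y v a b"
    and g: "\<And>r. r > 0 \<Longrightarrow> (g has_real_derivative g' r) (at r)"
      "\<And>r. r > 0 \<Longrightarrow> (g' has_real_derivative g'' r) (at r)"
    and pos: "f y > 0"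
  shows "line_jet (\<lambda>y. g (f y)) y v (g' (f y) * a) (g'' (f y) * a\<^sup>2 + g' (f y) * b)"
proof -
  obtain F where F: "\<forall>\<^sub>F t in nhds 0. ((\<lambda>t. f (y + t *\<^sub>R v)) has_real_derivative F t) (at t)"
    "F 0 = a" "(F has_real_derivative b) (at 0)" using f unfolding line_jet_def by blast
  note D = line_jet_first[OF f]
  have "isCont (\<lambda>t. f (y + t *\<^sub>R v)) 0" using D by (rule DERIV_isCont)
  then have "(\<lambda>t. f (y + t *\<^sub>R v)) \<midarrow>0\<rightarrow> f y" by (simp add: isCont_def)
  then have "\<forall>\<^sub>F t in at 0. f (y + t *\<^sub>R v) > 0" using pos by (rule order_tendstoD(1))
  then have ev: "\<forall>\<^sub>F t in nhds 0. f (y + t *\<^sub>R v) > 0"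
    using pos by (auto simp: eventually_nhds_conv_at)
  show ?thesis
  proof (rule line_jetI[where g = "\<lambda>t. g' (f (y + t *\<^sub>R v)) * F t"])
    show "\<forall>\<^sub>F t in nhds 0. ((\<lambda>t. g (f (y + t *\<^sub>R v))) has_real_derivative g' (f (y + t *\<^sub>R v)) * F t) (at t)"
      using F(1) ev by eventually_elim (rule DERIV_chain2[OF g(1)])
    have "((\<lambda>t. g' (f (y + t *\<^sub>R v))) has_real_derivative g'' (f y) * a) (at 0)"
      by (rule DERIV_chain2[OF _ D]) (use g pos in auto)
    then show "((\<lambda>t. g' (f (y + t *\<^sub>R v)) * F t) has_real_derivative g'' (f y) * a\<^sup>2 + g' (f y) * b) (at 0)"
      using F by (auto intro!: derivative_eq_intros simp: power2_eq_square)
  qed (use F in auto)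
qed

lemma line_jet_cong:
  assumes "line_jet f y v a b" "\<forall>\<^sub>F z in nhds y. f z = g z"
  shows "line_jet g y v a b"
proof -
  obtain F where F: "\<forall>\<^sub>F t in nhds 0. ((\<lambda>t. f (y + t *\<^sub>R v)) has_real_derivative F t) (at t)"
    "F 0 = a" "(F has_real_derivative b) (at 0)" using assms unfolding line_jet_def by blast
  have "isCont (\<lambda>t. y + t *\<^sub>R v) 0" by (intro continuous_intros)
  then have "filterlim (\<lambda>t. y + t *\<^sub>R v) (nhds y) (nhds 0)"
    using tendsto_at_iff_tendsto_nhds[of "\<lambda>t. y + t *\<^sub>R v" 0] by (simp add: isCont_def)
  then have "\<forall>\<^sub>F t in nhds 0. f (y + t *\<^sub>R v) = g (y + t *\<^sub>R v)"
    using assms(2) eventually_compose_filterlim by blast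
  \<comment> \<open>Transferring a derivative at a nearby \<open>t\<close> requires agreement in a
    neighbourhood of that \<open>t\<close>, not only at \<open>t\<close>.\<close>
  then have "\<forall>\<^sub>F t in nhds 0. \<forall>\<^sub>F t in nhds t. f (y + t *\<^sub>R v) = g (y + t *\<^sub>R v)"
    by (simp add: eventually_eventually)
  then have "\<forall>\<^sub>F t in nhds 0. ((\<lambda>t. g (y + t *\<^sub>R v)) has_real_derivative F t) (at t)"
    using F(1)
  proof eventually_elim
    case (elim t)
    then show ?case by (simp cong: DERIV_cong_ev)
  qed
  then show ?thesis using F(2,3) by (rule line_jetI)
qed

definition symbol_on :: "'a::real_normed_vector set \<Rightarrow> ('a \<Rightarrow> real) \<Rightarrow> ('a \<Rightarrow> real) \<Rightarrow> bool" where
  "symbol_on S W f \<longleftrightarrow> (\<forall>y\<in>S. \<bar>f y\<bar> \<le> W y \<and>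
     (\<forall>v. \<exists>a b. line_jet f y v a b \<and> \<bar>a\<bar> * norm y \<le> W y * norm v \<and>
       \<bar>b\<bar> * (norm y)\<^sup>2 \<le> W y * (norm v)\<^sup>2))"

lemma symbol_onI:
  assumes "\<And>y. y \<in> S \<Longrightarrow> \<bar>f y\<bar> \<le> W y"
    and "\<And>y v. y \<in> S \<Longrightarrow> \<exists>a b. line_jet f y v a b \<and> \<bar>a\<bar> * norm y \<le> W y * norm v \<and>
       \<bar>b\<bar> * (norm y)\<^sup>2 \<le> W y * (norm v)\<^sup>2"
  shows "symbol_on S W f"
  using assms unfolding symbol_on_def by blast

lemma symbol_on_bound: "symbol_on S W f \<Longrightarrow> y \<in> S \<Longrightarrow> \<bar>f y\<bar> \<le> W y"
  unfolding symbol_on_def by blast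

lemma symbol_on_jet:
  assumes "symbol_on S W f" "y \<in> S"
  obtains a b where "line_jet f y v a b" "\<bar>a\<bar> * norm y \<le> W y * norm v"
    "\<bar>b\<bar> * (norm y)\<^sup>2 \<le> W y * (norm v)\<^sup>2"
  using assms unfolding symbol_on_def by blast

lemma symbol_on_mono:
  assumes "symbol_on S W f" "\<And>y. y \<in> T \<Longrightarrow> W y \<le> V y" "T \<subseteq> S"
  shows "symbol_on T V f"
proof (rule symbol_onI)
  fix y assume y: "y \<in> T"
  then show "\<bar>f y\<bar> \<le> V y" using assms symbol_on_bound by fastforce
  fix v
  obtain a b where ab: "line_jet f y v a b" "\<bar>a\<bar> * norm y \<le> W y * norm v"
    "\<bar>b\<bar> * (norm y)\<^sup>2 \<le> W y * (norm v)\<^sup>2" using symbol_on_jet[OF assms(1)] y assms(3) by blast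
  moreover have "W y * norm v \<le> V y * norm v" "W y * (norm v)\<^sup>2 \<le> V y * (norm v)\<^sup>2"
    using assms(2)[OF y] by (auto intro!: mult_right_mono)
  ultimately show "\<exists>a b. line_jet f y v a b \<and> \<bar>a\<bar> * norm y \<le> V y * norm v \<and> \<bar>b\<bar> * (norm y)\<^sup>2 \<le> V y * (norm v)\<^sup>2"
    by (meson order_trans)
qed

lemma symbol_on_cong:
  assumes "symbol_on S W f" "\<And>y. y \<in> S \<Longrightarrow> \<forall>\<^sub>F z in nhds y. f z = g z"
  shows "symbol_on S W g"
proof (rule symbol_onI)
  fix y assume y: "y \<in> S"
  then have "f y = g y" using assms(2) eventually_nhds_x_imp_x by fastforce
  then show "\<bar>g y\<bar> \<le> W y" using symbol_on_bound[OF assms(1) y] by simp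
  fix v
  show "\<exists>a b. line_jet g y v a b \<and> \<bar>a\<bar> * norm y \<le> W y * norm v \<and> \<bar>b\<bar> * (norm y)\<^sup>2 \<le> W y * (norm v)\<^sup>2"
    by (rule symbol_on_jet[OF assms(1) y, of v]) (use line_jet_cong assms(2)[OF y] in blast)
qed

lemma symbol_on_union:
  "symbol_on S W f \<Longrightarrow> symbol_on T W f \<Longrightarrow> symbol_on (S \<union> T) W f"
  unfolding symbol_on_def by blast

lemma symbol_on_const: "symbol_on S (\<lambda>_. \<bar>c\<bar>) (\<lambda>_. c)"
  by (rule symbol_onI) (auto intro!: line_jet_const exI[of _ 0])

lemma symbol_on_add:
  assumes "symbol_on S W f" "symbol_on S V g"
  shows "symbol_on S (\<lambda>y. W y + V y) (\<lambda>y. f y + g y)"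
proof (rule symbol_onI)
  fix y assume y: "y \<in> S"
  note B = symbol_on_bound[OF assms(1) y] symbol_on_bound[OF assms(2) y]
  show "\<bar>f y + g y\<bar> \<le> W y + V y" using B by linarith
  fix v
  obtain a b where ab: "line_jet f y v a b" "\<bar>a\<bar> * norm y \<le> W y * norm v"
    "\<bar>b\<bar> * (norm y)\<^sup>2 \<le> W y * (norm v)\<^sup>2" using symbol_on_jet[OF assms(1) y] by blast
  obtain a' b' where ab': "line_jet g y v a' b'" "\<bar>a'\<bar> * norm y \<le> V y * norm v"
    "\<bar>b'\<bar> * (norm y)\<^sup>2 \<le> V y * (norm v)\<^sup>2" using symbol_on_jet[OF assms(2) y] by blast
  have "\<bar>a + a'\<bar> * norm y \<le> \<bar>a\<bar> * norm y + \<bar>a'\<bar> * norm y"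
    by (simp add: distrib_right[symmetric] mult_right_mono)
  also have "\<dots> \<le> (W y + V y) * norm v" using ab(2) ab'(2) by (simp add: distrib_right)
  finally have 1: "\<bar>a + a'\<bar> * norm y \<le> (W y + V y) * norm v" .
  have "\<bar>b + b'\<bar> * (norm y)\<^sup>2 \<le> \<bar>b\<bar> * (norm y)\<^sup>2 + \<bar>b'\<bar> * (norm y)\<^sup>2"
    by (simp add: distrib_right[symmetric] mult_right_mono)
  also have "\<dots> \<le> (W y + V y) * (norm v)\<^sup>2" using ab(3) ab'(3) by (simp add: distrib_right)
  finally have 2: "\<bar>b + b'\<bar> * (norm y)\<^sup>2 \<le> (W y + V y) * (norm v)\<^sup>2" .
  show "\<exists>a b. line_jet (\<lambda>y. f y + g y) y v a b \<and> \<bar>a\<bar> * norm y \<le> (W y + V y) * norm v \<and>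
     \<bar>b\<bar> * (norm y)\<^sup>2 \<le> (W y + V y) * (norm v)\<^sup>2"
    using line_jet_add[OF ab(1) ab'(1)] 1 2 by blast
qed

text \<open>Leibniz rule: the second derivative of a product has the coefficients 1, 2, 1, whence
  the factor 4, which is used for the lower orders as well.\<close>

lemma symbol_on_mult:
  assumes "symbol_on S W f" "symbol_on S V g"
  shows "symbol_on S (\<lambda>y. 4 * (W y * V y)) (\<lambda>y. f y * g y)"
proof (rule symbol_onI)
  fix y assume y: "y \<in> S"
  note B = symbol_on_bound[OF assms(1) y] symbol_on_bound[OF assms(2) y]
  have W: "W y \<ge> 0" "V y \<ge> 0" using B by linarith+
  have fg: "\<bar>f y * g y\<bar> \<le> W y * V y"
    unfolding abs_mult using B W by (intro mult_mono) auto
  also have "\<dots> \<le> 4 * (W y * V y)" using W by simp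
  finally show "\<bar>f y * g y\<bar> \<le> 4 * (W y * V y)" .
  fix v
  obtain a b where ab: "line_jet f y v a b" "\<bar>a\<bar> * norm y \<le> W y * norm v"
    "\<bar>b\<bar> * (norm y)\<^sup>2 \<le> W y * (norm v)\<^sup>2" using symbol_on_jet[OF assms(1) y] by blast
  obtain a' b' where ab': "line_jet g y v a' b'" "\<bar>a'\<bar> * norm y \<le> V y * norm v"
    "\<bar>b'\<bar> * (norm y)\<^sup>2 \<le> V y * (norm v)\<^sup>2" using symbol_on_jet[OF assms(2) y] by blast
  let ?n = "norm y" and ?m = "norm v"
  have "\<bar>a * g y\<bar> * ?n \<le> (W y * V y) * ?m"
    using mult_mono[OF ab(2) B(2)] W by (simp add: abs_mult mult_ac)
  moreover have "\<bar>a' * f y\<bar> * ?n \<le> (W y * V y) * ?m"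
    using mult_mono[OF ab'(2) B(1)] W by (simp add: abs_mult mult_ac)
  moreover have "\<bar>a * g y + a' * f y\<bar> * ?n \<le> \<bar>a * g y\<bar> * ?n + \<bar>a' * f y\<bar> * ?n"
    by (simp add: distrib_right[symmetric] mult_right_mono)
  moreover have "0 \<le> (W y * V y) * ?m" using W by simp
  ultimately have 1: "\<bar>a * g y + a' * f y\<bar> * ?n \<le> 4 * (W y * V y) * ?m" by linarith
  have lin: "\<bar>p + 2 * q + r\<bar> \<le> \<bar>p\<bar> + 2 * \<bar>q\<bar> + \<bar>r\<bar>" for p q r :: real by linarith
  have "\<bar>b * g y\<bar> * ?n\<^sup>2 \<le> (W y * V y) * ?m\<^sup>2"
    using mult_mono[OF ab(3) B(2)] W by (simp add: abs_mult mult_ac)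
  moreover have "\<bar>b' * f y\<bar> * ?n\<^sup>2 \<le> (W y * V y) * ?m\<^sup>2"
    using mult_mono[OF ab'(3) B(1)] W by (simp add: abs_mult mult_ac)
  moreover have "\<bar>a * a'\<bar> * ?n\<^sup>2 \<le> (W y * V y) * ?m\<^sup>2"
    using mult_mono[OF ab(2) ab'(2)] W by (simp add: abs_mult mult_ac power2_eq_square)
  moreover have "\<bar>b * g y + 2 * a * a' + b' * f y\<bar> * ?n\<^sup>2
      \<le> (\<bar>b * g y\<bar> + 2 * \<bar>a * a'\<bar> + \<bar>b' * f y\<bar>) * ?n\<^sup>2"
    using lin[of "b * g y" "a * a'" "b' * f y"] by (intro mult_right_mono) (auto simp: mult.assoc)
  ultimately have 2: "\<bar>b * g y + 2 * a * a' + b' * f y\<bar> * ?n\<^sup>2 \<le> 4 * (W y * V y) * ?m\<^sup>2"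
    by (simp add: distrib_right)
  show "\<exists>a b. line_jet (\<lambda>y. f y * g y) y v a b \<and> \<bar>a\<bar> * ?n \<le> 4 * (W y * V y) * ?m \<and>
     \<bar>b\<bar> * ?n\<^sup>2 \<le> 4 * (W y * V y) * ?m\<^sup>2"
    using line_jet_mult[OF ab(1) ab'(1)] 1 2 by blast
qed

lemma symbol_on_sum:
  assumes "\<And>i. i \<in> I \<Longrightarrow> symbol_on S (W i) (f i)"
  shows "symbol_on S (\<lambda>y. \<Sum>i\<in>I. W i y) (\<lambda>y. \<Sum>i\<in>I. f i y)"
  using assms
proof (induction I rule: infinite_finite_induct)
  case (insert i I)
  then show ?case using symbol_on_add[of S "W i" "f i" "\<lambda>y. \<Sum>i\<in>I. W i y" "\<lambda>y. \<Sum>i\<in>I. f i y"] by simp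
qed (use symbol_on_const[of S 0] in auto)

lemma symbol_on_coord: "symbol_on S norm (\<lambda>y :: real ^ 'n::finite. y $ i)"
proof (rule symbol_onI)
  fix y v :: "real ^ 'n"
  show "\<bar>y $ i\<bar> \<le> norm y" by (rule component_le_norm_cart)
  have "line_jet (\<lambda>y. y $ i) y v (v $ i) 0"
    by (rule line_jetI[where g = "\<lambda>_. v $ i"]) (auto intro!: derivative_eq_intros always_eventually)
  moreover have "\<bar>v $ i\<bar> * norm y \<le> norm y * norm v"
    using component_le_norm_cart[of v i] by (metis mult.commute mult_right_mono norm_ge_zero)
  ultimately show "\<exists>a b. line_jet (\<lambda>y. y $ i) y v a b \<and> \<bar>a\<bar> * norm y \<le> norm y * norm v \<and>
      \<bar>b\<bar> * (norm y)\<^sup>2 \<le> norm y * (norm v)\<^sup>2"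
    by (intro exI[of _ "v $ i"] exI[of _ 0]) auto
qed

lemma symbol_on_norm_power_mult:
  assumes "symbol_on S (\<lambda>y. C * norm y ^ m) f" "symbol_on S (\<lambda>y. D * norm y ^ n) g"
  shows "symbol_on S (\<lambda>y. (4 * C * D) * norm y ^ (m + n)) (\<lambda>y. f y * g y)"
  using symbol_on_mult[OF assms] by (simp add: power_add mult_ac)

lemma symbol_on_coord_power:
  "\<exists>C. symbol_on S (\<lambda>y. C * norm y ^ n) (\<lambda>y :: real ^ 'n::finite. (y $ i) ^ n)"
proof (induction n)
  case 0
  show ?case using symbol_on_const[of S 1] by (intro exI[of _ 1]) simp
next
  case (Suc n)
  then obtain C where C: "symbol_on S (\<lambda>y. C * norm y ^ n) (\<lambda>y :: real ^ 'n::finite. (y $ i) ^ n)" by blast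
  have "symbol_on S (\<lambda>y. 1 * norm y ^ 1) (\<lambda>y :: real ^ 'n::finite. y $ i)"
    using symbol_on_coord by simp
  from symbol_on_norm_power_mult[OF this C] show ?case by auto
qed

lemma symbol_on_multi_power: "\<exists>C. symbol_on S (\<lambda>y. C * norm y ^ multi_size \<beta>) (\<lambda>y. multi_power y \<beta>)"
proof -
  have "\<exists>C. symbol_on S (\<lambda>y. C * norm y ^ (\<Sum>i\<in>I. \<beta> i)) (\<lambda>y. \<Prod>i\<in>I. (y $ i) ^ \<beta> i)" for I
  proof (induction I rule: infinite_finite_induct)
    case (insert i I)
    then obtain C where C: "symbol_on S (\<lambda>y. C * norm y ^ (\<Sum>i\<in>I. \<beta> i)) (\<lambda>y. \<Prod>i\<in>I. (y $ i) ^ \<beta> i)" by blast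
    obtain D where "symbol_on S (\<lambda>y. D * norm y ^ \<beta> i) (\<lambda>y. (y $ i) ^ \<beta> i)"
      using symbol_on_coord_power by blast
    from symbol_on_norm_power_mult[OF this C] show ?case using insert by auto
  qed (use symbol_on_const[of S 1] in \<open>auto intro!: exI[of _ 1]\<close>)
  then show ?thesis unfolding multi_size_def multi_power_def .
qed

section \<open>Radial functions and powers of the norm\<close>

lemma norm_add_scaleR_squared:
  fixes y v :: "'a::real_inner"
  shows "(norm (y + t *\<^sub>R v))\<^sup>2 = (norm y)\<^sup>2 + 2 * t * (y \<bullet> v) + t\<^sup>2 * (norm v)\<^sup>2"
proof -
  have "(norm (y + t *\<^sub>R v))\<^sup>2 = (norm y)\<^sup>2 + (norm (t *\<^sub>R v))\<^sup>2 + 2 * (y \<bullet> (t *\<^sub>R v))"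
    by (simp only: power2_norm_eq_inner inner_add_left inner_add_right inner_commute)
  then show ?thesis by (simp add: power_mult_distrib)
qed

text \<open>Along a line the norm is the square root of a quadratic polynomial, which is positive at
  \<open>t = 0\<close> because \<open>y \<noteq> 0\<close>.\<close>

lemma line_jet_norm:
  fixes y v :: "'a::real_inner"
  assumes "y \<noteq> 0"
  shows "line_jet norm y v ((y \<bullet> v) / norm y) ((norm v)\<^sup>2 / norm y - (y \<bullet> v)\<^sup>2 / norm y ^ 3)"
proof -
  define q where "q = (\<lambda>z :: 'a. (norm z)\<^sup>2)"
  have q: "line_jet q y v (2 * (y \<bullet> v)) (2 * (norm v)\<^sup>2)"
    unfolding q_def
    by (rule line_jetI[where g = "\<lambda>t. 2 * (y \<bullet> v) + 2 * t * (norm v)\<^sup>2"])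
      (auto simp: norm_add_scaleR_squared intro!: derivative_eq_intros always_eventually)
  have "line_jet (\<lambda>z. sqrt (q z)) y v (inverse (sqrt (q y)) / 2 * (2 * (y \<bullet> v)))
    ((- (inverse (sqrt (q y)) / 2 / (2 * q y))) * (2 * (y \<bullet> v))\<^sup>2 + inverse (sqrt (q y)) / 2 * (2 * (norm v)\<^sup>2))"
  proof (rule line_jet_compose[OF q])
    fix r :: real assume r: "r > 0"
    show "(sqrt has_real_derivative inverse (sqrt r) / 2) (at r)" by (rule DERIV_real_sqrt[OF r])
    show "((\<lambda>r. inverse (sqrt r) / 2) has_real_derivative - (inverse (sqrt r) / 2 / (2 * r))) (at r)"
      using r by (auto intro!: derivative_eq_intros simp: field_simps power2_eq_square real_sqrt_mult_self)
  next
    show "q y > 0" using assms by (simp add: q_def)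
  qed
  moreover have "inverse (norm y) / 2 * (2 * (y \<bullet> v)) = (y \<bullet> v) / norm y"
    by (simp add: field_simps)
  moreover have "(- (inverse (norm y) / 2 / (2 * (norm y)\<^sup>2))) * (2 * (y \<bullet> v))\<^sup>2 + inverse (norm y) / 2 * (2 * (norm v)\<^sup>2)
     = (norm v)\<^sup>2 / norm y - (y \<bullet> v)\<^sup>2 / norm y ^ 3"
    using assms by (simp add: field_simps power2_eq_square power3_eq_cube)
  ultimately show ?thesis by (simp add: q_def)
qed

text \<open>Chain rule with the jet of the norm. The second derivative has the two terms
  \<open>g'' a\<^sup>2\<close> and \<open>g' b\<close>, each controlled by \<open>W\<close>, which
  gives the factor 2.\<close>

lemma symbol_on_radial:
  fixes g g' g'' W :: "real \<Rightarrow> real" and S :: "'a::real_inner set"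
  assumes g: "\<And>r. r > 0 \<Longrightarrow> (g has_real_derivative g' r) (at r)"
      "\<And>r. r > 0 \<Longrightarrow> (g' has_real_derivative g'' r) (at r)"
    and W: "\<And>y. y \<in> S \<Longrightarrow> \<bar>g (norm y)\<bar> \<le> W (norm y)"
      "\<And>y. y \<in> S \<Longrightarrow> \<bar>g' (norm y)\<bar> * norm y \<le> W (norm y)"
      "\<And>y. y \<in> S \<Longrightarrow> \<bar>g'' (norm y)\<bar> * (norm y)\<^sup>2 \<le> W (norm y)"
    and S: "0 \<notin> S"
  shows "symbol_on S (\<lambda>y. 2 * W (norm y)) (\<lambda>y. g (norm y))"
proof (rule symbol_onI)
  fix y v :: 'a assume y: "y \<in> S"
  then have n: "norm y > 0" using S by auto
  note B = W[OF y]
  have W0: "W (norm y) \<ge> 0" using B(1) by linarith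
  show "\<bar>g (norm y)\<bar> \<le> 2 * W (norm y)" using B W0 by linarith
  define a where "a = (y \<bullet> v) / norm y"
  define b where "b = (norm v)\<^sup>2 / norm y - (y \<bullet> v)\<^sup>2 / norm y ^ 3"
  have yv: "\<bar>y \<bullet> v\<bar> \<le> norm y * norm v" by (rule Cauchy_Schwarz_ineq2)
  have a: "\<bar>a\<bar> \<le> norm v" using yv n by (simp add: a_def field_simps)
  have a2: "a\<^sup>2 \<le> (norm v)\<^sup>2" using power_mono[OF a, of 2] by simp
  \<comment> \<open>This is the squared length of the component of \<open>v\<close> orthogonal to
    \<open>y\<close>, hence it lies between 0 and \<open>(norm v)\<^sup>2\<close>.\<close>
  have "b * norm y = (norm v)\<^sup>2 - a\<^sup>2"
    using n by (simp add: a_def b_def field_simps power2_eq_square power3_eq_cube)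
  moreover have "\<bar>b\<bar> * norm y = \<bar>b * norm y\<bar>" by (simp add: abs_mult)
  ultimately have b: "\<bar>b\<bar> * norm y \<le> (norm v)\<^sup>2" using a2 by simp
  have "line_jet (\<lambda>y. g (norm y)) y v (g' (norm y) * a) (g'' (norm y) * a\<^sup>2 + g' (norm y) * b)"
    by (rule line_jet_compose) (use n g line_jet_norm a_def b_def in auto)
  moreover have "\<bar>g' (norm y) * a\<bar> * norm y \<le> 2 * W (norm y) * norm v"
  proof -
    have "\<bar>g' (norm y) * a\<bar> * norm y = (\<bar>g' (norm y)\<bar> * norm y) * \<bar>a\<bar>" by (simp add: abs_mult)
    also have "\<dots> \<le> W (norm y) * norm v" using B a W0 by (intro mult_mono) auto
    also have "\<dots> \<le> 2 * W (norm y) * norm v" using W0 by (intro mult_right_mono) auto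
    finally show ?thesis .
  qed
  moreover have "\<bar>g'' (norm y) * a\<^sup>2 + g' (norm y) * b\<bar> * (norm y)\<^sup>2 \<le> 2 * W (norm y) * (norm v)\<^sup>2"
  proof -
    have "\<bar>g'' (norm y) * a\<^sup>2 + g' (norm y) * b\<bar> \<le> \<bar>g'' (norm y)\<bar> * a\<^sup>2 + \<bar>g' (norm y)\<bar> * \<bar>b\<bar>"
      using abs_triangle_ineq[of "g'' (norm y) * a\<^sup>2" "g' (norm y) * b"] by (simp add: abs_mult)
    then have "\<bar>g'' (norm y) * a\<^sup>2 + g' (norm y) * b\<bar> * (norm y)\<^sup>2 \<le>
        (\<bar>g'' (norm y)\<bar> * a\<^sup>2 + \<bar>g' (norm y)\<bar> * \<bar>b\<bar>) * (norm y)\<^sup>2" by (rule mult_right_mono) simp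
    also have "\<dots> = (\<bar>g'' (norm y)\<bar> * (norm y)\<^sup>2) * a\<^sup>2 + (\<bar>g' (norm y)\<bar> * norm y) * (\<bar>b\<bar> * norm y)"
      by (simp add: algebra_simps power2_eq_square)
    also have "\<dots> \<le> W (norm y) * (norm v)\<^sup>2 + W (norm y) * (norm v)\<^sup>2"
      using B W0 a2 b by (intro add_mono mult_mono) auto
    finally show ?thesis by simp
  qed
  ultimately show "\<exists>a b. line_jet (\<lambda>y. g (norm y)) y v a b \<and> \<bar>a\<bar> * norm y \<le> 2 * W (norm y) * norm v \<and>
      \<bar>b\<bar> * (norm y)\<^sup>2 \<le> 2 * W (norm y) * (norm v)\<^sup>2"
    by blast
qed

text \<open>The constant \<open>(1 + p)\<^sup>2\<close> dominates the coefficients 1,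
  \<open>p\<close> and \<open>p * (p + 1)\<close> of the derivatives of order 0, 1 and 2.\<close>

lemma symbol_on_norm_powr:
  fixes S :: "'a::real_inner set"
  assumes "0 \<notin> S" "p \<ge> 0"
  shows "symbol_on S (\<lambda>y. 2 * ((1 + p)\<^sup>2 * norm y powr (- p))) (\<lambda>y. norm y powr (- p))"
proof (rule symbol_on_radial[where g = "\<lambda>r. r powr (-p)" and g' = "\<lambda>r. (-p) * r powr (-p - 1)"
      and g'' = "\<lambda>r. (-p) * ((-p - 1) * r powr (-p - 1 - 1))" and W = "\<lambda>r. (1 + p)\<^sup>2 * r powr (-p)"])
  show "0 \<notin> S" by (rule assms(1))
next
  fix r :: real assume "r > 0"
  then show "((\<lambda>r. r powr (-p)) has_real_derivative (-p) * r powr (-p - 1)) (at r)"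
    by (rule has_real_derivative_powr)
  have "((\<lambda>r. r powr (-p - 1)) has_real_derivative (-p - 1) * r powr (-p - 1 - 1)) (at r)"
    using \<open>r > 0\<close> by (rule has_real_derivative_powr)
  then show "((\<lambda>r. (-p) * r powr (-p - 1)) has_real_derivative (-p) * ((-p - 1) * r powr (-p - 1 - 1))) (at r)"
    by (rule DERIV_cmult)
next
  fix y assume "y \<in> S"
  then have n: "norm y > 0" using assms by auto
  have p1: "norm y powr (-p - 1) * norm y = norm y powr (-p)"
    using n powr_add[of "norm y" "-p - 1" 1] by simp
  have p2: "norm y powr (-p - 1 - 1) * (norm y)\<^sup>2 = norm y powr (-p)"
    using n powr_add[of "norm y" "-p - 1 - 1" 2] by simp
  have P: "norm y powr (-p) \<ge> 0" by simp
  have c: "1 \<le> (1 + p)\<^sup>2" "p \<le> (1 + p)\<^sup>2" "p * (p + 1) \<le> (1 + p)\<^sup>2"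
    using assms(2) by (auto simp: power2_eq_square algebra_simps)
  show "\<bar>norm y powr - p\<bar> \<le> (1 + p)\<^sup>2 * norm y powr - p"
    using mult_right_mono[OF c(1) P] by simp
  have "\<bar>(-p) * norm y powr (-p - 1)\<bar> * norm y = p * (norm y powr (-p - 1) * norm y)"
    using assms(2) by (simp add: abs_mult)
  then show "\<bar>(-p) * norm y powr (-p - 1)\<bar> * norm y \<le> (1 + p)\<^sup>2 * norm y powr - p"
    unfolding p1 using mult_right_mono[OF c(2) P] by simp
  have "\<bar>(-p) * ((-p - 1) * norm y powr (-p - 1 - 1))\<bar> * (norm y)\<^sup>2
      = (p * (p + 1)) * (norm y powr (-p - 1 - 1) * (norm y)\<^sup>2)"
    using assms(2) by (simp add: abs_mult)
  then show "\<bar>(-p) * ((-p - 1) * norm y powr (-p - 1 - 1))\<bar> * (norm y)\<^sup>2 \<le> (1 + p)\<^sup>2 * norm y powr - p"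
    unfolding p2 using mult_right_mono[OF c(3) P] by simp
qed

section \<open>Symbol estimates from vanishing Taylor coefficients\<close>

lemma line_jet_C_k:
  fixes f :: "'a::euclidean_space \<Rightarrow> real"
  assumes f: "C_k (Suc (Suc k)) f"
  shows "line_jet f y v (\<Sum>b\<in>Basis. (v \<bullet> b) * partial_deriv b f y)
    (\<Sum>b\<in>Basis. (v \<bullet> b) * (\<Sum>c\<in>Basis. (v \<bullet> c) * partial_deriv c (partial_deriv b f) y))"
proof (rule line_jetI[where g = "\<lambda>t. \<Sum>b\<in>Basis. (v \<bullet> b) * partial_deriv b f (y + t *\<^sub>R v)"])
  show "\<forall>\<^sub>F t in nhds 0. ((\<lambda>t. f (y + t *\<^sub>R v)) has_real_derivative
        (\<Sum>b\<in>Basis. v \<bullet> b * partial_deriv b f (y + t *\<^sub>R v))) (at t)"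
    by (intro always_eventually allI C_k_line_DERIV[OF f])
  have "((\<lambda>t. partial_deriv b f (y + t *\<^sub>R v)) has_real_derivative
      (\<Sum>c\<in>Basis. (v \<bullet> c) * partial_deriv c (partial_deriv b f) y)) (at 0)" if "b \<in> Basis" for b
    using C_k_line_DERIV[OF C_k_partial[OF f that], of y v 0] by simp
  then show "((\<lambda>t. \<Sum>b\<in>Basis. v \<bullet> b * partial_deriv b f (y + t *\<^sub>R v)) has_real_derivative
      (\<Sum>b\<in>Basis. v \<bullet> b * (\<Sum>c\<in>Basis. v \<bullet> c * partial_deriv c (partial_deriv b f) y))) (at 0)"
    by (intro DERIV_sum DERIV_cmult) auto
qed simp

text \<open>\<open>Taylor_vanishing_bound\<close> for \<open>R\<close>, its first and its second
  partials, with one common constant; each differentiation costs one power of the norm. It serves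
  the Taylor remainder of \<open>u\<close> and, on the real line, the cutoff.\<close>

lemma partial_derivs_bound:
  fixes R :: "'a::euclidean_space \<Rightarrow> real"
  assumes R: "C_k (Suc (Suc m)) R"
    and van: "\<And>l. set l \<subseteq> Basis \<Longrightarrow> length l < Suc (Suc m) \<Longrightarrow> foldr partial_deriv l R 0 = 0"
  obtains C where "C \<ge> 0" "\<And>y. y \<in> cball 0 \<rho> \<Longrightarrow> \<bar>R y\<bar> \<le> C * norm y ^ Suc (Suc m)"
    "\<And>y b. y \<in> cball 0 \<rho> \<Longrightarrow> b \<in> Basis \<Longrightarrow> \<bar>partial_deriv b R y\<bar> \<le> C * norm y ^ Suc m"
    "\<And>y b c. y \<in> cball 0 \<rho> \<Longrightarrow> b \<in> Basis \<Longrightarrow> c \<in> Basis \<Longrightarrow>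
       \<bar>partial_deriv c (partial_deriv b R) y\<bar> \<le> C * norm y ^ m"
proof -
  obtain C0 where C0: "\<And>y. y \<in> cball 0 \<rho> \<Longrightarrow> \<bar>R y\<bar> \<le> C0 * norm y ^ Suc (Suc m)"
    using Taylor_vanishing_bound[OF R van, of \<rho>] by blast
  have "\<exists>C. \<forall>y\<in>cball 0 \<rho>. \<bar>partial_deriv b R y\<bar> \<le> C * norm y ^ Suc m" if b: "b \<in> Basis" for b
  proof (rule Taylor_vanishing_bound)
    show "C_k (Suc m) (partial_deriv b R)" using R b by (rule C_k_partial)
    fix l :: "'a list" assume "set l \<subseteq> Basis" "length l < Suc m"
    then show "foldr partial_deriv l (partial_deriv b R) 0 = 0"
      using van[of "l @ [b]"] b by auto
  qed
  then obtain C1 where C1: "\<And>y b. y \<in> cball 0 \<rho> \<Longrightarrow> b \<in> Basis \<Longrightarrow> \<bar>partial_deriv b R y\<bar> \<le> C1 b * norm y ^ Suc m"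
    by metis
  have "\<exists>C. \<forall>y\<in>cball 0 \<rho>. \<bar>partial_deriv c (partial_deriv b R) y\<bar> \<le> C * norm y ^ m"
    if b: "b \<in> Basis" and c: "c \<in> Basis" for b c
  proof (rule Taylor_vanishing_bound)
    show "C_k m (partial_deriv c (partial_deriv b R))" using R b c C_k_partial by blast
    fix l :: "'a list" assume "set l \<subseteq> Basis" "length l < m"
    then show "foldr partial_deriv l (partial_deriv c (partial_deriv b R)) 0 = 0"
      using van[of "l @ [c, b]"] b c by auto
  qed
  then obtain C2 where C2: "\<And>y b c. y \<in> cball 0 \<rho> \<Longrightarrow> b \<in> Basis \<Longrightarrow> c \<in> Basis \<Longrightarrow>
      \<bar>partial_deriv c (partial_deriv b R) y\<bar> \<le> C2 b c * norm y ^ m"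
    by metis
  define C where "C = \<bar>C0\<bar> + (\<Sum>b\<in>Basis. \<bar>C1 b\<bar>) + (\<Sum>b\<in>Basis. \<Sum>c\<in>Basis. \<bar>C2 b c\<bar>)"
  have nn: "0 \<le> (\<Sum>b\<in>Basis. \<bar>C1 b\<bar>)" "0 \<le> (\<Sum>b\<in>Basis. \<Sum>c\<in>Basis. \<bar>C2 b c\<bar>)"
    by (auto intro!: sum_nonneg)
  have le: "C0 \<le> C" using nn unfolding C_def by linarith
  have le1: "C1 b \<le> C" if "b \<in> Basis" for b
  proof -
    have "\<bar>C1 b\<bar> \<le> (\<Sum>b\<in>Basis. \<bar>C1 b\<bar>)" using that by (intro member_le_sum) auto
    then show ?thesis using nn unfolding C_def by linarith
  qed
  have le2: "C2 b c \<le> C" if "b \<in> Basis" "c \<in> Basis" for b c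
  proof -
    have "\<bar>C2 b c\<bar> \<le> (\<Sum>c\<in>Basis. \<bar>C2 b c\<bar>)" using that by (intro member_le_sum) auto
    also have "\<dots> \<le> (\<Sum>b\<in>Basis. \<Sum>c\<in>Basis. \<bar>C2 b c\<bar>)"
      using that by (intro member_le_sum[of b Basis "\<lambda>b. \<Sum>c\<in>Basis. \<bar>C2 b c\<bar>"]) (auto intro!: sum_nonneg)
    finally show ?thesis using nn unfolding C_def by linarith
  qed
  show ?thesis
  proof (rule that[of C])
    show "0 \<le> C" using nn unfolding C_def by linarith
    show "\<bar>R y\<bar> \<le> C * norm y ^ Suc (Suc m)" if "y \<in> cball 0 \<rho>" for y
      using C0[OF that] le by (meson mult_right_mono norm_ge_zero order_trans zero_le_power)
    show "\<bar>partial_deriv b R y\<bar> \<le> C * norm y ^ Suc m" if "y \<in> cball 0 \<rho>" "b \<in> Basis" for y b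
      using C1[OF that] le1[OF that(2)] by (meson mult_right_mono norm_ge_zero order_trans zero_le_power)
    show "\<bar>partial_deriv c (partial_deriv b R) y\<bar> \<le> C * norm y ^ m"
      if "y \<in> cball 0 \<rho>" "b \<in> Basis" "c \<in> Basis" for y b c
      using C2[OF that] le2[OF that(2,3)] by (meson mult_right_mono norm_ge_zero order_trans zero_le_power)
  qed
qed

lemma symbol_on_Taylor_remainder:
  fixes R :: "'a::euclidean_space \<Rightarrow> real"
  assumes R: "C_k (Suc (Suc m)) R"
    and van: "\<And>l. set l \<subseteq> Basis \<Longrightarrow> length l < Suc (Suc m) \<Longrightarrow> foldr partial_deriv l R 0 = 0"
  shows "\<exists>C. symbol_on (cball 0 \<rho>) (\<lambda>y. C * norm y ^ Suc (Suc m)) R"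
proof -
  let ?d = "real DIM('a)"
  obtain C where C: "C \<ge> 0" "\<And>y. y \<in> cball 0 \<rho> \<Longrightarrow> \<bar>R y\<bar> \<le> C * norm y ^ Suc (Suc m)"
    "\<And>y b. y \<in> cball 0 \<rho> \<Longrightarrow> b \<in> Basis \<Longrightarrow> \<bar>partial_deriv b R y\<bar> \<le> C * norm y ^ Suc m"
    "\<And>y b c. y \<in> cball 0 \<rho> \<Longrightarrow> b \<in> Basis \<Longrightarrow> c \<in> Basis \<Longrightarrow>
       \<bar>partial_deriv c (partial_deriv b R) y\<bar> \<le> C * norm y ^ m"
    using partial_derivs_bound[OF R van, of \<rho>] by blast
  have d: "1 \<le> ?d" using DIM_positive[where 'a='a] by linarith
  have dd: "?d \<le> ?d * ?d" "1 \<le> ?d * ?d" using d mult_mono[of 1 ?d 1 ?d] by auto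
  \<comment> \<open>Crude bound for a sum over the basis. Used once it costs \<open>?d\<close>, used
    twice \<open>?d * ?d\<close>; the larger constant is then taken for all three estimates.\<close>
  have bound: "\<bar>\<Sum>b\<in>Basis. (v \<bullet> b) * g b\<bar> \<le> ?d * (norm v * K)"
    if "\<And>b. b \<in> Basis \<Longrightarrow> \<bar>g b\<bar> \<le> K" for v :: 'a and g K
  proof -
    have "\<bar>\<Sum>b\<in>Basis. (v \<bullet> b) * g b\<bar> \<le> (\<Sum>b\<in>Basis. \<bar>(v \<bullet> b) * g b\<bar>)" by (rule sum_abs)
    also have "\<dots> \<le> (\<Sum>b::'a\<in>Basis. norm v * K)"
      by (rule sum_mono) (auto simp: abs_mult intro!: mult_mono Basis_le_norm that)
    finally show ?thesis by simp
  qed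
  have "symbol_on (cball 0 \<rho>) (\<lambda>y. (?d * ?d * C) * norm y ^ Suc (Suc m)) R"
  proof (rule symbol_onI)
    fix y v :: 'a assume y: "y \<in> cball 0 \<rho>"
    let ?n = "norm y" and ?m = "norm v"
    have "C * ?n ^ Suc (Suc m) \<le> (?d * ?d * C) * ?n ^ Suc (Suc m)"
      using dd C(1) mult_right_mono[OF dd(2) C(1)] by (intro mult_right_mono) auto
    then show "\<bar>R y\<bar> \<le> (?d * ?d * C) * ?n ^ Suc (Suc m)" using C(2)[OF y] by linarith
    let ?a = "\<Sum>b\<in>Basis. (v \<bullet> b) * partial_deriv b R y"
    let ?b = "\<Sum>b\<in>Basis. (v \<bullet> b) * (\<Sum>c\<in>Basis. (v \<bullet> c) * partial_deriv c (partial_deriv b R) y)"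
    have "\<bar>?a\<bar> \<le> ?d * (?m * (C * ?n ^ Suc m))" by (intro bound C(3) y)
    then have "\<bar>?a\<bar> * ?n \<le> ?d * (?m * (C * ?n ^ Suc m)) * ?n" by (rule mult_right_mono) simp
    also have "\<dots> = ?d * (C * ?n ^ Suc (Suc m) * ?m)" by (simp add: mult_ac)
    also have "\<dots> \<le> (?d * ?d) * (C * ?n ^ Suc (Suc m) * ?m)"
      using dd(1) by (rule mult_right_mono) (use C(1) in simp)
    finally have a: "\<bar>?a\<bar> * ?n \<le> (?d * ?d * C) * ?n ^ Suc (Suc m) * ?m" by (simp add: mult_ac)
    have "\<bar>?b\<bar> \<le> ?d * (?m * (?d * (?m * (C * ?n ^ m))))" by (intro bound C(4) y)
    then have "\<bar>?b\<bar> * ?n\<^sup>2 \<le> ?d * (?m * (?d * (?m * (C * ?n ^ m)))) * ?n\<^sup>2" by (rule mult_right_mono) simp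
    also have "\<dots> = (?d * ?d * C) * ?n ^ Suc (Suc m) * ?m\<^sup>2" by (simp add: power2_eq_square mult_ac)
    finally have b: "\<bar>?b\<bar> * ?n\<^sup>2 \<le> (?d * ?d * C) * ?n ^ Suc (Suc m) * ?m\<^sup>2" .
    show "\<exists>a b. line_jet R y v a b \<and> \<bar>a\<bar> * ?n \<le> (?d * ?d * C) * ?n ^ Suc (Suc m) * ?m \<and>
       \<bar>b\<bar> * ?n\<^sup>2 \<le> (?d * ?d * C) * ?n ^ Suc (Suc m) * ?m\<^sup>2"
      using line_jet_C_k[OF R] a b by blast
  qed
  then show ?thesis by blast
qed

subsection \<open>Estimates for the numerator\<close>

text \<open>Exponent \<open>d + \<alpha>\<close> bounds the integrand, and exponent
  \<open>d + \<alpha> + 2\<close> is the weight \<open>g\<close>; as a parameter it lets both share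
  one integrability proof. The value at \<open>r = 0\<close> is 0.\<close>

definition radial_weight :: "real \<Rightarrow> real \<Rightarrow> real" where
  "radial_weight p r = min (r ^ 4) 1 * r powr (- p)"

lemma real_C_k_DERIV:
  fixes f :: "real \<Rightarrow> real"
  assumes "C_k (Suc k) f"
  shows "(f has_real_derivative partial_deriv 1 f x) (at x)"
  using C_k_DERIV[OF assms, of 1 0 x] by simp

text \<open>The big-O at 0 ignores the point itself, so \<open>r 0 = 0\<close> comes from
  continuity; then 0 is a minimum, which settles the first derivative. For the second,
  \<open>r z / z\<^sup>2\<close> is bounded by a multiple of \<open>\<bar>z\<bar>\<close> but tends
  to half of \<open>r'' 0\<close> by l'Hopital's rule.\<close>

lemma cutoff_derivs_vanish:
  fixes r :: "real \<Rightarrow> real"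
  assumes r: "C_k 3 r" and pos: "\<And>z. r z \<ge> 0" and O: "r \<in> O[at 0](\<lambda>z. \<bar>z\<bar> ^ 3)"
    and l: "set l \<subseteq> Basis" "length l < 3"
  shows "foldr partial_deriv l r 0 = 0"
proof -
  define r' where "r' = partial_deriv 1 r"
  define r'' where "r'' = partial_deriv 1 r'"
  have C2: "C_k (Suc (Suc 0)) r'" using C_k_partial[of 2 r 1] r by (simp add: r'_def numeral_3_eq_3 numeral_2_eq_2)
  have D: "(r has_real_derivative r' z) (at z)" for z
    using real_C_k_DERIV[of 2 r] r by (simp add: r'_def)
  have D': "(r' has_real_derivative r'' z) (at z)" for z
    using real_C_k_DERIV[OF C2] by (simp add: r''_def)
  obtain C where C: "\<forall>\<^sub>F z in at 0. norm (r z) \<le> C * norm (\<bar>z\<bar> ^ 3)"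
    using O unfolding bigo_def by blast
  have "r \<midarrow>0\<rightarrow> 0"
  proof (rule Lim_null_comparison[OF C])
    show "(\<lambda>z::real. C * norm (\<bar>z\<bar> ^ 3)) \<midarrow>0\<rightarrow> 0" by (auto intro!: tendsto_eq_intros)
  qed
  moreover have "r \<midarrow>0\<rightarrow> r 0" using DERIV_isCont[OF D[of 0]] unfolding isCont_def .
  ultimately have r0: "r 0 = 0" by (rule LIM_unique[rotated])
  have r'0: "r' 0 = 0"
    using DERIV_local_min[OF D[of 0] zero_less_one] pos r0 by simp
  have "r'' 0 = 0"
  proof -
    have "(\<lambda>z. r' z / z) \<midarrow>0\<rightarrow> r'' 0"
      using D'[of 0] r'0 by (simp add: has_field_derivative_iff)
    then have "(\<lambda>z. (r' z / z) / 2) \<midarrow>0\<rightarrow> r'' 0 / 2" by (intro tendsto_divide) auto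
    then have lim: "(\<lambda>z. r' z / (2 * z)) \<midarrow>0\<rightarrow> r'' 0 / 2" by (simp add: mult.commute)
    have "(\<lambda>z. r z / z\<^sup>2) \<midarrow>0\<rightarrow> r'' 0 / 2"
    proof (rule lhopital[OF _ _ _ _ _ _ lim])
      show "r \<midarrow>0\<rightarrow> 0" by fact
      show "(\<lambda>z::real. z\<^sup>2) \<midarrow>0\<rightarrow> 0" by (auto intro!: tendsto_eq_intros)
      show "\<forall>\<^sub>F z in at 0. (z::real)\<^sup>2 \<noteq> 0" "\<forall>\<^sub>F z in at 0. 2 * (z::real) \<noteq> 0"
        by (auto simp: eventually_at_filter)
      show "\<forall>\<^sub>F z in at 0. (r has_real_derivative r' z) (at z)" using D by auto
      show "\<forall>\<^sub>F z::real in at 0. ((\<lambda>z. z\<^sup>2) has_real_derivative 2 * z) (at z)"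
        by (intro always_eventually allI) (auto intro!: derivative_eq_intros)
    qed
    moreover have "(\<lambda>z. r z / z\<^sup>2) \<midarrow>0\<rightarrow> 0"
    proof (rule Lim_null_comparison)
      have "\<forall>\<^sub>F z::real in at 0. z \<noteq> 0" by (auto simp: eventually_at_filter)
      with C show "\<forall>\<^sub>F z in at 0. norm (r z / z\<^sup>2) \<le> C * \<bar>z\<bar>"
      proof eventually_elim
        case (elim z)
        have "\<bar>z\<bar> ^ 3 = \<bar>z\<bar> * z\<^sup>2" by (simp add: power3_eq_cube power2_eq_square)
        then have "\<bar>r z\<bar> \<le> (C * \<bar>z\<bar>) * z\<^sup>2" using elim(1) by simp
        then have "\<bar>r z\<bar> / z\<^sup>2 \<le> C * \<bar>z\<bar>" using elim(2) pos_divide_le_eq[of "z\<^sup>2"] by simp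
        then show ?case by simp
      qed
      show "(\<lambda>z::real. C * \<bar>z\<bar>) \<midarrow>0\<rightarrow> 0" by (auto intro!: tendsto_eq_intros)
    qed
    ultimately have "r'' 0 / 2 = 0" by (rule LIM_unique)
    then show ?thesis by simp
  qed
  moreover have "l = [] \<or> l = [1] \<or> l = [1, 1]"
    using l by (cases l; cases "tl l"; cases "tl (tl l)") auto
  ultimately show ?thesis using r0 r'0 by (auto simp: r'_def r''_def)
qed

text \<open>All derivatives of \<open>1 - w\<close> of order below 3 vanish at 0, so each derivative
  taken lowers the order 3 by one, and the radial lemma carries this over to \<open>y\<close>. The
  origin is removed because the norm is not differentiable there.\<close>

lemma symbol_on_cutoff:
  fixes w :: "real \<Rightarrow> real"
  assumes w: "C_k 3 w" and le: "\<And>z. w z \<le> 1" and O: "(\<lambda>z. 1 - w z) \<in> O[at 0](\<lambda>z. \<bar>z\<bar> ^ 3)"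
  shows "\<exists>C. symbol_on (cball 0 \<rho> - {0 :: 'a::real_inner}) (\<lambda>y. C * norm y ^ 3) (\<lambda>y. 1 - w (norm y))"
proof -
  define r where "r = (\<lambda>z. 1 - w z)"
  define r' where "r' = partial_deriv 1 r"
  define r'' where "r'' = partial_deriv 1 r'"
  have r: "C_k 3 r" unfolding r_def using C_k_lin[OF C_k_const w, of 1 1 "-1"] by simp
  have r3: "C_k (Suc (Suc 1)) r" using r by (simp add: numeral_3_eq_3)
  have C2: "C_k (Suc 1) r'" using C_k_partial[OF r3, of 1] by (simp add: r'_def)
  have D: "(r has_real_derivative r' z) (at z)" "(r' has_real_derivative r'' z) (at z)" for z
    using real_C_k_DERIV[OF r3] real_C_k_DERIV[OF C2] by (simp_all add: r'_def r''_def)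
  have van: "foldr partial_deriv l r 0 = 0" if "set l \<subseteq> Basis" "length l < Suc (Suc 1)" for l
    using that by (intro cutoff_derivs_vanish r) (use le O in \<open>auto simp: r_def\<close>)
  obtain C where C: "C \<ge> 0" "\<And>y. y \<in> cball 0 \<rho> \<Longrightarrow> \<bar>r y\<bar> \<le> C * norm y ^ Suc (Suc 1)"
    "\<And>y b. y \<in> cball 0 \<rho> \<Longrightarrow> b \<in> Basis \<Longrightarrow> \<bar>partial_deriv b r y\<bar> \<le> C * norm y ^ Suc 1"
    "\<And>y b c. y \<in> cball 0 \<rho> \<Longrightarrow> b \<in> Basis \<Longrightarrow> c \<in> Basis \<Longrightarrow>
       \<bar>partial_deriv c (partial_deriv b r) y\<bar> \<le> C * norm y ^ 1"
    using partial_derivs_bound[OF r3 van, of \<rho>] by blast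
  have "symbol_on (cball 0 \<rho> - {0 :: 'a}) (\<lambda>y. 2 * (\<lambda>z. C * z ^ 3) (norm y)) (\<lambda>y. r (norm y))"
  proof (rule symbol_on_radial[where g' = r' and g'' = r''])
    fix y :: 'a assume "y \<in> cball 0 \<rho> - {0}"
    then have y: "norm y \<in> cball 0 \<rho>" by simp
    show "\<bar>r (norm y)\<bar> \<le> C * norm y ^ 3" using C(2)[OF y] by (simp add: numeral_3_eq_3)
    show "\<bar>r' (norm y)\<bar> * norm y \<le> C * norm y ^ 3"
      using mult_right_mono[OF C(3)[OF y, of 1], of "norm y"] by (simp add: r'_def power3_eq_cube mult_ac)
    show "\<bar>r'' (norm y)\<bar> * (norm y)\<^sup>2 \<le> C * norm y ^ 3"
      using mult_right_mono[OF C(4)[OF y, of 1 1], of "(norm y)\<^sup>2"]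
      by (simp add: r'_def r''_def power3_eq_cube power2_eq_square mult_ac)
  qed (use D in auto)
  then show ?thesis unfolding r_def by (intro exI[of _ "2 * C"]) (simp add: mult.assoc)
qed

text \<open>Without a constant term, one factor \<open>norm y\<close> can be split off each
  monomial; the remaining powers are bounded by powers of \<open>\<rho>\<close>.\<close>

lemma symbol_on_Taylor_polynomial:
  fixes c :: "('n::finite \<Rightarrow> nat) \<Rightarrow> real"
  assumes "\<rho> \<ge> 1" "finite I" "\<And>\<beta>. \<beta> \<in> I \<Longrightarrow> multi_size \<beta> \<ge> 1"
  shows "\<exists>C. symbol_on (cball 0 \<rho>) (\<lambda>y. C * norm y) (\<lambda>y. \<Sum>\<beta>\<in>I. c \<beta> * multi_power y \<beta>)"
proof -
  have "\<exists>C. symbol_on (cball 0 \<rho>) (\<lambda>y. C * norm y) (\<lambda>y. c \<beta> * multi_power y \<beta>)" if "\<beta> \<in> I" for \<beta>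
  proof -
    let ?k = "multi_size \<beta> - 1"
    obtain C where C: "symbol_on (cball 0 \<rho>) (\<lambda>y. C * norm y ^ multi_size \<beta>) (\<lambda>y. multi_power y \<beta>)"
      using symbol_on_multi_power by blast
    from symbol_on_mult[OF symbol_on_const[of _ "c \<beta>"] this]
    have "symbol_on (cball 0 \<rho>) (\<lambda>y. (4 * \<bar>c \<beta>\<bar> * \<bar>C\<bar> * \<rho> ^ ?k) * norm y) (\<lambda>y. c \<beta> * multi_power y \<beta>)"
    proof (rule symbol_on_mono)
      fix y :: "real ^ 'n" assume y: "y \<in> cball 0 \<rho>"
      have "multi_size \<beta> = Suc ?k" using assms(3)[OF that] by simp
      then have "norm y ^ multi_size \<beta> = norm y ^ ?k * norm y" by (metis power_Suc2)
      also have "\<dots> \<le> \<rho> ^ ?k * norm y" using y by (intro mult_right_mono power_mono) auto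
      finally have "C * norm y ^ multi_size \<beta> \<le> \<bar>C\<bar> * (\<rho> ^ ?k * norm y)"
        by (intro mult_mono) auto
      then have "4 * \<bar>c \<beta>\<bar> * (C * norm y ^ multi_size \<beta>) \<le> 4 * \<bar>c \<beta>\<bar> * (\<bar>C\<bar> * (\<rho> ^ ?k * norm y))"
        by (intro mult_left_mono) auto
      then show "4 * (\<bar>c \<beta>\<bar> * (C * norm y ^ multi_size \<beta>)) \<le> (4 * \<bar>c \<beta>\<bar> * \<bar>C\<bar> * \<rho> ^ ?k) * norm y"
        by (simp add: mult_ac)
    qed auto
    then show ?thesis by blast
  qed
  then obtain C where "\<And>\<beta>. \<beta> \<in> I \<Longrightarrow> symbol_on (cball 0 \<rho>) (\<lambda>y. C \<beta> * norm y) (\<lambda>y. c \<beta> * multi_power y \<beta>)"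
    by metis
  from symbol_on_sum[OF this]
  have "symbol_on (cball 0 \<rho>) (\<lambda>y. (\<Sum>\<beta>\<in>I. C \<beta>) * norm y) (\<lambda>y. \<Sum>\<beta>\<in>I. c \<beta> * multi_power y \<beta>)"
    by (simp only: sum_distrib_right)
  then show ?thesis by blast
qed

lemma compactly_supported_bound:
  fixes f :: "'a::real_normed_vector \<Rightarrow> real"
  assumes "compactly_supported f"
  obtains \<rho> where "\<And>y. norm y > \<rho> \<Longrightarrow> f y = 0"
proof -
  have "bounded (closure {x. f x \<noteq> 0})"
    using assms unfolding compactly_supported_def by (rule compact_imp_bounded)
  then obtain \<rho> where "\<And>x. x \<in> closure {x. f x \<noteq> 0} \<Longrightarrow> norm x \<le> \<rho>" unfolding bounded_iff by blast
  then have "f y = 0" if "norm y > \<rho>" for y using closure_subset that by force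
  then show ?thesis using that by blast
qed

lemma multi_size_eq_0_iff: "multi_size \<beta> = 0 \<longleftrightarrow> \<beta> = (\<lambda>_. 0)"
  by (auto simp: multi_size_def fun_eq_iff)

lemma multi_deriv_zero:
  fixes u :: "(real, 'n::{finite,linorder}) vec \<Rightarrow> real"
  shows "multi_deriv (\<lambda>_. 0) u x = u x"
proof -
  have L: "concat (map (\<lambda>i. []) L) = ([] :: 'n list)" for L :: "'n list" by (induction L) auto
  show ?thesis by (simp add: multi_deriv_foldr multi_list_def L)
qed

text \<open>With \<open>P\<close> the polynomial and \<open>R = u - u 0 - P\<close>, the numerator
  equals \<open>- (R + (1 - w) P)\<close>. The product has order 3 plus order 1, which matches the
  order 4 of \<open>R\<close>.\<close>

lemma symbol_on_numerator:
  fixes u :: "real ^ 'n::{finite,linorder} \<Rightarrow> real"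
  assumes u: "C_k 4 u" "compactly_supported u"
    and w: "C_k 3 w" "compactly_supported w" "\<And>z. w z \<le> 1" "(\<lambda>z. 1 - w z) \<in> O[at 0](\<lambda>z. \<bar>z\<bar> ^ 3)"
  shows "\<exists>C. symbol_on (- {0}) (\<lambda>y. C * min (norm y ^ 4) 1) (\<lambda>y. u 0 - u y +
              w (norm y) * (\<Sum>\<beta> | 1 \<le> multi_size \<beta> \<and> multi_size \<beta> \<le> 3.
                   multi_deriv \<beta> u 0 / multi_fact \<beta> * multi_power y \<beta>))"
    (is "\<exists>C. symbol_on _ _ (\<lambda>y. ?F y)")
proof -
  let ?I = "{\<beta> :: 'n \<Rightarrow> nat. 1 \<le> multi_size \<beta> \<and> multi_size \<beta> \<le> 3}"
  let ?c = "\<lambda>\<beta>. multi_deriv \<beta> u 0 / multi_fact \<beta>"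
  define P where "P y = (\<Sum>\<beta>\<in>?I. ?c \<beta> * multi_power y \<beta>)" for y
  define R where "R y = u y - (\<Sum>\<beta> | multi_size \<beta> < Suc (Suc 2). ?c \<beta> * multi_power y \<beta>)" for y
  have I: "finite ?I" by (rule finite_subset[OF _ finite_multi_size[of 4]]) auto
  obtain \<rho>1 where \<rho>1: "\<And>y. norm y > \<rho>1 \<Longrightarrow> u y = 0" using compactly_supported_bound[OF u(2)] by blast
  obtain \<rho>2 where \<rho>2: "\<And>y. norm y > \<rho>2 \<Longrightarrow> w y = 0" using compactly_supported_bound[OF w(2)] by blast
  \<comment> \<open>The margin 1 leaves every point with \<open>\<rho> \<le> norm y\<close> an open
    neighbourhood on which both \<open>u\<close> and the cutoff vanish; it also gives
    \<open>\<rho> \<ge> 1\<close>.\<close>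
  define \<rho> where "\<rho> = 1 + \<bar>\<rho>1\<bar> + \<bar>\<rho>2\<bar>"
  have \<rho>: "\<rho> \<ge> 1" by (simp add: \<rho>_def)
  let ?S = "cball 0 \<rho> - {0 :: (real, 'n) vec}"
  have R_eq: "R y = u y - u 0 - P y" for y
  proof -
    have "{\<beta>. multi_size \<beta> < Suc (Suc 2)} = insert (\<lambda>_. 0) ?I"
      by (auto simp: multi_size_eq_0_iff[symmetric]) (simp_all add: multi_size_eq_0_iff multi_size_def)
    moreover have "(\<lambda>_. 0) \<notin> ?I" by (simp add: multi_size_def)
    ultimately have "(\<Sum>\<beta> | multi_size \<beta> < Suc (Suc 2). ?c \<beta> * multi_power y \<beta>)
        = ?c (\<lambda>_. 0) * multi_power y (\<lambda>_. 0) + P y"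
      using I by (simp add: P_def)
    then show ?thesis by (simp add: R_def multi_deriv_zero multi_fact_def multi_power_def)
  qed
  have u4: "C_k (Suc (Suc 2)) u" using u(1) by (simp add: numeral_eq_Suc)
  have "C_k (Suc (Suc 2)) (\<lambda>y. 1 * u y + (-1) * (\<Sum>\<beta> | multi_size \<beta> < Suc (Suc 2). ?c \<beta> * multi_power y \<beta>))"
    by (intro C_k_lin C_k_sum u4 C_k_multi_power)
  then have RC: "C_k (Suc (Suc 2)) R" unfolding R_def by simp
  have van: "foldr partial_deriv l R 0 = 0" if "set l \<subseteq> Basis" "length l < Suc (Suc 2)" for l
    unfolding R_def using u4 that by (rule foldr_partial_deriv_Taylor_remainder)
  obtain C1 where "symbol_on (cball 0 \<rho>) (\<lambda>y. C1 * norm y ^ Suc (Suc 2)) R"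
    using symbol_on_Taylor_remainder[OF RC van] by blast
  then have 1: "symbol_on ?S (\<lambda>y. C1 * norm y ^ 4) R"
    by (rule symbol_on_mono) (auto simp: numeral_eq_Suc)
  obtain C2 where 2: "symbol_on ?S (\<lambda>y. C2 * norm y ^ 3) (\<lambda>y. 1 - w (norm y))"
    using symbol_on_cutoff[OF w(1,3,4)] by blast
  obtain C3 where "symbol_on (cball 0 \<rho>) (\<lambda>y. C3 * norm y) P"
    unfolding P_def using symbol_on_Taylor_polynomial[OF \<rho> I, of ?c] by auto
  then have 3: "symbol_on ?S (\<lambda>y. C3 * norm y ^ 1) P"
    by (rule symbol_on_mono) auto
  have 4: "symbol_on ?S (\<lambda>y. (4 * C2 * C3) * norm y ^ 4) (\<lambda>y. (1 - w (norm y)) * P y)"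
    using symbol_on_norm_power_mult[OF 2 3] by simp
  have 5: "symbol_on ?S (\<lambda>y. C1 * norm y ^ 4 + (4 * C2 * C3) * norm y ^ 4) (\<lambda>y. R y + (1 - w (norm y)) * P y)"
    by (rule symbol_on_add[OF 1 4])
  \<comment> \<open>The outer 4 comes from multiplying by the constant \<open>-1\<close> through
    \<open>symbol_on_mult\<close>, \<open>\<rho> ^ 4\<close> from trading \<open>norm y ^ 4\<close>
    for its minimum with 1 on the ball, and \<open>\<bar>u 0\<bar>\<close> serves the far
    region.\<close>
  define C where "C = (4 * (\<bar>C1\<bar> + 4 * \<bar>C2\<bar> * \<bar>C3\<bar>)) * \<rho> ^ 4 + \<bar>u 0\<bar>"
  have F1: "?F y = -1 * (R y + (1 - w (norm y)) * P y)" for y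
    by (simp add: R_eq P_def algebra_simps)
  have "symbol_on ?S (\<lambda>y. 4 * (\<bar>-1\<bar> * (C1 * norm y ^ 4 + (4 * C2 * C3) * norm y ^ 4))) ?F"
    unfolding F1 using symbol_on_mult[OF symbol_on_const 5] .
  then have near: "symbol_on ?S (\<lambda>y. C * min (norm y ^ 4) 1) ?F"
  proof (rule symbol_on_mono)
    fix y :: "(real, 'n) vec" assume "y \<in> ?S"
    then have "norm y \<le> \<rho>" by simp
    then have "norm y ^ 4 \<le> \<rho> ^ 4" by (intro power_mono) auto
    moreover have "1 \<le> \<rho> ^ 4" using \<rho> by simp
    then have "norm y ^ 4 \<le> \<rho> ^ 4 * norm y ^ 4" using mult_right_mono[of 1 "\<rho> ^ 4" "norm y ^ 4"] by simp
    ultimately have *: "norm y ^ 4 \<le> \<rho> ^ 4 * min (norm y ^ 4) 1" by (auto simp: min_def)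
    have "C1 * norm y ^ 4 + (4 * C2 * C3) * norm y ^ 4 \<le> \<bar>C1\<bar> * norm y ^ 4 + (4 * \<bar>C2\<bar> * \<bar>C3\<bar>) * norm y ^ 4"
      by (intro add_mono mult_right_mono) (auto simp: abs_mult[symmetric])
    also have "\<dots> = (\<bar>C1\<bar> + 4 * \<bar>C2\<bar> * \<bar>C3\<bar>) * norm y ^ 4" by (simp add: algebra_simps)
    also have "\<dots> \<le> (\<bar>C1\<bar> + 4 * \<bar>C2\<bar> * \<bar>C3\<bar>) * (\<rho> ^ 4 * min (norm y ^ 4) 1)"
      using * by (intro mult_left_mono) auto
    finally have "4 * (\<bar>-1\<bar> * (C1 * norm y ^ 4 + (4 * C2 * C3) * norm y ^ 4)) \<le>
        4 * ((\<bar>C1\<bar> + 4 * \<bar>C2\<bar> * \<bar>C3\<bar>) * (\<rho> ^ 4 * min (norm y ^ 4) 1))" by simp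
    also have "\<dots> \<le> C * min (norm y ^ 4) 1"
      unfolding C_def by (simp add: algebra_simps)
    finally show "4 * (\<bar>-1\<bar> * (C1 * norm y ^ 4 + (4 * C2 * C3) * norm y ^ 4)) \<le> C * min (norm y ^ 4) 1" .
  qed auto
  let ?T = "{y :: (real, 'n) vec. \<rho> \<le> norm y}"
  have far: "symbol_on ?T (\<lambda>y. C * min (norm y ^ 4) 1) ?F"
  proof (rule symbol_on_cong)
    show "symbol_on ?T (\<lambda>y. C * min (norm y ^ 4) 1) (\<lambda>_. u 0)"
    proof (rule symbol_on_mono[OF symbol_on_const])
      fix y :: "(real, 'n) vec" assume "y \<in> ?T"
      then have "norm y \<ge> 1" using \<rho> by simp
      then have "norm y ^ 4 \<ge> 1" by simp
      moreover have "\<bar>u 0\<bar> \<le> C" using \<rho> unfolding C_def by simp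
      ultimately show "\<bar>u 0\<bar> \<le> C * min (norm y ^ 4) 1" by (simp add: min_def)
    qed auto
    fix y :: "(real, 'n) vec" assume "y \<in> ?T"
    then have "y \<in> - cball 0 (\<bar>\<rho>1\<bar> + \<bar>\<rho>2\<bar>)" by (simp add: \<rho>_def)
    moreover have "open (- cball 0 (\<bar>\<rho>1\<bar> + \<bar>\<rho>2\<bar>) :: (real, 'n) vec set)" by auto
    ultimately have "\<forall>\<^sub>F z in nhds y. z \<in> - cball 0 (\<bar>\<rho>1\<bar> + \<bar>\<rho>2\<bar>)" by (intro eventually_nhds_in_open)
    then show "\<forall>\<^sub>F z in nhds y. u 0 = ?F z"
    proof eventually_elim
      case (elim z)
      then have "\<rho>1 < norm z" "\<rho>2 < norm (norm z)" by auto
      then show ?case using \<rho>1[of z] \<rho>2[of "norm z"] by simp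
    qed
  qed
  have "symbol_on (- {0}) (\<lambda>y. C * min (norm y ^ 4) 1) ?F"
    using symbol_on_union[OF near far] by (rule symbol_on_mono) auto
  then show ?thesis by blast
qed

lemma symbol_on_quotient:
  fixes F :: "'a::real_inner \<Rightarrow> real"
  assumes "symbol_on (- {0}) (\<lambda>y. C * min (norm y ^ 4) 1) F" "p \<ge> 0"
  shows "\<exists>C. symbol_on (- {0}) (\<lambda>y. C * radial_weight p (norm y)) (\<lambda>y. F y / norm y powr p)"
proof -
  have "symbol_on (- {0}) (\<lambda>y. 4 * ((C * min (norm y ^ 4) 1) * (2 * ((1 + p)\<^sup>2 * norm y powr (- p)))))
     (\<lambda>y. F y * norm y powr (- p))"
    by (rule symbol_on_mult[OF assms(1) symbol_on_norm_powr]) (use assms(2) in auto)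
  then have "symbol_on (- {0}) (\<lambda>y. (8 * C * (1 + p)\<^sup>2) * radial_weight p (norm y)) (\<lambda>y. F y * norm y powr (- p))"
    by (rule symbol_on_mono) (auto simp: radial_weight_def)
  then show ?thesis by (auto simp: powr_minus divide_inverse)
qed

subsection \<open>The radial weight\<close>

lemma radial_weight_nonneg [simp]: "radial_weight p r \<ge> 0"
  by (simp add: radial_weight_def min_def)

lemma radial_weight_measurable [measurable]: "radial_weight p \<in> borel_measurable borel"
  unfolding radial_weight_def by measurable

text \<open>Cancels the factor \<open>(norm y)\<^sup>2\<close> in the second-derivative bound of
  \<open>symbol_on\<close>, which turns the weight of the integrand into \<open>g\<close>.\<close>

lemma radial_weight_shift:
  assumes "r > 0"
  shows "radial_weight p r = r\<^sup>2 * radial_weight (p + 2) r"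
proof -
  have "r powr (- p) = r\<^sup>2 * r powr (- (p + 2))"
    using assms powr_add[of r 2 "- (p + 2)"] by simp
  then show ?thesis by (simp add: radial_weight_def)
qed

text \<open>The common factor 16 leaves room for the ratios 8 and 2 of
  \<open>lattice_cell_geometry\<close>. It enters to the fourth power through
  \<open>min (r ^ 4) 1\<close> and to the power \<open>p\<close> through the other factor.\<close>

lemma radial_weight_comparable:
  assumes "r > 0" "r \<le> 16 * r'" "r' \<le> 16 * r" "p \<ge> 0"
  shows "radial_weight p r' \<le> (16 ^ 4 * 16 powr p) * radial_weight p r"
proof -
  have r': "r' > 0" using assms by simp
  have "r' ^ 4 \<le> (16 * r) ^ 4" using assms r' by (intro power_mono) auto
  then have m: "min (r' ^ 4) 1 \<le> 16 ^ 4 * min (r ^ 4) 1" by (auto simp: min_def power_mult_distrib)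
  have "r' powr (- p) \<le> (r / 16) powr (- p)"
    using assms r' powr_mono2'[of "- p" "r / 16" r'] by auto
  moreover have "(r / 16) powr (- p) = r powr (- p) / 16 powr (- p)"
    by (rule powr_divide)
  moreover have "r powr (- p) / 16 powr (- p) = 16 powr p * r powr (- p)"
    by (simp only: powr_minus[of 16 p] divide_inverse inverse_inverse_eq mult.commute)
  ultimately have "r' powr (- p) \<le> 16 powr p * r powr (- p)" by simp
  with m have "min (r' ^ 4) 1 * r' powr (- p) \<le> (16 ^ 4 * min (r ^ 4) 1) * (16 powr p * r powr (- p))"
    by (intro mult_mono) (auto simp: min_def)
  then show ?thesis by (simp add: radial_weight_def mult_ac)
qed

lemma powr_geometric_summable:
  assumes "q > 0"
  shows "summable (\<lambda>k. 2 powr (c - q * real k))"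
proof -
  have "2 powr (c - q * real k) = 2 powr c * (2 powr (- q)) ^ k" for k
    by (simp add: powr_power powr_add[symmetric] algebra_simps)
  moreover have "norm (2 powr (- q)) < (1::real)" using assms by (simp add: powr_less_one)
  ultimately show ?thesis by (simp add: summable_mult summable_geometric)
qed

text \<open>Splitting by \<open>2 ^ j \<le> r < 2 ^ (j + 1)\<close>: for negative \<open>j\<close>
  the factor \<open>min (r ^ 4) 1\<close> is bounded by \<open>r ^ 4\<close>, otherwise by
  1.\<close>

lemma radial_weight_dyadic:
  assumes r: "r > 0" and p: "p \<ge> 0"
  obtains k :: nat where "r < 2 powr (- real k)" "radial_weight p r \<le> 2 powr (p * (real k + 1) - 4 * real k)"
  | k :: nat where "r < 2 powr (real k + 1)" "radial_weight p r \<le> 2 powr (- p * real k)"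
proof -
  define s where "s = log 2 r"
  define j where "j = \<lfloor>s\<rfloor>"
  have rs: "r = 2 powr s" using r by (simp add: s_def)
  have j: "of_int j \<le> s" "s < of_int j + 1" unfolding j_def by linarith+
  have r4: "r ^ 4 = 2 powr (4 * s)" unfolding rs by (simp add: powr_power)
  have rp: "r powr (- p) = 2 powr (- p * s)" unfolding rs by (simp add: powr_powr mult.commute)
  have rp_le: "r powr (- p) \<le> 2 powr (- p * of_int j)"
    unfolding rp using j p by (intro powr_mono) (auto intro!: mult_left_mono)
  show ?thesis
  proof (cases "j < 0")
    case True
    \<comment> \<open>The shift by one makes \<open>2 powr (- real k)\<close> the outer radius of
      the shell and lets \<open>k\<close> start at 0.\<close>
    define k where "k = nat (- j - 1)"
    have k: "real_of_int j = - real k - 1" using True by (simp add: k_def)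
    show ?thesis
    proof (rule that(1)[of k])
      show "r < 2 powr (- real k)" unfolding rs using j k by simp
      have "radial_weight p r \<le> r ^ 4 * r powr (- p)"
        unfolding radial_weight_def by (intro mult_right_mono) auto
      also have "\<dots> \<le> 2 powr (- 4 * real k) * 2 powr (- p * of_int j)"
        unfolding r4 using j k rp_le by (intro mult_mono) auto
      also have "\<dots> = 2 powr (p * (real k + 1) - 4 * real k)"
        unfolding k powr_add[symmetric] by (simp add: algebra_simps)
      finally show "radial_weight p r \<le> 2 powr (p * (real k + 1) - 4 * real k)" .
    qed
  next
    case False
    define k where "k = nat j"
    have k: "real_of_int j = real k" using False by (simp add: k_def)
    show ?thesis
    proof (rule that(2)[of k])
      show "r < 2 powr (real k + 1)" unfolding rs using j k by simp
      have "radial_weight p r \<le> 1 * r powr (- p)"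
        unfolding radial_weight_def by (intro mult_right_mono) auto
      then show "radial_weight p r \<le> 2 powr (- p * real k)" using rp_le k by simp
    qed
  qed
qed

text \<open>Dyadic shells are enlarged to balls, whose volumes are explicit. The small balls give a
  geometric series with ratio \<open>2 powr (- (4 - q))\<close>, the large ones with ratio
  \<open>2 powr (- q)\<close>, whence the range of \<open>q\<close>.\<close>

lemma integrable_radial_weight:
  assumes q: "0 < q" "q < 4"
  shows "integrable lborel (\<lambda>y :: 'a::euclidean_space. radial_weight (real DIM('a) + q) (norm y))"
proof (rule integrableI_bounded)
  let ?d = "real DIM('a)"
  define p where "p = ?d + q"
  define V where "V = unit_ball_vol ?d"
  define A where "A k = 2 powr (p * (real k + 1) - 4 * real k)" for k :: nat
  define B where "B k = 2 powr (- p * real k)" for k :: nat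
  define \<alpha> where "\<alpha> k = (2::real) powr (- real k)" for k :: nat
  define \<beta> where "\<beta> k = (2::real) powr (real k + 1)" for k :: nat
  define g where "g k y = ennreal (A k) * indicator (ball 0 (\<alpha> k)) y + ennreal (B k) * indicator (ball 0 (\<beta> k)) y"
    for k and y :: 'a
  have p: "p \<ge> 0" using q by (simp add: p_def)
  have V: "V \<ge> 0" by (simp add: V_def)
  have [measurable]: "ball (0::'a) r \<in> sets borel" for r by simp
  have [measurable]: "g k \<in> borel_measurable lborel" for k unfolding g_def by measurable
  show "(\<lambda>y :: 'a. radial_weight (real DIM('a) + q) (norm y)) \<in> borel_measurable lborel" by measurable
  have pw: "ennreal (radial_weight p (norm y)) \<le> (\<Sum>k. g k y)" for y :: 'a
  proof (cases "y = 0")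
    case True
    then show ?thesis by (simp add: radial_weight_def)
  next
    case False
    then have "norm y > 0" by simp
    have gk: "g k y \<le> (\<Sum>k. g k y)" for k
      using sum_le_suminf[OF summableI, of "{k}" "\<lambda>k. g k y"] by simp
    from \<open>norm y > 0\<close> p show ?thesis
    proof (cases rule: radial_weight_dyadic)
      case (1 k)
      then have "ennreal (radial_weight p (norm y)) \<le> g k y"
        by (auto simp: g_def A_def \<alpha>_def intro!: add_increasing2 ennreal_leI)
      then show ?thesis using gk order_trans by blast
    next
      case (2 k)
      then have "ennreal (radial_weight p (norm y)) \<le> g k y"
        by (auto simp: g_def B_def \<beta>_def intro!: add_increasing ennreal_leI)
      then show ?thesis using gk order_trans by blast
    qed
  qed
  have Ag: "A k * (V * \<alpha> k ^ DIM('a)) = V * 2 powr (p - (4 - q) * real k)" for k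
  proof -
    have "\<alpha> k ^ DIM('a) = 2 powr (- real k * ?d)"
      unfolding \<alpha>_def by (simp add: powr_power mult.commute)
    then have "A k * \<alpha> k ^ DIM('a) = 2 powr (p * (real k + 1) - 4 * real k + (- real k * ?d))"
      unfolding A_def powr_add by simp
    also have "p * (real k + 1) - 4 * real k + (- real k * ?d) = p - (4 - q) * real k"
      by (simp add: p_def algebra_simps)
    finally show ?thesis by (simp add: mult_ac)
  qed
  have Bg: "B k * (V * \<beta> k ^ DIM('a)) = V * 2 powr (?d - q * real k)" for k
  proof -
    have "\<beta> k ^ DIM('a) = 2 powr ((real k + 1) * ?d)"
      unfolding \<beta>_def by (simp add: powr_power mult.commute)
    then have "B k * \<beta> k ^ DIM('a) = 2 powr (- p * real k + (real k + 1) * ?d)"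
      unfolding B_def powr_add by simp
    also have "- p * real k + (real k + 1) * ?d = ?d - q * real k"
      by (simp add: p_def algebra_simps)
    finally show ?thesis by (simp add: mult_ac)
  qed
  define S where "S k = V * 2 powr (p - (4 - q) * real k) + V * 2 powr (?d - q * real k)" for k :: nat
  have S_nonneg: "0 \<le> S k" for k using V by (simp add: S_def)
  have S: "summable S" unfolding S_def
    using q by (intro summable_add summable_mult powr_geometric_summable) auto
  have "(\<integral>\<^sup>+y. g k y \<partial>lborel) = ennreal (S k)" for k
  proof -
    have "(\<integral>\<^sup>+y. g k y \<partial>lborel) = ennreal (A k) * emeasure lborel (ball (0::'a) (\<alpha> k)) + ennreal (B k) * emeasure lborel (ball (0::'a) (\<beta> k))"
      unfolding g_def by (subst nn_integral_add) (auto simp: nn_integral_cmult)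
    also have "\<dots> = ennreal (A k * (V * \<alpha> k ^ DIM('a))) + ennreal (B k * (V * \<beta> k ^ DIM('a)))"
      using V by (simp add: emeasure_ball \<alpha>_def \<beta>_def V_def A_def B_def ennreal_mult')
    also have "\<dots> = ennreal (S k)" unfolding Ag Bg S_def using V by (simp add: ennreal_plus)
    finally show ?thesis .
  qed
  then have "(\<integral>\<^sup>+y. (\<Sum>k. g k y) \<partial>lborel) = (\<Sum>k. ennreal (S k))"
    by (subst nn_integral_suminf) auto
  also have "\<dots> = ennreal (\<Sum>k. S k)"
    by (rule suminf_ennreal2[OF S_nonneg S])
  finally have "(\<integral>\<^sup>+y. (\<Sum>k. g k y) \<partial>lborel) < \<infinity>" by simp
  moreover have "(\<integral>\<^sup>+y. ennreal (norm (radial_weight p (norm y))) \<partial>(lborel :: 'a measure)) \<le> (\<integral>\<^sup>+y. (\<Sum>k. g k y) \<partial>lborel)"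
    by (intro nn_integral_mono) (simp add: pw)
  ultimately show "(\<integral>\<^sup>+y. ennreal (norm (radial_weight (real DIM('a) + q) (norm y))) \<partial>(lborel :: 'a measure)) < \<infinity>"
    unfolding p_def by (rule le_less_trans[rotated])
qed

section \<open>Second differences along a line\<close>

lemma second_difference_bound:
  fixes f :: "'a::real_normed_vector \<Rightarrow> real"
  assumes jet: "\<And>t. \<bar>t\<bar> \<le> 1 \<Longrightarrow> \<exists>a b. line_jet f (c + t *\<^sub>R v) v a b \<and> \<bar>b\<bar> \<le> M"
  shows "\<bar>f (c + v) + f (c - v) - 2 * f c\<bar> \<le> 2 * M"
proof -
  define \<phi> where "\<phi> t = f (c + t *\<^sub>R v)" for t
  \<comment> \<open>Each jet brings its own local derivative function. Near \<open>t\<close> it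
    coincides with \<open>deriv \<phi>\<close>, which glues them into a single function for the mean
    value theorem.\<close>
  have D: "(\<phi> has_real_derivative deriv \<phi> t) (at t) \<and> (\<exists>b. (deriv \<phi> has_real_derivative b) (at t) \<and> \<bar>b\<bar> \<le> M)"
    if t: "\<bar>t\<bar> \<le> 1" for t
  proof -
    obtain a b where "line_jet f (c + t *\<^sub>R v) v a b" and b: "\<bar>b\<bar> \<le> M" using jet[OF t] by blast
    then obtain g where g: "\<forall>\<^sub>F s in nhds 0. ((\<lambda>s. f (c + t *\<^sub>R v + s *\<^sub>R v)) has_real_derivative g s) (at s)"
      "g 0 = a" "(g has_real_derivative b) (at 0)" unfolding line_jet_def by blast
    have shift: "(\<lambda>s. f (c + t *\<^sub>R v + s *\<^sub>R v)) = (\<lambda>s. \<phi> (s + t))"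
      by (simp add: \<phi>_def scaleR_add_left add_ac)
    have ev: "\<forall>\<^sub>F s in nhds 0. (\<phi> has_real_derivative g s) (at (s + t))"
      using g(1) unfolding shift by eventually_elim (simp add: DERIV_shift)
    then have "\<forall>\<^sub>F s in nhds 0. deriv \<phi> (s + t) = g s"
      by eventually_elim (rule DERIV_imp_deriv)
    then have "((\<lambda>s. deriv \<phi> (s + t)) has_real_derivative b) (at 0)"
      using g(3) by (subst DERIV_cong_ev[OF refl _ refl]) auto
    then have "(deriv \<phi> has_real_derivative b) (at t)" using DERIV_shift[of "deriv \<phi>" b 0 t] by simp
    moreover have "(\<phi> has_real_derivative g 0) (at t)" using eventually_nhds_x_imp_x[OF ev] by simp
    ultimately show ?thesis using b DERIV_imp_deriv by metis
  qed
  \<comment> \<open>Evenness removes the linear term: a mean value step for \<open>\<psi>\<close> on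
    \<open>[0, 1]\<close> and one for \<open>deriv \<phi>\<close> on \<open>[- \<xi>, \<xi>]\<close>
    reach a single value of the second derivative.\<close>
  define \<psi> where "\<psi> t = \<phi> t + \<phi> (- t)" for t
  have D\<psi>: "(\<psi> has_real_derivative (deriv \<phi> t - deriv \<phi> (- t))) (at t)" if "\<bar>t\<bar> \<le> 1" for t
  proof -
    have "(\<phi> has_real_derivative deriv \<phi> t) (at t)" using D[of t] that by simp
    moreover have "((\<lambda>t. \<phi> (- t)) has_real_derivative deriv \<phi> (- t) * (- 1)) (at t)"
      by (rule DERIV_chain2[where f = \<phi>]) (use D[of "- t"] that in \<open>auto intro!: derivative_eq_intros\<close>)
    ultimately have "((\<lambda>t. \<phi> t + \<phi> (- t)) has_real_derivative deriv \<phi> t + deriv \<phi> (- t) * (- 1)) (at t)"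
      by (rule DERIV_add)
    then show ?thesis unfolding \<psi>_def by simp
  qed
  obtain \<xi> where \<xi>: "0 < \<xi>" "\<xi> < 1" "\<psi> 1 - \<psi> 0 = (1 - 0) * (deriv \<phi> \<xi> - deriv \<phi> (- \<xi>))"
    using MVT2[of 0 1 \<psi> "\<lambda>t. deriv \<phi> t - deriv \<phi> (- t)"] D\<psi> by auto
  obtain b where b: "\<And>t. \<bar>t\<bar> \<le> 1 \<Longrightarrow> (deriv \<phi> has_real_derivative b t) (at t) \<and> \<bar>b t\<bar> \<le> M"
    using D by metis
  obtain \<eta> where \<eta>: "- \<xi> < \<eta>" "\<eta> < \<xi>" "deriv \<phi> \<xi> - deriv \<phi> (- \<xi>) = (\<xi> - - \<xi>) * b \<eta>"
    using MVT2[of "- \<xi>" \<xi> "deriv \<phi>" b] b \<xi> by auto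
  have "\<bar>b \<eta>\<bar> \<le> M" using b[of \<eta>] \<eta> \<xi> by simp
  then have "(2 * \<xi>) * \<bar>b \<eta>\<bar> \<le> 2 * M" using \<xi> by (intro mult_mono) auto
  moreover have "\<bar>\<psi> 1 - \<psi> 0\<bar> = (2 * \<xi>) * \<bar>b \<eta>\<bar>" using \<xi> \<eta>(3) by (simp add: abs_mult)
  ultimately have "\<bar>\<psi> 1 - \<psi> 0\<bar> \<le> 2 * M" by simp
  then show ?thesis by (simp add: \<psi>_def \<phi>_def algebra_simps)
qed

subsection \<open>Midpoint quadrature on the lattice\<close>

definition lattice_cell :: "real \<Rightarrow> int ^ 'n \<Rightarrow> (real ^ 'n::finite) set" where
  "lattice_cell h j = {y. \<forall>i. h * (of_int (j $ i) - 1 / 2) \<le> y $ i \<and> y $ i < h * (of_int (j $ i) + 1 / 2)}"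

text \<open>Rounding each \<open>y $ i / h\<close> recovers \<open>j\<close>; with half-open cells
  the rounding is a floor, so covering and disjointness follow at once.\<close>

lemma lattice_cell_iff_floor:
  assumes "h > 0"
  shows "y \<in> lattice_cell h j \<longleftrightarrow> (\<forall>i. \<lfloor>y $ i / h + 1 / 2\<rfloor> = j $ i)"
proof -
  have "(h * (of_int (j $ i) - 1 / 2) \<le> y $ i \<and> y $ i < h * (of_int (j $ i) + 1 / 2))
     = (\<lfloor>y $ i / h + 1 / 2\<rfloor> = j $ i)" for i
  proof -
    have "(h * (of_int (j $ i) - 1 / 2) \<le> y $ i) = (of_int (j $ i) \<le> y $ i / h + 1 / 2)"
      using pos_le_divide_eq[OF assms, of "of_int (j $ i) - 1 / 2" "y $ i"] by (auto simp: mult.commute)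
    moreover have "(y $ i < h * (of_int (j $ i) + 1 / 2)) = (y $ i / h + 1 / 2 < of_int (j $ i) + 1)"
      using pos_divide_less_eq[OF assms, of "y $ i" "of_int (j $ i) + 1 / 2"] by (auto simp: mult.commute)
    ultimately show ?thesis by (simp add: floor_eq_iff)
  qed
  then show ?thesis unfolding lattice_cell_def by blast
qed

lemma lattice_cell_UN:
  assumes "h > 0"
  shows "(\<Union>j. lattice_cell h j) = (UNIV :: (real ^ 'n::finite) set)"
proof -
  have "y \<in> lattice_cell h (\<chi> i. \<lfloor>y $ i / h + 1 / 2\<rfloor>)" for y :: "real ^ 'n"
    by (simp add: lattice_cell_iff_floor[OF assms])
  then show ?thesis by blast
qed

lemma lattice_cell_disjoint:
  assumes "h > 0" "j \<noteq> k"
  shows "lattice_cell h j \<inter> lattice_cell h k = {}"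
  using assms(2) by (auto simp: lattice_cell_iff_floor[OF assms(1)] vec_eq_iff)

lemma lattice_cell_sets [measurable, simp]: "lattice_cell h j \<in> sets borel"
proof -
  have "lattice_cell h j = (\<Inter>i. {y. h * (of_int (j $ i) - 1 / 2) \<le> y $ i} \<inter> {y. y $ i < h * (of_int (j $ i) + 1 / 2)})"
    unfolding lattice_cell_def by auto
  moreover have "{y :: real ^ 'a. a \<le> y $ i} \<in> sets borel" for a i
    using closed_halfspace_component_ge_cart[of a i] by (simp add: borel_closed)
  moreover have "{y :: real ^ 'a. y $ i < a} \<in> sets borel" for a i
    using open_halfspace_component_lt_cart[of i a] by (simp add: borel_open)
  ultimately show ?thesis by (auto intro!: sets.countable_INT'')
qed

text \<open>Countable additivity speaks of sequences, so the lattice is enumerated; summability of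
  the norms then upgrades the series to an unordered sum.\<close>

lemma integral_lattice_cells_has_sum:
  fixes f :: "real ^ 'n::finite \<Rightarrow> real"
  assumes h: "h > 0" and f: "integrable lborel f"
  shows "((\<lambda>j. LINT y:lattice_cell h j|lborel. f y) has_sum (\<integral>y. f y \<partial>lborel)) UNIV"
proof -
  let ?g = "from_nat_into (UNIV :: (int ^ 'n) set)"
  have inf: "infinite (UNIV :: (int ^ 'n) set)"
  proof
    assume "finite (UNIV :: (int ^ 'n) set)"
    then have "finite (range (\<lambda>k. \<chi> i. k) :: (int ^ 'n) set)" by (rule finite_subset[rotated]) auto
    moreover have "inj (\<lambda>k. (\<chi> i. k) :: int ^ 'n)" by (auto simp: inj_def vec_eq_iff)
    ultimately show False using finite_imageD infinite_UNIV_int by blast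
  qed
  have bij: "bij_betw ?g UNIV UNIV" using inf by (intro bij_betw_from_nat_into) auto
  have UN: "(\<Union>n. lattice_cell h (?g n)) = (UNIV :: (real ^ 'n) set)"
    using lattice_cell_UN[OF h] bij by (metis bij_betw_imp_surj_on image_image)
  have disj: "lattice_cell h (?g m) \<inter> lattice_cell h (?g n) = {}" if "m \<noteq> n" for m n
    using that bij by (intro lattice_cell_disjoint[OF h]) (auto simp: bij_betw_def inj_on_def)
  have int: "set_integrable lborel (lattice_cell h j) f" for j
    unfolding set_integrable_def using f by (intro integrable_mult_indicator) auto
  have nint: "set_integrable lborel (lattice_cell h j) (\<lambda>y. norm (f y))" for j
    unfolding set_integrable_def using f by (intro integrable_mult_indicator integrable_norm) auto
  have norm_le: "norm (LINT y:lattice_cell h j|lborel. f y) \<le> (LINT y:lattice_cell h j|lborel. norm (f y))" for j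
    using int by (rule set_integral_norm_bound)
  have "summable (\<lambda>n. LINT y:lattice_cell h (?g n)|lborel. norm (f y))"
  proof (rule summableI_nonneg_bounded)
    fix n
    show "0 \<le> (LINT y:lattice_cell h (?g n)|lborel. norm (f y))"
      using norm_le norm_ge_zero order_trans by blast
    have "(\<Sum>i<n. LINT y:lattice_cell h (?g i)|lborel. norm (f y))
        = (LINT y:(\<Union>i<n. lattice_cell h (?g i))|lborel. norm (f y))"
      using nint disj by (subst set_integral_finite_Union) (auto simp: disjoint_family_on_def)
    also have "\<dots> \<le> (\<integral>y. norm (f y) \<partial>lborel)"
      unfolding set_lebesgue_integral_def
    proof (rule integral_mono)
      have "(\<Union>i<n. lattice_cell h (?g i)) \<in> sets borel" by (intro sets.finite_UN) auto
      then show "integrable lborel (\<lambda>y. indicat_real (\<Union>i<n. lattice_cell h (?g i)) y *\<^sub>R norm (f y))"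
        using f by (intro integrable_mult_indicator integrable_norm) auto
      show "integrable lborel (\<lambda>y. norm (f y))" using f by (rule integrable_norm)
    qed (auto simp: indicator_def)
    finally show "(\<Sum>i<n. LINT y:lattice_cell h (?g i)|lborel. norm (f y)) \<le> (\<integral>y. norm (f y) \<partial>lborel)" .
  qed
  then have sn: "summable (\<lambda>n. norm (LINT y:lattice_cell h (?g n)|lborel. f y))"
    by (rule summable_comparison_test'[where N = 0]) (use norm_le in auto)
  have "(LINT y:(\<Union>n. lattice_cell h (?g n))|lborel. f y) = (\<Sum>n. LINT y:lattice_cell h (?g n)|lborel. f y)"
    by (rule lebesgue_integral_countable_add)
      (use disj UN f in \<open>auto simp: set_integrable_def\<close>)
  then have "(\<Sum>n. LINT y:lattice_cell h (?g n)|lborel. f y) = (\<integral>y. f y \<partial>lborel)"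
    unfolding UN by (simp add: set_lebesgue_integral_def)
  then have "(\<lambda>n. LINT y:lattice_cell h (?g n)|lborel. f y) sums (\<integral>y. f y \<partial>lborel)"
    using summable_norm_cancel[OF sn] summable_sums by fastforce
  from norm_summable_imp_has_sum[OF sn this] show ?thesis
    using has_sum_reindex_bij_betw[OF bij, of "\<lambda>j. LINT y:lattice_cell h j|lborel. f y"] by blast
qed

text \<open>The half-open cells partition the space; the open boxes differ from them by null sets and
  are invariant under reflection in the lattice point.\<close>

definition lattice_box :: "real \<Rightarrow> int ^ 'n \<Rightarrow> (real ^ 'n::finite) set" where
  "lattice_box h j = box (grid_point h j - (\<chi> i. h / 2)) (grid_point h j + (\<chi> i. h / 2))"

lemma lattice_box_iff: "y \<in> lattice_box h j \<longleftrightarrow> (\<forall>i. \<bar>y $ i - grid_point h j $ i\<bar> < h / 2)"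
proof -
  have "(c - h / 2 < z \<and> z < c + h / 2) = (\<bar>z - c\<bar> < h / 2)" for c z :: real by linarith
  then show ?thesis unfolding lattice_box_def mem_box_cart by simp
qed

lemma lattice_cell_AE_box:
  fixes j :: "int ^ 'n::finite"
  shows "AE y in lborel. y \<in> lattice_cell h j \<longleftrightarrow> y \<in> lattice_box h j"
proof -
  let ?a = "grid_point h j - (\<chi> i. h / 2)" and ?b = "grid_point h j + (\<chi> i. h / 2)"
  have D: "cbox ?a ?b - box ?a ?b \<in> sets lborel" by auto
  have "cbox ?a ?b - box ?a ?b \<in> null_sets lborel"
    using negligible_frontier_interval[of ?a ?b] null_sets_completion_iff[OF D]
    by (simp add: negligible_iff_null_sets)
  then have "AE y in lborel. y \<notin> cbox ?a ?b - box ?a ?b" by (rule AE_not_in)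
  moreover have "lattice_cell h j \<subseteq> cbox ?a ?b"
    by (auto simp: lattice_cell_def mem_box_cart grid_point_def algebra_simps less_imp_le)
  moreover have "box ?a ?b \<subseteq> lattice_cell h j"
    by (auto simp: lattice_cell_def mem_box_cart grid_point_def algebra_simps less_imp_le)
  ultimately show ?thesis unfolding lattice_box_def by (auto elim!: eventually_mono)
qed

lemma lattice_box_sets [measurable, simp]: "lattice_box h j \<in> sets borel"
  unfolding lattice_box_def by simp

lemma measure_lattice_box:
  fixes j :: "int ^ 'n::finite"
  assumes "h > 0"
  shows "measure lborel (lattice_box h j) = h ^ CARD('n)"
proof -
  let ?a = "grid_point h j - (\<chi> i. h / 2)" and ?b = "grid_point h j + (\<chi> i. h / 2)"
  have d: "(?b - ?a) \<bullet> b = h" if "b \<in> Basis" for b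
    using that unfolding real_vec_Basis by (auto simp: inner_axis)
  have le: "?a \<bullet> b \<le> ?b \<bullet> b" if "b \<in> Basis" for b
    using d[OF that] assms inner_diff_left[of ?b ?a b] by linarith
  have "measure lborel (lattice_box h j) = (if \<forall>b\<in>Basis. ?a \<bullet> b \<le> ?b \<bullet> b then \<Prod>b\<in>Basis. (?b - ?a) \<bullet> b else 0)"
    unfolding lattice_box_def by (rule measure_lborel_box_eq)
  also have "\<dots> = (\<Prod>b\<in>Basis. (?b - ?a) \<bullet> b)" using le by (intro if_P) blast
  also have "\<dots> = (\<Prod>b\<in>(Basis :: (real ^ 'n) set). h)" by (rule prod.cong[OF refl d])
  finally show ?thesis by simp
qed

lemma emeasure_lattice_box_finite: "emeasure lborel (lattice_box h j) < \<infinity>"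
  unfolding lattice_box_def by (simp add: emeasure_lborel_box_eq)

lemma lattice_cell_integral_box:
  fixes f :: "real ^ 'n::finite \<Rightarrow> real"
  assumes "f \<in> borel_measurable borel"
  shows "(LINT y:lattice_cell h j|lborel. f y) = (LINT y:lattice_box h j|lborel. f y)"
  unfolding set_lebesgue_integral_def
proof (rule integral_cong_AE)
  note [measurable] = assms
  show "(\<lambda>y. indicat_real (lattice_cell h j) y *\<^sub>R f y) \<in> borel_measurable lborel"
    "(\<lambda>y. indicat_real (lattice_box h j) y *\<^sub>R f y) \<in> borel_measurable lborel" by measurable
  show "AE y in lborel. indicat_real (lattice_cell h j) y *\<^sub>R f y = indicat_real (lattice_box h j) y *\<^sub>R f y"
    using lattice_cell_AE_box[of h j] by eventually_elim (simp add: indicator_def)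
qed

section \<open>Reflection and the midpoint rule on one cell\<close>

lemma lborel_reflect: "distr lborel borel (\<lambda>y. c - y) = (lborel :: 'a::euclidean_space measure)"
proof -
  have "lborel = density (distr lborel borel (\<lambda>y. c + (-1) *\<^sub>R y)) (\<lambda>_. ennreal (\<bar>-1\<bar> ^ DIM('a)))"
    by (rule lborel_affine) simp
  then show ?thesis by (simp add: density_1)
qed

lemma lborel_integral_reflect:
  fixes f :: "'a::euclidean_space \<Rightarrow> real"
  assumes [measurable]: "f \<in> borel_measurable borel"
  shows "(\<integral>y. f (c - y) \<partial>lborel) = (\<integral>y. f y \<partial>lborel)"
  using integral_distr[of "\<lambda>y. c - y" lborel borel f] by (simp add: lborel_reflect)

lemma lborel_integrable_reflect:
  fixes f :: "'a::euclidean_space \<Rightarrow> real"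
  assumes "integrable lborel f"
  shows "integrable lborel (\<lambda>y. f (c - y))"
  using integrable_distr[of "\<lambda>y. c - y" lborel borel f] assms by (simp add: lborel_reflect)

text \<open>Reflection in the midpoint preserves the open box and the measure, so twice the integral
  is that of \<open>f y + f (2 c - y)\<close> and only symmetric second differences remain. The
  factor 1/2 gained by this averaging is given away at the end.\<close>

lemma lattice_cell_midpoint:
  fixes f :: "real ^ 'n::finite \<Rightarrow> real"
  assumes h: "h > 0" and f: "integrable lborel f"
    and M: "\<And>v. (\<And>i. \<bar>v $ i\<bar> < h / 2) \<Longrightarrow>
      \<bar>f (grid_point h j + v) + f (grid_point h j - v) - 2 * f (grid_point h j)\<bar> \<le> M"
  shows "\<bar>(LINT y:lattice_cell h j|lborel. f y) - h ^ CARD('n) * f (grid_point h j)\<bar> \<le> M * h ^ CARD('n)"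
proof -
  let ?Q = "lattice_box h j" and ?c = "grid_point h j"
  define g where "g y = indicat_real ?Q y * f y" for y
  have [measurable]: "f \<in> borel_measurable borel" using f by auto
  have g: "integrable lborel g"
    unfolding g_def using integrable_mult_indicator[OF _ f, of ?Q] by simp
  have sym: "2 *\<^sub>R ?c - y \<in> ?Q \<longleftrightarrow> y \<in> ?Q" for y
    unfolding lattice_box_iff by (auto simp: abs_minus_commute)
  have g': "integrable lborel (\<lambda>y. g (2 *\<^sub>R ?c - y))" by (rule lborel_integrable_reflect[OF g])
  have gm: "g \<in> borel_measurable borel" using g by auto
  have one: "integrable lborel (indicat_real ?Q)"
    using emeasure_lattice_box_finite by (intro integrable_real_indicator) auto
  have "(LINT y:lattice_cell h j|lborel. f y) = (\<integral>y. g y \<partial>lborel)"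
    by (subst lattice_cell_integral_box) (auto simp: set_lebesgue_integral_def g_def[abs_def])
  then have I: "2 * (LINT y:lattice_cell h j|lborel. f y) = (\<integral>y. g y + g (2 *\<^sub>R ?c - y) \<partial>lborel)"
    using g g' lborel_integral_reflect[OF gm] by simp
  have m: "(\<integral>y. indicat_real ?Q y \<partial>lborel) = h ^ CARD('n)"
    using measure_lattice_box[OF h] by simp
  have "2 * (LINT y:lattice_cell h j|lborel. f y) - 2 * (h ^ CARD('n) * f ?c)
      = (\<integral>y. g y + g (2 *\<^sub>R ?c - y) - indicat_real ?Q y * (2 * f ?c) \<partial>lborel)"
    unfolding I using g g' one m by simp
  also have "\<bar>\<dots>\<bar> \<le> (\<integral>y. \<bar>g y + g (2 *\<^sub>R ?c - y) - indicat_real ?Q y * (2 * f ?c)\<bar> \<partial>lborel)"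
    by (rule integral_abs_bound)
  also have "\<dots> \<le> (\<integral>y. indicat_real ?Q y * M \<partial>lborel)"
  proof (rule integral_mono)
    show "integrable lborel (\<lambda>y. \<bar>g y + g (2 *\<^sub>R ?c - y) - indicat_real ?Q y * (2 * f ?c)\<bar>)"
      using g g' one by (intro integrable_abs Bochner_Integration.integrable_diff Bochner_Integration.integrable_add) auto
    show "integrable lborel (\<lambda>y. indicat_real ?Q y * M)" using one by auto
    fix y
    show "\<bar>g y + g (2 *\<^sub>R ?c - y) - indicat_real ?Q y * (2 * f ?c)\<bar> \<le> indicat_real ?Q y * M"
    proof (cases "y \<in> ?Q")
      case True
      have "?c + (y - ?c) = y" "?c - (y - ?c) = 2 *\<^sub>R ?c - y" by (simp_all add: scaleR_2)
      moreover have "\<bar>f (?c + (y - ?c)) + f (?c - (y - ?c)) - 2 * f ?c\<bar> \<le> M"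
        using True unfolding lattice_box_iff by (intro M) simp
      ultimately show ?thesis using True sym[of y] by (simp add: g_def)
    qed (use sym[of y] in \<open>simp add: g_def\<close>)
  qed
  also have "\<dots> = M * h ^ CARD('n)" using m by simp
  finally have "\<bar>2 * ((LINT y:lattice_cell h j|lborel. f y) - h ^ CARD('n) * f ?c)\<bar> \<le> M * h ^ CARD('n)"
    by (simp add: algebra_simps)
  then show ?thesis by (simp add: abs_mult)
qed

text \<open>This is the only place where the dimension matters: since \<open>sqrt 3 / 2 < 1\<close>, the cells around
  nonzero lattice points stay away from the origin.\<close>

lemma lattice_cell_geometry:
  fixes v :: "real ^ 'n::finite"
  assumes h: "h > 0" and d: "CARD('n) \<le> 3" and v: "\<And>i. \<bar>v $ i\<bar> \<le> h / 2"
  shows "(norm v)\<^sup>2 \<le> h\<^sup>2"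
    and "j \<noteq> 0 \<Longrightarrow> \<bar>t\<bar> \<le> 1 \<Longrightarrow> norm (grid_point h j) \<le> 8 * norm (grid_point h j + t *\<^sub>R v)"
    and "j \<noteq> 0 \<Longrightarrow> \<bar>t\<bar> \<le> 1 \<Longrightarrow> norm (grid_point h j + t *\<^sub>R v) \<le> 2 * norm (grid_point h j)"
    and "j \<noteq> 0 \<Longrightarrow> h \<le> norm (grid_point h j :: real ^ 'n)"
proof -
  have "(norm v)\<^sup>2 = (\<Sum>i\<in>UNIV. (v $ i)\<^sup>2)" by (simp add: norm_vec_def L2_set_def sum_nonneg)
  also have "\<dots> \<le> (\<Sum>i\<in>(UNIV :: 'n set). (h / 2)\<^sup>2)"
    using v h by (intro sum_mono) (simp add: abs_le_square_iff[symmetric])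
  also have "\<dots> \<le> 3 * (h / 2)\<^sup>2"
    using mult_right_mono[of "real CARD('n)" 3 "(h / 2)\<^sup>2"] d by simp
  \<comment> \<open>7/8 is a rational bound for \<open>sqrt 3 / 2\<close>, as 3/4 is below 49/64.
    The gap 1/8 yields the ratio 8, and \<open>1 + 7/8 < 2\<close> yields the ratio 2.\<close>
  also have "\<dots> \<le> (7 / 8 * h)\<^sup>2" by (simp add: power2_eq_square)
  finally have v2: "(norm v)\<^sup>2 \<le> (7 / 8 * h)\<^sup>2" .
  then have vn: "norm v \<le> 7 / 8 * h" by (rule power2_le_imp_le) (use h in simp)
  have "(7 / 8 * h)\<^sup>2 \<le> h\<^sup>2" by (simp add: power2_eq_square)
  then show "(norm v)\<^sup>2 \<le> h\<^sup>2" using v2 by simp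
  have c: "h \<le> norm (grid_point h j :: real ^ 'n)" if "j \<noteq> 0" for j
  proof -
    obtain i where "j $ i \<noteq> 0" using \<open>j \<noteq> 0\<close> by (auto simp: vec_eq_iff)
    then have "1 \<le> \<bar>real_of_int (j $ i)\<bar>" by linarith
    then have "h \<le> \<bar>grid_point h j $ i\<bar>" using h by (simp add: grid_point_def abs_mult)
    then show ?thesis using component_le_norm_cart[of "grid_point h j" i] by linarith
  qed
  show "j \<noteq> 0 \<Longrightarrow> h \<le> norm (grid_point h j :: real ^ 'n)" by (rule c)
  assume j: "j \<noteq> 0" and t: "\<bar>t\<bar> \<le> 1"
  have "norm (t *\<^sub>R v) \<le> 7 / 8 * h"
    using mult_mono[OF t vn] h by simp
  then have "norm (t *\<^sub>R v) \<le> 7 / 8 * norm (grid_point h j :: real ^ 'n)" using c[OF j] by simp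
  then show "norm (grid_point h j) \<le> 8 * norm (grid_point h j + t *\<^sub>R v)"
    "norm (grid_point h j + t *\<^sub>R v) \<le> 2 * norm (grid_point h j)"
    using norm_triangle_ineq[of "grid_point h j" "t *\<^sub>R v"]
      norm_triangle_ineq2[of "grid_point h j" "- (t *\<^sub>R v)"] by auto
qed

text \<open>On the box the weight is comparable to its value at the lattice point, and
  \<open>h ^ CARD('n)\<close> is the volume. Lattice sums of the weight are thus dominated by its
  integral, with a constant independent of \<open>h\<close>.\<close>

lemma lattice_radial_weight_le_integral:
  fixes j :: "int ^ 'n::finite"
  assumes h: "h > 0" and d: "CARD('n) \<le> 3" and j: "j \<noteq> 0" and p: "p \<ge> 0"
    and int: "integrable lborel (\<lambda>y :: real ^ 'n. radial_weight p (norm y))"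
  shows "h ^ CARD('n) * radial_weight p (norm (grid_point h j))
    \<le> (16 ^ 4 * 16 powr p) * (LINT y:lattice_cell h j|lborel. radial_weight p (norm y))"
proof -
  let ?Q = "lattice_box h j" and ?c = "grid_point h j" and ?K = "16 ^ 4 * 16 powr p"
  have one: "integrable lborel (indicat_real ?Q)"
    using emeasure_lattice_box_finite by (intro integrable_real_indicator) auto
  have iQ: "integrable lborel (\<lambda>y. indicat_real ?Q y * radial_weight p (norm y))"
    using integrable_mult_indicator[OF _ int, of ?Q] by simp
  have "h ^ CARD('n) * radial_weight p (norm ?c) = (\<integral>y. indicat_real ?Q y * radial_weight p (norm ?c) \<partial>lborel)"
    using measure_lattice_box[OF h, of j] by simp
  also have "\<dots> \<le> (\<integral>y. ?K * (indicat_real ?Q y * radial_weight p (norm y)) \<partial>lborel)"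
  proof (rule integral_mono)
    show "integrable lborel (\<lambda>y. indicat_real ?Q y * radial_weight p (norm ?c))" using one by auto
    show "integrable lborel (\<lambda>y. ?K * (indicat_real ?Q y * radial_weight p (norm y)))" using iQ by auto
    fix y
    show "indicat_real ?Q y * radial_weight p (norm ?c) \<le> ?K * (indicat_real ?Q y * radial_weight p (norm y))"
    proof (cases "y \<in> ?Q")
      case True
      then have v: "\<And>i. \<bar>(y - ?c) $ i\<bar> \<le> h / 2" unfolding lattice_box_iff by (simp add: less_imp_le)
      have 1: "norm ?c \<le> 8 * norm y" "norm y \<le> 2 * norm ?c" "h \<le> norm ?c"
        using lattice_cell_geometry(2,3)[OF h d v j, of 1] lattice_cell_geometry(4)[OF h d v j] by simp_all
      then have "radial_weight p (norm ?c) \<le> ?K * radial_weight p (norm y)"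
        using h p by (intro radial_weight_comparable) auto
      then show ?thesis using True by simp
    qed simp
  qed
  also have "\<dots> = ?K * (LINT y:lattice_cell h j|lborel. radial_weight p (norm y))"
    by (subst lattice_cell_integral_box) (auto simp: set_lebesgue_integral_def)
  finally show ?thesis .
qed

lemma lattice_radial_weight_summable:
  assumes h: "h > 0" and d: "CARD('n::finite) \<le> 3" and p: "p \<ge> 0"
    and int: "integrable lborel (\<lambda>y :: real ^ 'n. radial_weight p (norm y))"
  shows "(\<lambda>j :: int ^ 'n. radial_weight p (norm (grid_point h j))) summable_on (UNIV - {0})"
proof -
  have "(\<lambda>j :: int ^ 'n. LINT y:lattice_cell h j|lborel. radial_weight p (norm y)) summable_on UNIV"
    using integral_lattice_cells_has_sum[OF h int] has_sum_imp_summable by blast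
  then have "(\<lambda>j :: int ^ 'n. LINT y:lattice_cell h j|lborel. radial_weight p (norm y)) summable_on (UNIV - {0})"
    by (rule summable_on_subset_banach) simp
  then have "(\<lambda>j :: int ^ 'n. (16 ^ 4 * 16 powr p) * (LINT y:lattice_cell h j|lborel. radial_weight p (norm y))) summable_on (UNIV - {0})"
    by (rule summable_on_cmult_right)
  then have "(\<lambda>j :: int ^ 'n. h ^ CARD('n) * radial_weight p (norm (grid_point h j))) summable_on (UNIV - {0})"
    by (rule summable_on_comparison_test) (use lattice_radial_weight_le_integral[OF h d _ p int] h in auto)
  then have "(\<lambda>j :: int ^ 'n. (1 / h ^ CARD('n)) * (h ^ CARD('n) * radial_weight p (norm (grid_point h j)))) summable_on (UNIV - {0})"
    by (rule summable_on_cmult_right)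
  then show ?thesis using h by simp
qed

text \<open>At a point \<open>?z\<close> of the segment, dividing the symbol bound by
  \<open>(norm ?z)\<^sup>2\<close> raises the exponent to \<open>p + 2\<close>; comparability moves
  the weight to the lattice point, and \<open>(norm v)\<^sup>2 \<le> h\<^sup>2\<close> supplies the
  order.\<close>

lemma symbol_on_second_difference:
  fixes f :: "real ^ 'n::finite \<Rightarrow> real" and v :: "real ^ 'n"
  assumes h: "h > 0" and d: "CARD('n) \<le> 3" and j: "j \<noteq> 0" and p: "p \<ge> 0" and C: "C \<ge> 0"
    and f: "symbol_on (- {0}) (\<lambda>y. C * radial_weight p (norm y)) f"
    and v: "\<And>i. \<bar>v $ i\<bar> < h / 2"
  shows "\<bar>f (grid_point h j + v) + f (grid_point h j - v) - 2 * f (grid_point h j)\<bar>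
    \<le> 2 * (C * (16 ^ 4 * 16 powr (p + 2)) * h\<^sup>2 * radial_weight (p + 2) (norm (grid_point h j)))"
proof (rule second_difference_bound)
  let ?c = "grid_point h j" and ?K = "16 ^ 4 * 16 powr (p + 2)"
  fix t :: real assume t: "\<bar>t\<bar> \<le> 1"
  let ?z = "?c + t *\<^sub>R v"
  have v': "\<And>i. \<bar>v $ i\<bar> \<le> h / 2" using v by (simp add: less_imp_le)
  note geo = lattice_cell_geometry(1)[OF h d v'] lattice_cell_geometry(2,3)[OF h d v' j t]
    lattice_cell_geometry(4)[OF h d v' j]
  have z: "norm ?z > 0" using geo h by linarith
  then have "?z \<in> - {0}" by auto
  then obtain a b where ab: "line_jet f ?z v a b"
    "\<bar>b\<bar> * (norm ?z)\<^sup>2 \<le> C * radial_weight p (norm ?z) * (norm v)\<^sup>2"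
    using symbol_on_jet[OF f] by metis
  have "\<bar>b\<bar> * (norm ?z)\<^sup>2 \<le> (C * radial_weight (p + 2) (norm ?z) * (norm v)\<^sup>2) * (norm ?z)\<^sup>2"
    using ab(2) radial_weight_shift[OF z, of p] by (simp add: mult_ac)
  then have "\<bar>b\<bar> \<le> C * radial_weight (p + 2) (norm ?z) * (norm v)\<^sup>2"
    using z by simp
  also have "\<dots> \<le> C * (?K * radial_weight (p + 2) (norm ?c)) * h\<^sup>2"
  proof (intro mult_mono mult_left_mono)
    show "radial_weight (p + 2) (norm ?z) \<le> ?K * radial_weight (p + 2) (norm ?c)"
      using geo p h by (intro radial_weight_comparable) auto
  qed (use C geo in auto)
  finally show "\<exists>a b. line_jet f ?z v a b \<and> \<bar>b\<bar> \<le> C * ?K * h\<^sup>2 * radial_weight (p + 2) (norm ?c)"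
    using ab(1) by (intro exI[of _ a] exI[of _ b]) (simp add: mult_ac)
qed

text \<open>Cells with \<open>j \<noteq> 0\<close> contribute the sum \<open>s\<close> of midpoint
  errors; the cell of the origin contributes its whole integral, as the lattice sum skips that
  point.\<close>

lemma lattice_quadrature_error:
  fixes f :: "real ^ 'n::finite \<Rightarrow> real"
  assumes h: "h > 0" and d: "CARD('n) \<le> 3" and p: "p \<ge> 0" and C: "C \<ge> 0"
    and f: "symbol_on (- {0}) (\<lambda>y. C * radial_weight p (norm y)) f" and f0: "f 0 = 0"
    and meas [measurable]: "f \<in> borel_measurable borel"
    and int: "integrable lborel (\<lambda>y :: real ^ 'n. radial_weight p (norm y))"
    and int2: "integrable lborel (\<lambda>y :: real ^ 'n. radial_weight (p + 2) (norm y))"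
  shows "\<bar>(\<integral>y. f y \<partial>lborel) - h ^ CARD('n) * (\<Sum>\<^sub>\<infinity>j\<in>UNIV - {0}. f (grid_point h j))\<bar>
    \<le> (2 * C * (16 ^ 4 * 16 powr (p + 2))\<^sup>2 + C) * (\<integral>y. radial_weight (p + 2) (norm (y :: real ^ 'n)) \<partial>lborel) * h\<^sup>2"
proof -
  let ?K = "16 ^ 4 * 16 powr (p + 2)" and ?n = "CARD('n)"
  let ?g = "\<lambda>j :: int ^ 'n. LINT y:lattice_cell h j|lborel. radial_weight (p + 2) (norm y)"
  let ?G = "\<integral>y. radial_weight (p + 2) (norm (y :: real ^ 'n)) \<partial>lborel"
  let ?I = "\<lambda>j. LINT y:lattice_cell h j|lborel. f y"
  have fb: "\<bar>f y\<bar> \<le> C * radial_weight p (norm y)" for y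
    using symbol_on_bound[OF f, of y] f0 C by (cases "y = 0") auto
  have fint: "integrable lborel f"
    by (rule Bochner_Integration.integrable_bound[OF integrable_mult_right[OF int, of C]])
      (use fb C in auto)
  have "(\<lambda>j :: int ^ 'n. C * radial_weight p (norm (grid_point h j))) summable_on (UNIV - {0})"
    by (intro summable_on_cmult_right lattice_radial_weight_summable h d p int)
  then have "(\<lambda>j :: int ^ 'n. norm (f (grid_point h j))) summable_on (UNIV - {0})"
    by (rule summable_on_comparison_test) (use fb in auto)
  then have fs: "(\<lambda>j :: int ^ 'n. f (grid_point h j)) summable_on (UNIV - {0})"
    by (rule abs_summable_summable)
  have remove0: "(a has_sum (s - a 0)) (UNIV - {0 :: int ^ 'n})" if "(a has_sum s) UNIV" for a :: "int ^ 'n \<Rightarrow> real" and s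
  proof -
    have "(a has_sum (s - a 0)) (UNIV - {0})"
      by (rule has_sum_Diff[OF that]) (auto intro!: has_sum_finiteI)
    then show ?thesis .
  qed
  have gnn: "0 \<le> ?g j" for j
    unfolding set_lebesgue_integral_def by (intro Bochner_Integration.integral_nonneg) auto
  have gs: "(?g has_sum (?G - ?g 0)) (UNIV - {0})"
    by (rule remove0, rule integral_lattice_cells_has_sum[OF h int2])
  have g0: "?g 0 \<le> ?G" using has_sum_nonneg[OF gs] gnn by simp
  define e where "e j = ?I j - h ^ ?n * f (grid_point h j)" for j
  define s where "s = (\<integral>y. f y \<partial>lborel) - ?I 0 - h ^ ?n * (\<Sum>\<^sub>\<infinity>j\<in>UNIV - {0}. f (grid_point h j))"
  have es: "(e has_sum s) (UNIV - {0})"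
    using has_sum_add[OF remove0[OF integral_lattice_cells_has_sum[OF h fint]]
        has_sum_cmult_right[OF has_sum_infsum[OF fs], of "- (h ^ ?n)"]]
    unfolding e_def s_def by simp
  \<comment> \<open>One factor \<open>?K\<close> moves the weight from the segment to the lattice
    point, the other from the lattice point to the cell integral.\<close>
  let ?D = "2 * C * ?K\<^sup>2 * h\<^sup>2"
  have eb: "\<bar>e j\<bar> \<le> ?D * ?g j" if "j \<in> UNIV - {0}" for j
  proof -
    have j: "j \<noteq> 0" using that by simp
    have "\<bar>e j\<bar> \<le> 2 * (C * ?K * h\<^sup>2 * radial_weight (p + 2) (norm (grid_point h j))) * h ^ ?n"
      unfolding e_def
      by (rule lattice_cell_midpoint[OF h fint], rule symbol_on_second_difference[OF h d j p C f])
    also have "\<dots> = (2 * C * ?K * h\<^sup>2) * (h ^ ?n * radial_weight (p + 2) (norm (grid_point h j)))"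
      by (simp add: mult_ac)
    also have "\<dots> \<le> (2 * C * ?K * h\<^sup>2) * (?K * ?g j)"
      using lattice_radial_weight_le_integral[OF h d j _ int2] p C by (intro mult_left_mono) auto
    also have "\<dots> = ?D * ?g j" by (simp add: power2_eq_square mult_ac)
    finally show ?thesis .
  qed
  have Dg: "((\<lambda>j. ?D * ?g j) has_sum (?D * (?G - ?g 0))) (UNIV - {0})"
    by (rule has_sum_cmult_right[OF gs])
  have "s \<le> ?D * (?G - ?g 0)"
    by (rule has_sum_mono[OF es Dg]) (use eb in \<open>auto simp: abs_le_iff\<close>)
  moreover have "- s \<le> ?D * (?G - ?g 0)"
    by (rule has_sum_mono[OF has_sum_uminusI[OF es] Dg]) (use eb in \<open>auto simp: abs_le_iff\<close>)
  ultimately have "\<bar>s\<bar> \<le> ?D * (?G - ?g 0)" by linarith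
  also have "\<dots> \<le> ?D * ?G" using gnn C by (intro mult_left_mono) auto
  finally have s: "\<bar>s\<bar> \<le> ?D * ?G" .
  have I0: "\<bar>?I 0\<bar> \<le> C * h\<^sup>2 * ?G"
  proof -
    have pw: "norm (indicat_real (lattice_cell h (0 :: int ^ 'n)) y *\<^sub>R f y)
        \<le> C * h\<^sup>2 * (indicat_real (lattice_cell h 0) y *\<^sub>R radial_weight (p + 2) (norm y))" for y
    \<comment> \<open>\<open>radial_weight_shift\<close> requires a positive norm, so the origin
      joins the trivial case, where \<open>f 0 = 0\<close> suffices.\<close>
    proof (cases "y \<in> lattice_cell h (0 :: int ^ 'n) \<and> y \<noteq> 0")
      case True
      then have "- (h / 2) \<le> y $ i \<and> y $ i < h / 2" for i
        by (simp add: lattice_cell_def)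
      then have "\<bar>y $ i\<bar> \<le> h / 2" for i
        by (meson abs_leI less_imp_le minus_le_iff)
      then have "(norm y)\<^sup>2 \<le> h\<^sup>2" by (rule lattice_cell_geometry(1)[OF h d])
      then have "C * ((norm y)\<^sup>2 * radial_weight (p + 2) (norm y)) \<le> C * (h\<^sup>2 * radial_weight (p + 2) (norm y))"
        using C by (intro mult_left_mono mult_right_mono) auto
      then show ?thesis using True fb[of y] radial_weight_shift[of "norm y" p] by (simp add: mult_ac)
    qed (use f0 C in \<open>auto simp: indicator_def\<close>)
    have "\<bar>?I 0\<bar> \<le> (\<integral>y. C * h\<^sup>2 * (indicat_real (lattice_cell h (0 :: int ^ 'n)) y *\<^sub>R radial_weight (p + 2) (norm y)) \<partial>lborel)"
      unfolding set_lebesgue_integral_def real_norm_def[symmetric]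
      by (rule Bochner_Integration.integral_norm_bound_integral[OF _ _ pw])
        (intro integrable_mult_right integrable_mult_indicator fint int2, simp)+
    also have "\<dots> = C * h\<^sup>2 * ?g 0" by (simp add: set_lebesgue_integral_def)
    also have "\<dots> \<le> C * h\<^sup>2 * ?G" using g0 C by (intro mult_left_mono) auto
    finally show ?thesis .
  qed
  have "(\<integral>y. f y \<partial>lborel) - h ^ ?n * (\<Sum>\<^sub>\<infinity>j\<in>UNIV - {0}. f (grid_point h j)) = s + ?I 0"
    by (simp add: s_def)
  then have "\<bar>(\<integral>y. f y \<partial>lborel) - h ^ ?n * (\<Sum>\<^sub>\<infinity>j\<in>UNIV - {0}. f (grid_point h j))\<bar> \<le> ?D * ?G + C * h\<^sup>2 * ?G"
    using s I0 by linarith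
  also have "\<dots> = (2 * C * ?K\<^sup>2 + C) * ?G * h\<^sup>2" by (simp add: algebra_simps)
  finally show ?thesis .
qed

subsection \<open>Lattice moments\<close>

lemma continuous_vanishing_outside_ball_bounded:
  fixes g :: "'a::euclidean_space \<Rightarrow> real"
  assumes "continuous_on UNIV g" "\<And>y. norm y > \<rho> \<Longrightarrow> g y = 0"
  obtains B where "\<And>y. \<bar>g y\<bar> \<le> B"
proof -
  obtain C where C: "\<And>y. y \<in> cball 0 \<rho> \<Longrightarrow> \<bar>g y\<bar> \<le> C"
    using Taylor_vanishing_bound[of 0 g \<rho>] assms(1) by (auto simp: Ball_def)
  have "\<bar>g y\<bar> \<le> \<bar>C\<bar>" for y
    using C[of y] assms(2)[of y] by (cases "norm y > \<rho>") auto
  then show ?thesis using that by blast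
qed

text \<open>Nonzero lattice points have norm at least \<open>h\<close>, so
  \<open>min (r ^ 4) 1\<close> is bounded below there; the dependence on \<open>h\<close> is
  harmless, since only convergence is claimed. The pieces of the numerator can thus be summed
  separately, although the constant \<open>u 0\<close> divided by the power is not integrable at the
  origin unless it vanishes.\<close>

lemma lattice_quotient_summable:
  fixes g :: "real ^ 'n::finite \<Rightarrow> real"
  assumes h: "h > 0" and d: "CARD('n) \<le> 3" and p: "p \<ge> 0"
    and int: "integrable lborel (\<lambda>y :: real ^ 'n. radial_weight p (norm y))"
    and g: "\<And>y. \<bar>g y\<bar> \<le> B"
  shows "(\<lambda>j. g (grid_point h j) / norm (grid_point h j) powr p) summable_on (UNIV - {0})"
proof -
  let ?m = "min (h ^ 4) 1"
  have m: "?m > 0" using h by simp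
  have B: "B \<ge> 0" using g[of 0] by linarith
  have "(\<lambda>j :: int ^ 'n. (B / ?m) * radial_weight p (norm (grid_point h j))) summable_on (UNIV - {0})"
    by (intro summable_on_cmult_right lattice_radial_weight_summable h d p int)
  then have "(\<lambda>j :: int ^ 'n. norm (g (grid_point h j) / norm (grid_point h j) powr p)) summable_on (UNIV - {0})"
  proof (rule summable_on_comparison_test)
    fix j :: "int ^ 'n" assume "j \<in> UNIV - {0}"
    then have hn: "h \<le> norm (grid_point h j :: real ^ 'n)"
      using lattice_cell_geometry(4)[OF h d, of 0 j] h by simp
    let ?r = "norm (grid_point h j :: real ^ 'n)"
    have "h ^ 4 \<le> ?r ^ 4" using hn h by (intro power_mono) auto
    then have "?m \<le> min (?r ^ 4) 1" by (intro min.mono) auto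
    then have "?m * ?r powr (- p) \<le> radial_weight p ?r"
      unfolding radial_weight_def by (rule mult_right_mono) simp
    then have "?r powr (- p) \<le> radial_weight p ?r / ?m"
      using pos_le_divide_eq[OF m, of "?r powr (- p)"] by (simp add: mult.commute)
    then have "\<bar>g (grid_point h j)\<bar> * ?r powr (- p) \<le> B * (radial_weight p ?r / ?m)"
      using g B by (intro mult_mono) auto
    then show "norm (g (grid_point h j) / ?r powr p) \<le> B / ?m * radial_weight p ?r"
      by (simp add: powr_minus divide_inverse abs_mult mult_ac)
  qed simp
  then show ?thesis by (rule abs_summable_summable)
qed

lemma has_sum_finite_linear_combination:
  fixes f :: "'i \<Rightarrow> 'b \<Rightarrow> real"
  assumes "finite I" "\<And>i. i \<in> I \<Longrightarrow> (f i has_sum s i) J"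
  shows "((\<lambda>x. \<Sum>i\<in>I. c i * f i x) has_sum (\<Sum>i\<in>I. c i * s i)) J"
  using assms
proof (induction I rule: finite_induct)
  case (insert i I)
  have "((\<lambda>x. c i * f i x) has_sum (c i * s i)) J"
    using insert.prems by (intro has_sum_cmult_right) auto
  moreover have "((\<lambda>x. \<Sum>i\<in>I. c i * f i x) has_sum (\<Sum>i\<in>I. c i * s i)) J"
    using insert by auto
  ultimately show ?case using insert.hyps has_sum_add by fastforce
qed (simp add: has_sum_0)

section \<open>Moments of the lattice and its symmetries\<close>

definition lattice_moment :: "(real \<Rightarrow> real) \<Rightarrow> real \<Rightarrow> real \<Rightarrow> ('n::finite \<Rightarrow> nat) \<Rightarrow> real" where
  "lattice_moment w p h \<beta> = (\<Sum>\<^sub>\<infinity>j\<in>UNIV - {0 :: int ^ 'n}.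
     w (norm (grid_point h j)) * multi_power (grid_point h j) \<beta> / norm (grid_point h j) powr p)"

text \<open>Flipping the sign of coordinate \<open>i\<close> permutes the nonzero lattice points,
  keeps norms and negates the monomial, so the sum equals its own negative.\<close>

lemma lattice_moment_odd:
  fixes \<beta> :: "'n::finite \<Rightarrow> nat"
  assumes "odd (\<beta> i)"
  shows "lattice_moment w p h \<beta> = 0"
proof -
  let ?t = "\<lambda>j :: int ^ 'n. w (norm (grid_point h j)) * multi_power (grid_point h j) \<beta> / norm (grid_point h j) powr p"
  define r where "r j = (\<chi> k. if k = i then - (j $ k) else j $ k)" for j :: "int ^ 'n"
  have rr: "r (r j) = j" for j by (simp add: r_def vec_eq_iff)
  have r0: "r j = 0 \<longleftrightarrow> j = 0" for j by (auto simp: r_def vec_eq_iff)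
  have bij: "bij_betw r (UNIV - {0}) (UNIV - {0})"
    by (rule bij_betwI[where g = r]) (auto simp: rr r0)
  have comp: "grid_point h (r j) $ k = (if k = i then - (grid_point h j $ k) else grid_point h j $ k)" for j k
    by (simp add: grid_point_def r_def)
  have norm: "norm (grid_point h (r j)) = norm (grid_point h j)" for j
    unfolding norm_vec_def L2_set_def by (intro arg_cong[where f = sqrt] sum.cong) (auto simp: comp)
  have mp: "multi_power (grid_point h (r j)) \<beta> = - multi_power (grid_point h j) \<beta>" for j
    unfolding multi_power_split[of _ _ i] using assms by (simp add: comp)
  have "(\<Sum>\<^sub>\<infinity>j\<in>UNIV - {0}. ?t j) = (\<Sum>\<^sub>\<infinity>j\<in>UNIV - {0}. ?t (r j))"
    by (rule infsum_reindex_bij_betw[OF bij, symmetric])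
  also have "\<dots> = - (\<Sum>\<^sub>\<infinity>j\<in>UNIV - {0}. ?t j)"
    by (simp add: norm mp infsum_uminus)
  finally show ?thesis unfolding lattice_moment_def by simp
qed

lemma multi_power_double: "multi_power y ((\<lambda>_. 0)(i := 2)) = (y $ i)\<^sup>2"
  by (simp add: multi_power_split[of _ _ i])

text \<open>Swapping the coordinates \<open>i\<close> and \<open>Min UNIV\<close> preserves the
  lattice and the norm, so all directions give the same moment; the 2 undoes the
  \<open>1 / 2\<close> in \<open>A2\<close>.\<close>

lemma lattice_moment_double:
  fixes i :: "'n::{finite,linorder}"
  shows "lattice_moment w (real CARD('n) + \<alpha>) h ((\<lambda>_. 0)(i := 2)) = 2 * A2 TYPE('n) w \<alpha> h"
proof -
  let ?p = "real CARD('n) + \<alpha>"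
  let ?t = "\<lambda>k (j :: (int, 'n) vec). w (norm (grid_point h j)) * (grid_point h j $ k)\<^sup>2 / norm (grid_point h j) powr ?p"
  define \<tau> where "\<tau> = Transposition.transpose i (Min (UNIV :: 'n set))"
  define r where "r j = (\<chi> k. j $ \<tau> k)" for j :: "(int, 'n) vec"
  have \<tau>\<tau>: "\<tau> (\<tau> k) = k" for k by (simp add: \<tau>_def)
  have rr: "r (r j) = j" for j by (simp add: r_def vec_eq_iff \<tau>\<tau>)
  have r0: "r 0 = 0" by (simp add: r_def vec_eq_iff)
  have bij: "bij_betw r (UNIV - {0}) (UNIV - {0})"
    by (rule bij_betwI[where g = r]) (use rr r0 in \<open>auto, metis+\<close>)
  have comp: "grid_point h (r j) $ k = grid_point h j $ \<tau> k" for j k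
    by (simp add: grid_point_def r_def)
  have bij\<tau>: "bij_betw \<tau> UNIV UNIV" by (rule bij_betwI[where g = \<tau>]) (auto simp: \<tau>\<tau>)
  have norm: "norm (grid_point h (r j)) = norm (grid_point h j)" for j
    unfolding norm_vec_def L2_set_def
    using sum.reindex_bij_betw[OF bij\<tau>, of "\<lambda>k. (norm (grid_point h j $ k))\<^sup>2"] by (simp add: comp)
  have "(\<Sum>\<^sub>\<infinity>j\<in>UNIV - {0}. ?t (Min UNIV) j) = (\<Sum>\<^sub>\<infinity>j\<in>UNIV - {0}. ?t (Min UNIV) (r j))"
    by (rule infsum_reindex_bij_betw[OF bij, symmetric])
  also have "\<dots> = (\<Sum>\<^sub>\<infinity>j\<in>UNIV - {0}. ?t i j)"
    by (simp add: norm comp \<tau>_def)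
  finally show ?thesis unfolding lattice_moment_def A2_def multi_power_double by simp
qed

text \<open>Nonzero even entries are at least 2, and two of them would exceed 3.\<close>

lemma even_multi_index_of_size_le_3:
  fixes \<beta> :: "'n::finite \<Rightarrow> nat"
  assumes "\<And>i. even (\<beta> i)" "1 \<le> multi_size \<beta>" "multi_size \<beta> \<le> 3"
  obtains i where "\<beta> = (\<lambda>_. 0)(i := 2)"
proof -
  have "multi_size \<beta> \<noteq> 0" using assms(2) by simp
  then obtain i where i: "\<beta> i \<noteq> 0" unfolding multi_size_eq_0_iff by auto
  have split: "multi_size \<beta> = \<beta> i + (\<Sum>k\<in>UNIV - {i}. \<beta> k)"
    unfolding multi_size_def by (rule sum.remove) auto
  have "\<beta> i \<ge> 2" using i assms(1)[of i] by (auto elim!: evenE)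
  then have "(\<Sum>k\<in>UNIV - {i}. \<beta> k) \<le> 1" using split assms(3) by linarith
  then have "\<beta> k = 0" if "k \<noteq> i" for k
    using member_le_sum[of k "UNIV - {i}" \<beta>] that assms(1)[of k] by (auto elim!: evenE)
  moreover have "\<beta> i = 2" using \<open>\<beta> i \<ge> 2\<close> split assms(1)[of i] assms(3) by (auto elim!: evenE)
  ultimately have "\<beta> = (\<lambda>_. 0)(i := 2)" by (auto simp: fun_eq_iff)
  then show ?thesis by (rule that)
qed

lemma multi_deriv_double:
  fixes u :: "(real, 'n::{finite,linorder}) vec \<Rightarrow> real"
  assumes "C_k 2 u"
  shows "multi_deriv ((\<lambda>_. 0)(i := 2)) u x = partial_deriv (axis i 1) (partial_deriv (axis i 1) u) x"
proof -
  have \<beta>: "(\<lambda>_. 0)(i := 2) = count_list [i, i]" by (auto simp: fun_eq_iff)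
  let ?l = "map (\<lambda>i. axis i 1 :: (real, 'n) vec) [i, i]"
  have "foldr partial_deriv ?l u = foldr partial_deriv (map (\<lambda>i. axis i 1) (multi_list (count_list [i, i]))) u"
    by (rule foldr_partial_deriv_perm)
      (use assms mset_multi_list_count_list[of "[i, i]"] in \<open>auto simp: real_vec_Basis numeral_2_eq_2\<close>)
  then show ?thesis unfolding multi_deriv_foldr \<beta> by simp
qed

lemma sum_lattice_moments:
  fixes u :: "(real, 'n::{finite,linorder}) vec \<Rightarrow> real"
  assumes u: "C_k 2 u"
  shows "(\<Sum>\<beta> | 1 \<le> multi_size \<beta> \<and> multi_size \<beta> \<le> 3.
      multi_deriv \<beta> u 0 / multi_fact \<beta> * lattice_moment w (real CARD('n) + \<alpha>) h \<beta>)
    = A2 TYPE('n) w \<alpha> h * laplacian u 0"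
proof -
  let ?I = "{\<beta> :: 'n \<Rightarrow> nat. 1 \<le> multi_size \<beta> \<and> multi_size \<beta> \<le> 3}"
  let ?m = "lattice_moment w (real CARD('n) + \<alpha>) h"
  let ?b = "\<lambda>i :: 'n. (\<lambda>_. 0)(i := 2 :: nat)"
  have I: "finite ?I" by (rule finite_subset[OF _ finite_multi_size[of 4]]) auto
  have sub: "range ?b \<subseteq> ?I" by (auto simp: multi_size_def if_distrib cong: if_cong)
  have inj: "inj ?b" by (auto simp: inj_def fun_eq_iff split: if_splits)
  have "(\<Sum>\<beta>\<in>?I. multi_deriv \<beta> u 0 / multi_fact \<beta> * ?m \<beta>)
      = (\<Sum>\<beta>\<in>range ?b. multi_deriv \<beta> u 0 / multi_fact \<beta> * ?m \<beta>)"
  proof (rule sum.mono_neutral_right[OF I sub], rule ballI)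
    fix \<beta> assume \<beta>: "\<beta> \<in> ?I - range ?b"
    have "\<exists>i. odd (\<beta> i)"
    proof (rule ccontr)
      assume "\<nexists>i. odd (\<beta> i)"
      then obtain i where "\<beta> = ?b i" using even_multi_index_of_size_le_3[of \<beta>] \<beta> by blast
      then show False using \<beta> by blast
    qed
    then have "?m \<beta> = 0" using lattice_moment_odd by blast
    then show "multi_deriv \<beta> u 0 / multi_fact \<beta> * ?m \<beta> = 0" by simp
  qed
  also have "\<dots> = (\<Sum>i\<in>UNIV. multi_deriv (?b i) u 0 / multi_fact (?b i) * ?m (?b i))"
    by (simp add: sum.reindex[OF inj])
  also have "\<dots> = (\<Sum>i\<in>UNIV. partial_deriv (axis i 1) (partial_deriv (axis i 1) u) 0 * A2 TYPE('n) w \<alpha> h)"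
  proof (rule sum.cong[OF refl])
    fix i :: 'n
    \<comment> \<open>This factorial cancels the 2 in \<open>lattice_moment_double\<close>.\<close>
    have "multi_fact (?b i) = 2" by (simp add: multi_fact_split[of _ i])
    then show "multi_deriv (?b i) u 0 / multi_fact (?b i) * ?m (?b i)
        = partial_deriv (axis i 1) (partial_deriv (axis i 1) u) 0 * A2 TYPE('n) w \<alpha> h"
      unfolding lattice_moment_double multi_deriv_double[OF u] by simp
  qed
  also have "\<dots> = A2 TYPE('n) w \<alpha> h * laplacian u 0"
    unfolding laplacian_def by (simp add: sum_distrib_left mult.commute)
  finally show ?thesis .
qed

text \<open>An unordered sum may be split once each piece is known to converge, so every piece is
  first put into \<open>has_sum\<close> form.\<close>

lemma lattice_sum_numerator:
  fixes u :: "(real, 'n::{finite,linorder}) vec \<Rightarrow> real"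
  assumes h: "h > 0" and d: "CARD('n) \<le> 3" and p: "real CARD('n) + \<alpha> \<ge> 0"
    and int: "integrable lborel (\<lambda>y :: (real, 'n) vec. radial_weight (real CARD('n) + \<alpha>) (norm y))"
    and u: "C_k 2 u" "compactly_supported u"
    and w: "continuous_on UNIV w" "compactly_supported w"
  shows "(\<Sum>\<^sub>\<infinity>j\<in>UNIV - {0 :: (int, 'n) vec}. (u 0 - u (grid_point h j) +
              w (norm (grid_point h j)) * (\<Sum>\<beta> | 1 \<le> multi_size \<beta> \<and> multi_size \<beta> \<le> 3.
                   multi_deriv \<beta> u 0 / multi_fact \<beta> * multi_power (grid_point h j) \<beta>))
             / norm (grid_point h j) powr (real CARD('n) + \<alpha>))
     = A1 TYPE('n) \<alpha> h * u 0
           - (\<Sum>\<^sub>\<infinity>j\<in>UNIV - {0 :: (int, 'n) vec}.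
                u (grid_point h j) / norm (grid_point h j) powr (real CARD('n) + \<alpha>))
           + A2 TYPE('n) w \<alpha> h * laplacian u 0"
proof -
  let ?p = "real CARD('n) + \<alpha>" and ?J = "UNIV - {0 :: (int, 'n) vec}"
  let ?I = "{\<beta> :: 'n \<Rightarrow> nat. 1 \<le> multi_size \<beta> \<and> multi_size \<beta> \<le> 3}"
  let ?c = "\<lambda>\<beta>. multi_deriv \<beta> u 0 / multi_fact \<beta>"
  let ?N = "\<lambda>j :: (int, 'n) vec. norm (grid_point h j) powr ?p"
  have I: "finite ?I" by (rule finite_subset[OF _ finite_multi_size[of 4]]) auto
  obtain \<rho>1 where \<rho>1: "\<And>y. norm y > \<rho>1 \<Longrightarrow> u y = 0" using compactly_supported_bound[OF u(2)] by blast
  obtain \<rho>2 where \<rho>2: "\<And>y. norm y > \<rho>2 \<Longrightarrow> w y = 0" using compactly_supported_bound[OF w(2)] by blast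
  note summ = lattice_quotient_summable[OF h d p int]
  have s1: "((\<lambda>j. 1 / ?N j) has_sum A1 TYPE('n) \<alpha> h) ?J"
    unfolding A1_def by (rule has_sum_infsum, rule summ[of "\<lambda>_. 1" 1]) simp
  obtain B where "\<And>y. \<bar>u y\<bar> \<le> B"
    using continuous_vanishing_outside_ball_bounded[OF C_k_continuous[OF u(1)] \<rho>1] by blast
  then have s2: "((\<lambda>j. u (grid_point h j) / ?N j) has_sum (\<Sum>\<^sub>\<infinity>j\<in>?J. u (grid_point h j) / ?N j)) ?J"
    by (intro has_sum_infsum summ)
  have s3: "((\<lambda>j. w (norm (grid_point h j)) * multi_power (grid_point h j) \<beta> / ?N j) has_sum lattice_moment w ?p h \<beta>) ?J" for \<beta>
  proof -
    \<comment> \<open>The compactly supported cutoff makes the monomial bounded, as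
      \<open>summ\<close> demands.\<close>
    have "continuous_on UNIV (\<lambda>y :: (real, 'n) vec. w (norm y) * multi_power y \<beta>)"
      by (intro continuous_intros continuous_on_compose2[OF w(1)]) auto
    then obtain B where "\<And>y. \<bar>w (norm y) * multi_power y \<beta>\<bar> \<le> B"
      using continuous_vanishing_outside_ball_bounded[of "\<lambda>y. w (norm y) * multi_power y \<beta>" \<rho>2] \<rho>2 by auto
    then show ?thesis unfolding lattice_moment_def
      by (intro has_sum_infsum summ)
  qed
  have "((\<lambda>j. u 0 * (1 / ?N j) + (- 1) * (u (grid_point h j) / ?N j) +
       (\<Sum>\<beta>\<in>?I. ?c \<beta> * (w (norm (grid_point h j)) * multi_power (grid_point h j) \<beta> / ?N j))) has_sum
     (u 0 * A1 TYPE('n) \<alpha> h + (- 1) * (\<Sum>\<^sub>\<infinity>j\<in>?J. u (grid_point h j) / ?N j) +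
       (\<Sum>\<beta>\<in>?I. ?c \<beta> * lattice_moment w ?p h \<beta>))) ?J"
    by (intro has_sum_add has_sum_cmult_right s1 s2 has_sum_finite_linear_combination I s3)
  then have "(\<Sum>\<^sub>\<infinity>j\<in>?J. u 0 * (1 / ?N j) + (- 1) * (u (grid_point h j) / ?N j) +
       (\<Sum>\<beta>\<in>?I. ?c \<beta> * (w (norm (grid_point h j)) * multi_power (grid_point h j) \<beta> / ?N j)))
    = u 0 * A1 TYPE('n) \<alpha> h + (- 1) * (\<Sum>\<^sub>\<infinity>j\<in>?J. u (grid_point h j) / ?N j) +
       (\<Sum>\<beta>\<in>?I. ?c \<beta> * lattice_moment w ?p h \<beta>)"
    by (rule infsumI)
  moreover have "(u 0 - u (grid_point h j) + w (norm (grid_point h j)) *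
        (\<Sum>\<beta>\<in>?I. ?c \<beta> * multi_power (grid_point h j) \<beta>)) / ?N j
    = u 0 * (1 / ?N j) + (- 1) * (u (grid_point h j) / ?N j) +
       (\<Sum>\<beta>\<in>?I. ?c \<beta> * (w (norm (grid_point h j)) * multi_power (grid_point h j) \<beta> / ?N j))" for j
    by (simp add: add_divide_distrib diff_divide_distrib sum_distrib_left sum_divide_distrib mult_ac)
  ultimately show ?thesis
    by (simp only: sum_lattice_moments[OF u(1)]) (simp add: mult_ac)
qed

theorem theorem1:
  fixes u :: "real ^ 'n::{finite,linorder} \<Rightarrow> real"
    and w :: "real \<Rightarrow> real"
    and \<alpha> :: real
  assumes "CARD('n) \<in> {2, 3}"
    and "0 < \<alpha>" and "\<alpha> < 2"
    and "C_k 6 u" and "compactly_supported u"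
    and "C_k 3 w" and "compactly_supported w"
    and "\<And>z. w z = w (- z)"
    and "\<And>z. 0 \<le> w z" and "\<And>z. w z \<le> 1"
    and "(\<lambda>z. 1 - w z) \<in> O[at 0](\<lambda>z. \<bar>z\<bar> ^ 3)"
  shows "(\<lambda>h.
      frac_laplacian_const \<alpha> CARD('n) *
        (\<integral>y. (u 0 - u y +
              w (norm y) *
                (\<Sum>\<beta> | 1 \<le> multi_size \<beta> \<and> multi_size \<beta> \<le> 3.
                   multi_deriv \<beta> u 0 / multi_fact \<beta> * multi_power y \<beta>))
             / norm y powr (real CARD('n) + \<alpha>) \<partial>lborel)
      - frac_laplacian_const \<alpha> CARD('n) * h ^ CARD('n) *
          (A1 TYPE('n) \<alpha> h * u 0
           - (\<Sum>\<^sub>\<infinity>j\<in>UNIV - {0 :: (int, 'n) vec}.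
                u (grid_point h j) / norm (grid_point h j) powr (real CARD('n) + \<alpha>))
           + A2 TYPE('n) w \<alpha> h * laplacian u 0))
    \<in> O[at_right 0](\<lambda>h. h\<^sup>2)"
proof -
  let ?p = "real CARD('n) + \<alpha>" and ?J = "UNIV - {0 :: (int, 'n) vec}"
  define F where "F y = u 0 - u y + w (norm y) * (\<Sum>\<beta> | 1 \<le> multi_size \<beta> \<and> multi_size \<beta> \<le> 3.
                   multi_deriv \<beta> u 0 / multi_fact \<beta> * multi_power y \<beta>)" for y
  define f where "f y = F y / norm y powr ?p" for y
  have d: "CARD('n) \<le> 3" using assms(1) by auto
  have p: "?p \<ge> 0" using assms(2) by simp
  have u4: "C_k 4 u" and u2: "C_k 2 u" using C_k_le[OF assms(4)] by simp_all
  have cu: "continuous_on UNIV u" and cw: "continuous_on UNIV w"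
    using C_k_continuous assms(4,6) by blast+
  have int: "integrable lborel (\<lambda>y :: (real, 'n) vec. radial_weight ?p (norm y))"
    using integrable_radial_weight[of \<alpha>, where 'a = "(real, 'n) vec"] assms(2,3) by simp
  \<comment> \<open>Here \<open>q = \<alpha> + 2\<close> must stay below 4, which is the condition
    \<open>\<alpha> < 2\<close>.\<close>
  have int2: "integrable lborel (\<lambda>y :: (real, 'n) vec. radial_weight (?p + 2) (norm y))"
    using integrable_radial_weight[of "\<alpha> + 2", where 'a = "(real, 'n) vec"] assms(2,3) by (simp add: add.assoc)
  obtain C0 where "symbol_on (- {0}) (\<lambda>y. C0 * min (norm y ^ 4) 1) F"
    using symbol_on_numerator[OF u4 assms(5,6,7,10,11)] unfolding F_def[abs_def] by blast
  then obtain C1 where C1: "symbol_on (- {0}) (\<lambda>y. C1 * radial_weight ?p (norm y)) f"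
    unfolding f_def[abs_def] using symbol_on_quotient[OF _ p] by blast
  define C where "C = \<bar>C1\<bar>"
  have C: "symbol_on (- {0}) (\<lambda>y. C * radial_weight ?p (norm y)) f"
    using C1 by (rule symbol_on_mono) (auto simp: C_def intro!: mult_right_mono)
  have "continuous_on UNIV F"
    unfolding F_def by (intro continuous_intros cu continuous_on_compose2[OF cw]) auto
  then have [measurable]: "F \<in> borel_measurable borel" by (rule borel_measurable_continuous_onI)
  have meas: "f \<in> borel_measurable borel" unfolding f_def by measurable
  \<comment> \<open>By the conventions for \<open>0 powr p\<close> and division by zero; the weight
    bound on \<open>f\<close> then holds at the origin too, where both sides are 0.\<close>
  have f0: "f 0 = 0" by (simp add: f_def)
  \<comment> \<open>All dependence on \<open>h\<close> sits in the explicit factor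
    \<open>h\<^sup>2\<close>, so \<open>E\<close> times the normalizing constant can serve in the
    big-O.\<close>
  define E where "E = (2 * C * (16 ^ 4 * 16 powr (?p + 2))\<^sup>2 + C) *
    (\<integral>y. radial_weight (?p + 2) (norm (y :: (real, 'n) vec)) \<partial>lborel)"
  let ?A = "\<lambda>h. A1 TYPE('n) \<alpha> h * u 0
           - (\<Sum>\<^sub>\<infinity>j\<in>?J. u (grid_point h j) / norm (grid_point h j) powr ?p)
           + A2 TYPE('n) w \<alpha> h * laplacian u 0"
  let ?\<kappa> = "frac_laplacian_const \<alpha> CARD('n)"
  have main: "\<bar>(\<integral>y. f y \<partial>lborel) - h ^ CARD('n) * ?A h\<bar> \<le> E * h\<^sup>2" if h: "h > 0" for h
  proof -
    have "(\<Sum>\<^sub>\<infinity>j\<in>?J. f (grid_point h j)) = ?A h"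
      unfolding f_def F_def by (rule lattice_sum_numerator[OF h d p int u2 assms(5) cw assms(7)])
    then show ?thesis
      using lattice_quadrature_error[OF h d p _ C f0 meas int int2] unfolding E_def C_def by simp
  qed
  have "norm (?\<kappa> * (\<integral>y. f y \<partial>lborel) - ?\<kappa> * h ^ CARD('n) * ?A h) \<le> (\<bar>?\<kappa>\<bar> * E) * norm (h\<^sup>2)" if "h > 0" for h
  proof -
    have "?\<kappa> * (\<integral>y. f y \<partial>lborel) - ?\<kappa> * h ^ CARD('n) * ?A h = ?\<kappa> * ((\<integral>y. f y \<partial>lborel) - h ^ CARD('n) * ?A h)"
      by (simp add: right_diff_distrib mult.assoc)
    then show ?thesis
      using mult_left_mono[OF main[OF that], of "\<bar>?\<kappa>\<bar>"] by (simp add: abs_mult mult.assoc)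
  qed
  then have "\<forall>\<^sub>F h in at_right 0. norm (?\<kappa> * (\<integral>y. f y \<partial>lborel) - ?\<kappa> * h ^ CARD('n) * ?A h) \<le> (\<bar>?\<kappa>\<bar> * E) * norm (h\<^sup>2)"
    by (auto simp: eventually_at_filter)
  then show ?thesis unfolding f_def F_def by (rule bigoI)
qed

end
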